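(* For every $\mathcal{C}_1,\mathcal{C}_2\in\mathscr{C}$, as $E\to\infty$, $$\mathbf{Cov}[\phi_E(\mathcal{C}_1),\phi_E(\mathcal{C}_2)]=\frac{\lambda(\mathcal{C}_1,\mathcal{C}_2)}{16\pi^2\sqrt E}+o\left(\frac1{\sqrt E}\right),$$ where $\lambda(\mathcal{C}_1,\mathcal{C}_2)$ is the signed length of $\mathcal{C}_1\cap\mathcal{C}_2$. In particular, for every $\mathcal{C}\in\mathscr{C}$, as $E\to\infty$, $$\mathbf{Var}[\phi_E(\mathcal{C})]=\frac{\mathrm{length}(\mathcal{C})}{16\pi^2\sqrt E}+o\left(\frac1{\sqrt E}\right).$$
   Context: For $E>0$, $B_E=\{B_E(x):x\in\mathbb{R}^2\}$ (Berry's random plane wave) is the centered smooth Gaussian field on $\mathbb{R}^2$ with covariance $\mathbb{E}[B_E(x)B_E(y)]=J_0(2\pi\sqrt E\,\|x-y\|)$, $J_0$ being the Bessel function of the first kind of order $0$. An oriented segment $S$ is the image of a map $\gamma:[0,L]\to\mathbb{R}^2$, $\gamma(t)=p+t(\cos\theta,\sin\theta)$, with $L>0$ (its length), $p\in\mathbb{R}^2$, $\theta\in[0,2\pi)$; its unit normal is $\mathrm{n}_S=(-\sin\theta,\cos\theta)$. A (simple) polygonal chain is an ordered collection $\mathcal{C}=(S_1,\dots,S_m)$ of oriented segments, with parametrizations $\gamma_k$ on $[0,L_k]$, such that $\gamma_k(L_k)=\gamma_{k+1}(0)$ for $k=1,\dots,m-1$ and $\bigcup_k S_k$ defines a simple curve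 in $\mathbb{R}^2$ (closed if $\gamma_m(L_m)=\gamma_1(0)$). $\mathscr{C}$ is the class of all polygonal chains. For $x$ in the relative interior of $S_k$, $\mathrm{n}_{\mathcal{C}}(x):=\mathrm{n}_{S_k}$, and $\mathrm{n}_{\mathcal{C}}(x):=0$ at the remaining finitely many points. The signed length for two oriented segments is $\lambda(S_1,S_2):=\mathrm{length}(S_1\cap S_2)\,\langle \mathrm{n}_{S_1},\mathrm{n}_{S_2}\rangle$, and for chains $\mathcal{A}=(T_1,\dots,T_n)$, $\mathcal{C}=(S_1,\dots,S_m)$, $\lambda(\mathcal{A},\mathcal{C}):=\sum_{i=1}^n\sum_{k=1}^m\lambda(T_i,S_k)$. For $\mathcal{C}\in\mathscr{C}$ and $E>0$, $$\phi_E(\mathcal{C}):=\frac{1}{8\pi\sqrt{2E}}\int_{\mathcal{C}}B_E(x)\langle\nabla B_E(x),\mathrm{n}_{\mathcal{C}}(x)\rangle\,\mathcal{H}^1(dx),$$ with $\mathcal{H}^1$ the one-dimensional Hausdorff measure. *)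

theory Defs
  imports "HOL-Probability.Probability"
begin

section \<open>One-dimensional Hausdorff measure\<close>

text \<open>The coverings are restricted to bounded sets because \<^const>\<open>diameter\<close> is only
  meaningful for those.  In dimension one the usual normalising constant is 1, so that the measure
  of a segment is its length.\<close>

definition hausdorff1_pre :: "real \<Rightarrow> 'a::metric_space set \<Rightarrow> ennreal" where
  "hausdorff1_pre \<delta> A =
     (INF U \<in> {U :: nat \<Rightarrow> 'a set. A \<subseteq> (\<Union>i. U i) \<and> (\<forall>i. bounded (U i) \<and> diameter (U i) \<le> \<delta>)}.
        \<Sum>i. ennreal (diameter (U i)))"

definition hausdorff1_outer :: "'a::metric_space set \<Rightarrow> ennreal" where
  "hausdorff1_outer A = (SUP \<delta> \<in> {0<..}. hausdorff1_pre \<delta> A)"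

definition hausdorff1 :: "'a::metric_space measure" where
  "hausdorff1 = measure_of UNIV (sets borel) hausdorff1_outer"


section \<open>Oriented segments and polygonal chains\<close>

datatype oseg = OSeg (seg_start: "real^2") (seg_angle: real) (seg_length: real)

definition is_oseg :: "oseg \<Rightarrow> bool" where
  "is_oseg S \<longleftrightarrow> seg_length S > 0 \<and> 0 \<le> seg_angle S \<and> seg_angle S < 2 * pi"

definition seg_param :: "oseg \<Rightarrow> real \<Rightarrow> real^2" where
  "seg_param S t = seg_start S + t *\<^sub>R vector [cos (seg_angle S), sin (seg_angle S)]"

definition seg_set :: "oseg \<Rightarrow> (real^2) set" where
  "seg_set S = seg_param S ` {0..seg_length S}"

definition seg_normal :: "oseg \<Rightarrow> real^2" where
  "seg_normal S = vector [- sin (seg_angle S), cos (seg_angle S)]"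

definition chain_set :: "oseg list \<Rightarrow> (real^2) set" where
  "chain_set C = (\<Union>S \<in> set C. seg_set S)"

text \<open>The concatenated curve traversed by a nonempty chain.\<close>

fun chain_path :: "oseg list \<Rightarrow> real \<Rightarrow> real^2" where
  "chain_path [] = (\<lambda>_. 0)"
| "chain_path [S] = linepath (seg_param S 0) (seg_param S (seg_length S))"
| "chain_path (S # T # C) =
     linepath (seg_param S 0) (seg_param S (seg_length S)) +++ chain_path (T # C)"

text \<open>Simplicity is required of the concatenated curve and not just of its image: the latter would
  admit chains that run back over themselves, for which there is no well-defined normal.
  \<^const>\<open>simple_path\<close> allows the two endpoints of the curve to coincide, which gives the
  closed chains.\<close>

definition polygonal_chain :: "oseg list \<Rightarrow> bool" where
  "polygonal_chain C \<longleftrightarrow>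
     C \<noteq> [] \<and> (\<forall>S \<in> set C. is_oseg S) \<and>
     (\<forall>k. Suc k < length C \<longrightarrow> seg_param (C ! k) (seg_length (C ! k)) = seg_param (C ! Suc k) 0) \<and>
     simple_path (chain_path C)"

text \<open>For a chain, the relative interiors of distinct segments are disjoint, so the choice below
  is unique.\<close>

definition chain_normal :: "oseg list \<Rightarrow> real^2 \<Rightarrow> real^2" where
  "chain_normal C x =
     (if \<exists>k < length C. x \<in> rel_interior (seg_set (C ! k))
      then seg_normal (C ! (THE k. k < length C \<and> x \<in> rel_interior (seg_set (C ! k))))
      else 0)"

definition chain_length :: "oseg list \<Rightarrow> real" where
  "chain_length C = measure hausdorff1 (chain_set C)"

definition seg_signed_length :: "oseg \<Rightarrow> oseg \<Rightarrow> real" where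
  "seg_signed_length S T =
     measure hausdorff1 (seg_set S \<inter> seg_set T) * (seg_normal S \<bullet> seg_normal T)"

definition signed_length :: "oseg list \<Rightarrow> oseg list \<Rightarrow> real" where
  "signed_length A C =
     (\<Sum>i<length A. \<Sum>k<length C. seg_signed_length (A ! i) (C ! k))"


section \<open>Berry's random plane wave\<close>

definition bessel_J0 :: "real \<Rightarrow> real" where
  "bessel_J0 z = (\<Sum>k. (-1) ^ k / (fact k)\<^sup>2 * (z / 2) ^ (2 * k))"

text \<open>Degenerate (almost surely constant) Gaussian variables are included.\<close>

definition gaussian_rv :: "'w measure \<Rightarrow> ('w \<Rightarrow> real) \<Rightarrow> bool" where
  "gaussian_rv M X \<longleftrightarrow>
     X \<in> borel_measurable M \<and>
     (\<exists>\<mu> \<sigma>. (\<sigma> > 0 \<and> distributed M lborel X (\<lambda>x. ennreal (normal_density \<mu> \<sigma> x))) \<or>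
            (AE w in M. X w = \<mu>))"

definition gaussian_field :: "'w measure \<Rightarrow> ('i \<Rightarrow> 'w \<Rightarrow> real) \<Rightarrow> bool" where
  "gaussian_field M X \<longleftrightarrow>
     (\<forall>F c. finite F \<longrightarrow> gaussian_rv M (\<lambda>w. \<Sum>i\<in>F. c i * X i w))"

fun Ck_fun :: "nat \<Rightarrow> ('a::euclidean_space \<Rightarrow> real) \<Rightarrow> bool" where
  "Ck_fun 0 f = continuous_on UNIV f"
| "Ck_fun (Suc n) f =
     (f differentiable_on UNIV \<and> (\<forall>b \<in> Basis. Ck_fun n (\<lambda>x. frechet_derivative f (at x) b)))"

definition smooth_fun :: "('a::euclidean_space \<Rightarrow> real) \<Rightarrow> bool" where
  "smooth_fun f \<longleftrightarrow> (\<forall>n. Ck_fun n f)"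

definition gradient :: "('a::real_inner \<Rightarrow> real) \<Rightarrow> 'a \<Rightarrow> 'a" where
  "gradient f x = (THE D. GDERIV f x :> D)"

definition berry_wave :: "'w measure \<Rightarrow> real \<Rightarrow> (real^2 \<Rightarrow> 'w \<Rightarrow> real) \<Rightarrow> bool" where
  "berry_wave M E B \<longleftrightarrow>
     prob_space M \<and>
     gaussian_field M B \<and>
     (\<forall>w \<in> space M. smooth_fun (\<lambda>x. B x w)) \<and>
     (\<forall>x. prob_space.expectation M (B x) = 0) \<and>
     (\<forall>x y. prob_space.expectation M (\<lambda>w. B x w * B y w) =
              bessel_J0 (2 * pi * sqrt E * norm (x - y)))"

definition covariance :: "'w measure \<Rightarrow> ('w \<Rightarrow> real) \<Rightarrow> ('w \<Rightarrow> real) \<Rightarrow> real" where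
  "covariance M X Y =
     prob_space.expectation M
       (\<lambda>w. (X w - prob_space.expectation M X) * (Y w - prob_space.expectation M Y))"

definition phi :: "real \<Rightarrow> (real^2 \<Rightarrow> 'w \<Rightarrow> real) \<Rightarrow> oseg list \<Rightarrow> 'w \<Rightarrow> real" where
  "phi E B C w =
     1 / (8 * pi * sqrt (2 * E)) *
     (LINT x:chain_set C|hausdorff1. B x w * (gradient (\<lambda>y. B y w) x \<bullet> chain_normal C x))"

end

theory Submission
  imports Defs "HOL-Real_Asymp.Real_Asymp"
begin

text \<open>
  Write \<open>k = 2 \<pi> \<surd>E\<close> and \<open>F z = J\<^sub>0(k |z|)\<^sup>2\<close>.  Since \<open>B \<partial>\<^sub>n B\<close> is half the
  derivative of \<open>B\<^sup>2\<close> and \<open>E[B(x)\<^sup>2 B(y)\<^sup>2] = 1 + 2 F(x - y)\<close>, mean-square limits of difference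
  quotients show that \<open>B \<partial>\<^sub>n B (x)\<close> and \<open>B \<partial>\<^sub>m B (y)\<close> have covariance
  \<open>- \<partial>\<^sub>n \<partial>\<^sub>m F (x - y) / 2\<close>, so the covariance of two fluxes is a double integral over pairs of
  segments.  In the plane \<open>\<partial>\<^sub>n \<partial>\<^sub>m F = \<langle>n, m\<rangle> \<Delta>F - \<partial>\<^sub>\<sigma> \<partial>\<^sub>\<tau> F\<close>, where \<open>\<sigma>, \<tau>\<close> are the
  tangents: the last term integrates to corner values of \<open>F\<close>, and
  \<open>- \<Delta>F = 2 k\<^sup>2 e'(k |z|)\<close> with \<open>e(u) = u (J\<^sub>0(u)\<^sup>2 + J\<^sub>1(u)\<^sup>2)\<close>.

  Integrated along a line through the point, \<open>k e'(k r)\<close> gives boundary values of \<open>e\<close>; along any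
  other line it tends to \<open>0\<close> because \<open>e(u)\<close> converges to \<open>2 / \<pi>\<close>.  This limit comes from
  \<open>e(u) - J\<^sub>0(u) J\<^sub>1(u) = \<integral>\<^sub>0\<^sup>u J\<^sub>0(t) J\<^sub>1(t) / t dt\<close>, the product formula
  \<open>J\<^sub>0(u) J\<^sub>1(u) = 2 / \<pi> \<integral>\<^sub>0\<^bsup>\<pi>/2\<^esup> J\<^sub>1(2 u sin \<theta>) sin \<theta> d\<theta>\<close> and
  \<open>\<integral>\<^sub>0\<^sup>\<infinity> J\<^sub>1(t) / t dt = 1\<close>.
\<close>

text \<open>The obstacle is the size of the kernel. Uniformly in \<open>k\<close>,
  \<open>k e'(k r)\<close> is only \<open>O(1 / r)\<close>, which is not integrable along a line
  through the point, so absolute values are too crude and the cancellation is kept in exact form. On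
  an overlap the antiderivative \<open>e(k v)\<close> is explicit, and an interior point collects
  the limit \<open>2 / pi\<close> from either side; this is the source of the factor
  \<open>4 / pi\<close> per unit of overlap. On a line at distance \<open>d\<close> the integral is
  at most a multiple of \<open>1 / sqrt d\<close> for all \<open>k\<close>. This is integrable
  across a transversal crossing, so one dominated convergence argument serves parallel, crossing and
  disjoint segments.

  The integral formulas yield the limit of \<open>e\<close> without amplitude and phase expansions
  of the Bessel functions. The hypotheses give Gaussian laws only for finite combinations of values
  of the field, hence difference quotients instead of a joint law of field and gradient.

  The corner values stay bounded while the main term grows like \<open>k = 2 pi sqrt E\<close>, and
  the prefactors combine to \<open>(4 / pi) k / (128 pi^2 E) = 1 / (16 pi^2 sqrt E)\<close>.\<close>

lemma has_integral_real_derivative: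
  fixes f :: "real \<Rightarrow> real"
  assumes "a \<le> b" and "\<And>x. x \<in> {a..b} \<Longrightarrow> (f has_real_derivative f' x) (at x within {a..b})"
  shows "(f' has_integral (f b - f a)) {a..b}"
  using assms fundamental_theorem_of_calculus[of a b f f']
  by (simp add: has_real_derivative_iff_has_vector_derivative)

section \<open>Bessel functions\<close>

text \<open>Series in \<open>q = u^2\<close> make the covariance an entire function of the squared
  norm, so the origin needs no separate treatment and no square root is differentiated.
  \<open>j1_coeff\<close> belongs to \<open>J1 u / u\<close>.\<close>

definition j0_coeff :: "nat \<Rightarrow> real" where
  "j0_coeff n = (-1/4) ^ n / (fact n)\<^sup>2"

definition j1_coeff :: "nat \<Rightarrow> real" where
  "j1_coeff n = (-1/4) ^ n / (2 * fact n * fact (Suc n))"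

definition j0_series :: "real \<Rightarrow> real" where
  "j0_series q = (\<Sum>n. j0_coeff n * q ^ n)"

definition j1_series :: "real \<Rightarrow> real" where
  "j1_series q = (\<Sum>n. j1_coeff n * q ^ n)"

definition j1_series_deriv :: "real \<Rightarrow> real" where
  "j1_series_deriv q = (\<Sum>n. diffs j1_coeff n * q ^ n)"

lemma summable_of_exp_bound:
  fixes c :: "nat \<Rightarrow> real"
  assumes "\<And>n. \<bar>c n\<bar> \<le> 1 / fact n"
  shows "summable (\<lambda>n. norm (c n * q ^ n))"
proof (rule summable_comparison_test')
  show "summable (\<lambda>n. inverse (fact n) * \<bar>q\<bar> ^ n)"
    by (rule summable_exp)
  fix n :: nat
  show "norm (norm (c n * q ^ n)) \<le> inverse (fact n) * \<bar>q\<bar> ^ n"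
    using mult_right_mono[OF assms[of n], of "\<bar>q\<bar> ^ n"]
    by (simp add: abs_mult power_abs divide_inverse)
qed

lemma abs_j0_coeff_le: "\<bar>j0_coeff n\<bar> \<le> 1 / fact n"
proof -
  have "(1/4 :: real) ^ n \<le> 1" by (simp add: power_le_one)
  moreover have "fact n \<le> ((fact n)\<^sup>2 :: real)"
    using fact_ge_1[of n, where 'a = real] by (simp add: power2_eq_square)
  ultimately show ?thesis
    unfolding j0_coeff_def by (simp add: power_abs frac_le)
qed

lemma abs_j1_coeff_le: "\<bar>j1_coeff n\<bar> \<le> 1 / fact n"
proof -
  have "(1/4 :: real) ^ n \<le> 1" by (simp add: power_le_one)
  moreover have "fact n \<le> (2 * fact n * fact (Suc n) :: real)"
    using mult_left_mono[of 1 "2 * fact (Suc n) :: real" "fact n"]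
      fact_ge_1[of "Suc n", where 'a = real]
    by (simp del: fact_Suc fact_ge_1 add: mult_ac)
  ultimately show ?thesis
    unfolding j1_coeff_def by (simp add: power_abs frac_le abs_mult del: fact_Suc)
qed

lemma summable_norm_j0: "summable (\<lambda>n. norm (j0_coeff n * q ^ n))"
  by (rule summable_of_exp_bound[OF abs_j0_coeff_le])

lemma summable_norm_j1: "summable (\<lambda>n. norm (j1_coeff n * q ^ n))"
  by (rule summable_of_exp_bound[OF abs_j1_coeff_le])

lemma summable_j0: "summable (\<lambda>n. j0_coeff n * q ^ n)"
  using summable_norm_j0 by (rule summable_norm_cancel)

lemma summable_j1: "summable (\<lambda>n. j1_coeff n * q ^ n)"
  using summable_norm_j1 by (rule summable_norm_cancel)

lemma bessel_J0_eq_series: "bessel_J0 u = j0_series (u\<^sup>2)"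
  unfolding bessel_J0_def j0_series_def j0_coeff_def
  by (intro suminf_cong)
    (simp add: power_mult power_divide power_minus'[of "1/4 :: real"] power_one_over)

text \<open>With \<open>q = u^2\<close> one has \<open>d/dq = (1 / (2 u)) d/du\<close>, so
  \<open>J0' = - J1\<close> becomes the factor \<open>-1/2\<close> in front of the series of
  \<open>J1 u / u\<close>.\<close>

lemma diffs_j0_coeff: "diffs j0_coeff n = - j1_coeff n / 2"
proof -
  have "diffs j0_coeff n = (1 + real n) * ((- (1/4)) * (- (1/4)) ^ n / ((1 + real n) * fact n)\<^sup>2)"
    by (simp add: diffs_def j0_coeff_def)
  also have "\<dots> = - ((- (1/4)) ^ n / (4 * fact n * ((1 + real n) * fact n)))"
    by (simp add: power2_eq_square divide_simps)
  finally show ?thesis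
    by (simp add: j1_coeff_def)
qed

lemma has_real_derivative_j0_series [derivative_intros]:
  assumes "(f has_real_derivative f') (at x within S)"
  shows "((\<lambda>x. j0_series (f x)) has_real_derivative - j1_series (f x) / 2 * f') (at x within S)"
proof -
  have "(j0_series has_real_derivative (\<Sum>n. diffs j0_coeff n * q ^ n)) (at q)" for q
    unfolding j0_series_def[abs_def]
    by (rule termdiffs_strong_converges_everywhere[OF summable_j0])
  moreover have "(\<Sum>n. diffs j0_coeff n * q ^ n) = - j1_series q / 2" for q
    using suminf_mult[OF summable_j1, of "-1/2" q]
    by (simp add: diffs_j0_coeff j1_series_def)
  ultimately have "(j0_series has_real_derivative - j1_series q / 2) (at q)" for q
    by metis
  then show ?thesis
    by (rule DERIV_chain2[OF _ assms])
qed

lemma has_real_derivative_j1_series [derivative_intros]: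
  assumes "(f has_real_derivative f') (at x within S)"
  shows "((\<lambda>x. j1_series (f x)) has_real_derivative j1_series_deriv (f x) * f') (at x within S)"
proof -
  have "(j1_series has_real_derivative j1_series_deriv q) (at q)" for q
    unfolding j1_series_def[abs_def] j1_series_deriv_def
    by (rule termdiffs_strong_converges_everywhere[OF summable_j1])
  then show ?thesis
    by (rule DERIV_chain2[OF _ assms])
qed

lemma isCont_j1_series_deriv: "isCont j1_series_deriv q"
  unfolding j1_series_deriv_def[abs_def]
  by (rule isCont_powser_converges_everywhere, rule termdiff_converges_all[OF summable_j1])

lemma continuous_on_j0_series [continuous_intros]:
  "continuous_on S f \<Longrightarrow> continuous_on S (\<lambda>x. j0_series (f x))"
  by (rule continuous_on_compose2[of UNIV j0_series])
    (auto intro!: DERIV_continuous_on derivative_eq_intros)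

lemma continuous_on_j1_series [continuous_intros]:
  "continuous_on S f \<Longrightarrow> continuous_on S (\<lambda>x. j1_series (f x))"
  by (rule continuous_on_compose2[of UNIV j1_series])
    (auto intro!: DERIV_continuous_on derivative_eq_intros)

lemma continuous_on_j1_series_deriv [continuous_intros]:
  "continuous_on S f \<Longrightarrow> continuous_on S (\<lambda>x. j1_series_deriv (f x))"
  by (rule continuous_on_compose2[of UNIV j1_series_deriv])
    (auto intro!: continuous_at_imp_continuous_on isCont_j1_series_deriv)

text \<open>Bessel's equation of order zero, in the variable \<open>q = u\<^sup>2\<close>.\<close>

lemma j0_series_ode: "2 * q * j1_series_deriv q + 2 * j1_series q = j0_series q"
proof -
  have "(\<lambda>n. real n * j1_coeff n * q ^ n) sums (q * j1_series_deriv q)"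
  proof -
    have "(\<lambda>n. diffs j1_coeff n * q ^ n) sums j1_series_deriv q"
      unfolding j1_series_deriv_def
      by (rule summable_sums, rule termdiff_converges_all[OF summable_j1])
    then have "(\<lambda>n. q * (diffs j1_coeff n * q ^ n)) sums (q * j1_series_deriv q)"
      by (rule sums_mult)
    then have "(\<lambda>n. real (Suc n) * j1_coeff (Suc n) * q ^ Suc n) sums (q * j1_series_deriv q)"
      by (simp add: diffs_def mult_ac)
    \<comment> \<open>Reindexing adds only the term at \<open>n = 0\<close>, which vanishes.\<close>
    then show ?thesis
      by (subst (asm) sums_Suc_iff) simp
  qed
  moreover have "(\<lambda>n. j1_coeff n * q ^ n) sums j1_series q"
    unfolding j1_series_def by (rule summable_sums[OF summable_j1])
  ultimately have
    "(\<lambda>n. 2 * (real n * j1_coeff n * q ^ n) + 2 * (j1_coeff n * q ^ n)) sums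
      (2 * (q * j1_series_deriv q) + 2 * j1_series q)"
    by (intro sums_add sums_mult)
  moreover have "2 * (real n * j1_coeff n * q ^ n) + 2 * (j1_coeff n * q ^ n)
      = j0_coeff n * q ^ n" for n
  proof -
    have "(2 * real n + 2) * j1_coeff n = j0_coeff n"
      by (simp add: j0_coeff_def j1_coeff_def power2_eq_square divide_simps)
    then show ?thesis
      by (metis (no_types, lifting) distrib_right mult.assoc)
  qed
  moreover have "(\<lambda>n. j0_coeff n * q ^ n) sums j0_series q"
    unfolding j0_series_def by (rule summable_sums[OF summable_j0])
  ultimately have "2 * (q * j1_series_deriv q) + 2 * j1_series q = j0_series q"
    using sums_unique2 by (metis (no_types, lifting) sums_cong)
  then show ?thesis by simp
qed

section \<open>Wallis integrals and integral representations\<close>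

lemma central_binomial_Suc:
  "real ((2 * Suc n) choose Suc n) = 2 * (2 * real n + 1) / (real n + 1) * real ((2 * n) choose n)"
proof -
  have 1: "real ((2 * m) choose m) = fact (2 * m) / (fact m * fact m)" for m
    using binomial_fact[of m "2 * m", where 'a = real] by simp
  have 2: "fact (2 * Suc n) = (2 * real n + 2) * ((2 * real n + 1) * fact (2 * n))"
    by (simp add: algebra_simps)
  have 3: "fact (Suc n) = (real n + 1) * fact n"
    by simp
  have "(2 * x + 2) * ((2 * x + 1) * g) / ((x + 1) * f * ((x + 1) * f)) =
      2 * (2 * x + 1) / (x + 1) * (g / (f * f))" if "x \<ge> 0" "f > 0" for x f g :: real
    using that by (simp add: divide_simps) (simp add: algebra_simps)
  then show ?thesis
    unfolding 1 2 3 by simp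
qed

text \<open>Wallis' integrals. The derivative of \<open>sin ^ (2 n + 1) * cos\<close> integrates to
  0 over the quarter period, which links the exponents \<open>2 n\<close> and
  \<open>2 n + 2\<close>; the ratio is that of consecutive central binomial coefficients, up to the
  factor 4.\<close>

lemma integral_sin_power:
  "((\<lambda>\<theta>. sin \<theta> ^ (2 * n)) has_integral (pi / 2 * (real ((2 * n) choose n) / 4 ^ n))) {0..pi/2}"
proof (induction n)
  case 0
  show ?case
    using has_integral_const_real[of "1::real" 0 "pi/2"] by simp
next
  case (Suc n)
  let ?F = "\<lambda>\<theta>::real. sin \<theta> ^ (2 * n + 1) * cos \<theta>"
  let ?f = "\<lambda>\<theta>::real. real (2 * n + 1) * sin \<theta> ^ (2 * n) - real (2 * n + 2) * sin \<theta> ^ (2 * Suc n)"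
  have "(?f has_integral (?F (pi/2) - ?F 0)) {0..pi/2}"
  proof (rule has_integral_real_derivative)
    fix \<theta> :: real
    have "(?F has_real_derivative
        (real (2 * n + 1) * (cos \<theta> * sin \<theta> ^ (2 * n)) * cos \<theta> - sin \<theta> * sin \<theta> ^ (2 * n + 1)))
        (at \<theta> within {0..pi/2})"
      unfolding Suc_eq_plus1[symmetric]
      by (rule derivative_eq_intros DERIV_power_Suc refl)+ (simp add: algebra_simps)
    moreover have cc: "cos \<theta> * cos \<theta> = 1 - sin \<theta> * sin \<theta>"
      using sin_cos_squared_add[of \<theta>] unfolding power2_eq_square by linarith
    have "real (2 * n + 1) * (cos \<theta> * sin \<theta> ^ (2 * n)) * cos \<theta> - sin \<theta> * sin \<theta> ^ (2 * n + 1)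
        = real (2 * n + 1) * sin \<theta> ^ (2 * n) * (1 - sin \<theta> * sin \<theta>) - sin \<theta> * sin \<theta> ^ (2 * n + 1)"
      unfolding cc[symmetric] by (simp only: mult_ac)
    also have "\<dots> = ?f \<theta>"
      by (simp add: algebra_simps)
    ultimately show "(?F has_real_derivative ?f \<theta>) (at \<theta> within {0..pi/2})"
      by simp
  qed simp
  then have "(?f has_integral 0) {0..pi/2}"
    by simp
  from has_integral_diff[OF has_integral_mult_right[OF Suc.IH, of "real (2 * n + 1)"] this]
  have "((\<lambda>\<theta>. real (2 * n + 2) * sin \<theta> ^ (2 * Suc n)) has_integral
      (real (2 * n + 1) * (pi / 2 * (real ((2 * n) choose n) / 4 ^ n)))) {0..pi/2}"
    by simp
  from has_integral_mult_right[OF this, of "1 / real (2 * n + 2)"]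
  have "((\<lambda>\<theta>. sin \<theta> ^ (2 * Suc n)) has_integral
      (1 / real (2 * n + 2) * (real (2 * n + 1) * (pi / 2 * (real ((2 * n) choose n) / 4 ^ n)))))
      {0..pi/2}"
  proof -
    have "1 / c * (c * x) = x" if "c \<noteq> 0" for c x :: real
      using that by simp
    from this[of "real (2 * n + 2)"] \<open>(_ has_integral 1 / real (2 * n + 2) * _) _\<close>
    show ?thesis by simp
  qed
  moreover note central_binomial_Suc[of n]
  then have "1 / real (2 * n + 2) * (real (2 * n + 1) * (pi / 2 * (real ((2 * n) choose n) / 4 ^ n)))
      = pi / 2 * (real ((2 * Suc n) choose Suc n) / 4 ^ Suc n)"
    by (simp add: divide_simps del: binomial_Suc_Suc mult_Suc_right) (simp add: algebra_simps)
  ultimately show ?case by simp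
qed

text \<open>Common source of the two Bessel formulas below: integration against \<open>sin^2\<close>
  multiplies the coefficient of \<open>q ^ n\<close> by a Wallis factor, so each formula reduces to
  an identity between coefficients. As \<open>sin^2\<close> is at most 1, the series at
  \<open>q\<close> dominates uniformly in the angle.\<close>

lemma integral_sin_sq_power_series:
  fixes c :: "nat \<Rightarrow> real"
  assumes summ: "\<And>q. summable (\<lambda>n. norm (c n * q ^ n))"
    and sums: "(\<lambda>n. c n * (real ((2 * n + 2) choose (n + 1)) / 4 ^ (n + 1)) * q ^ n) sums s"
  shows "((\<lambda>\<theta>. (sin \<theta>)\<^sup>2 * (\<Sum>n. c n * (q * (sin \<theta>)\<^sup>2) ^ n)) has_integral (pi / 2 * s)) {0..pi/2}"
proof -
  let ?f = "\<lambda>n \<theta>. (sin \<theta>)\<^sup>2 * (c n * (q * (sin \<theta>)\<^sup>2) ^ n)"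
  have sq: "(sin \<theta>)\<^sup>2 \<le> 1" for \<theta> :: real
    using abs_square_le_1 abs_sin_le_one by blast
  have int_term: "((\<lambda>\<theta>. ?f n \<theta>) has_integral
      (pi / 2 * (c n * (real ((2 * n + 2) choose (n + 1)) / 4 ^ (n + 1)) * q ^ n))) {0..pi/2}" for n
  proof -
    have "c n * q ^ n * sin \<theta> ^ (2 * Suc n) = ?f n \<theta>" for \<theta>
    proof -
      have "sin \<theta> ^ (2 * Suc n) = (sin \<theta>)\<^sup>2 * ((sin \<theta>)\<^sup>2) ^ n"
        by (simp only: power_mult power_Suc)
      then show ?thesis
        by (simp only: power_mult_distrib mult_ac)
    qed
    moreover have "c n * q ^ n * (pi / 2 * (real ((2 * Suc n) choose Suc n) / 4 ^ Suc n)) =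
        pi / 2 * (c n * (real ((2 * n + 2) choose (n + 1)) / 4 ^ (n + 1)) * q ^ n)"
    proof -
      have "2 * Suc n = 2 * n + 2" "Suc n = n + 1" by simp_all
      then show ?thesis by (simp only: mult_ac times_divide_eq_left times_divide_eq_right)
    qed
    ultimately show ?thesis
      using has_integral_mult_right[OF integral_sin_power[of "Suc n"], of "c n * q ^ n"] by (simp only:)
  qed
  have unif: "uniform_limit (cbox 0 (pi/2)) (\<lambda>N \<theta>. \<Sum>n<N. ?f n \<theta>) (\<lambda>\<theta>. \<Sum>n. ?f n \<theta>) sequentially"
  proof (rule Weierstrass_m_test)
    fix n and \<theta> :: real
    have "norm (?f n \<theta>) = (sin \<theta>)\<^sup>2 * (\<bar>c n * q ^ n\<bar> * ((sin \<theta>)\<^sup>2) ^ n)"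
      by (simp add: abs_mult power_mult_distrib power_abs mult_ac)
    also have "\<dots> \<le> 1 * (\<bar>c n * q ^ n\<bar> * 1)"
      using sq by (intro mult_mono) (auto intro: power_le_one)
    finally show "norm (?f n \<theta>) \<le> norm (c n * q ^ n)"
      by simp
  qed (rule summ)
  obtain I J where I: "\<And>N. ((\<lambda>\<theta>. \<Sum>n<N. ?f n \<theta>) has_integral I N) (cbox 0 (pi/2))"
    and J: "((\<lambda>\<theta>. \<Sum>n. ?f n \<theta>) has_integral J) (cbox 0 (pi/2))" and IJ: "I \<longlonglongrightarrow> J"
    by (rule uniform_limit_integral_cbox[OF unif]) (auto intro!: continuous_intros)
  have "I N = (\<Sum>n<N. pi / 2 * (c n * (real ((2 * n + 2) choose (n + 1)) / 4 ^ (n + 1)) * q ^ n))" for N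
    using has_integral_unique[OF I] has_integral_sum[OF _ int_term, of "{..<N}"] by (auto simp: cbox_interval)
  then have "I = (\<lambda>N. \<Sum>n<N. pi / 2 * (c n * (real ((2 * n + 2) choose (n + 1)) / 4 ^ (n + 1)) * q ^ n))"
    by (rule ext)
  then have "(\<lambda>n. pi / 2 * (c n * (real ((2 * n + 2) choose (n + 1)) / 4 ^ (n + 1)) * q ^ n)) sums J"
    using IJ unfolding sums_def by (simp only:)
  moreover have "(\<lambda>n. pi / 2 * (c n * (real ((2 * n + 2) choose (n + 1)) / 4 ^ (n + 1)) * q ^ n))
      sums (pi / 2 * s)"
    by (rule sums_mult[OF sums])
  ultimately have "J = pi / 2 * s"
    by (rule sums_unique2)
  moreover have "(\<Sum>n. ?f n \<theta>) = (sin \<theta>)\<^sup>2 * (\<Sum>n. c n * (q * (sin \<theta>)\<^sup>2) ^ n)" for \<theta>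
    by (rule suminf_mult[OF summable_norm_cancel[OF summ]])
  ultimately show ?thesis
    using J by (simp only: cbox_interval)
qed

text \<open>Bessel's integral for \<open>J1 u\<close>, that is \<open>2 / pi\<close> times the
  integral of \<open>sin t * sin (u * sin t)\<close> over the quarter period, divided by
  \<open>u\<close>. The coefficients \<open>c\<close> are those of \<open>sinc x\<close> in powers
  of \<open>x^2\<close>.\<close>

lemma j1_series_eq_integral:
  "((\<lambda>\<theta>. (sin \<theta>)\<^sup>2 * sinc (u * sin \<theta>)) has_integral (pi / 2 * j1_series (u\<^sup>2))) {0..pi/2}"
proof -
  define c :: "nat \<Rightarrow> real" where "c n = (-1) ^ n / fact (2 * n + 1)" for n
  have c_le: "\<bar>c n\<bar> \<le> 1 / fact n" for n
    using fact_mono[of n "2 * n + 1", where 'a = real]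
    by (simp add: c_def power_abs frac_le del: fact_Suc)
  \<comment> \<open>The numerator \<open>fact (2 * n + 2)\<close> of the binomial coefficient
    contains \<open>fact (2 * n + 1)\<close>, which cancels the denominator of
    \<open>c n\<close>.\<close>
  have "c n * (real ((2 * n + 2) choose (n + 1)) / 4 ^ (n + 1)) = j1_coeff n" for n
  proof -
    have "real ((2 * n + 2) choose (n + 1)) = fact (2 * n + 2) / (fact (n + 1) * fact (n + 1))"
      using binomial_fact[of "n + 1" "2 * n + 2", where 'a = real] by simp
    also have "fact (2 * n + 2) = (2 * real n + 2) * (fact (2 * n + 1) :: real)"
      using fact_Suc[of "2 * n + 1", where 'a = real] by (simp del: fact_Suc)
    finally have 1: "real ((2 * n + 2) choose (n + 1)) =
        (2 * real n + 2) * fact (2 * n + 1) / (fact (n + 1) * fact (n + 1))" .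
    have 2: "fact (n + 1) = (real n + 1) * fact n"
      by simp
    have "s / g * ((2 * x + 2) * g / ((x + 1) * f * ((x + 1) * f)) / (4 * p)) =
        s / p / (2 * f * ((x + 1) * f))" if "x \<ge> 0" "f > 0" "g > 0" "p > 0" for x f g p s :: real
      using that by (simp add: divide_simps)
    from this[of "real n" "fact n" "fact (2 * n + 1)" "4 ^ n" "(-1) ^ n"]
      power_add[of "4::real" n 1]
    show ?thesis
      unfolding 1 2 c_def j1_coeff_def Suc_eq_plus1
      by (simp only: power_minus'[of "1/4 :: real"] power_one_over power_divide)
        (simp add: mult_ac del: fact_Suc binomial_Suc_Suc)
  qed
  then have "(\<lambda>n. c n * (real ((2 * n + 2) choose (n + 1)) / 4 ^ (n + 1)) * (u\<^sup>2) ^ n)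
      sums j1_series (u\<^sup>2)"
    unfolding j1_series_def using summable_sums[OF summable_j1] by simp
  from integral_sin_sq_power_series[OF summable_of_exp_bound[OF c_le] this]
  have "((\<lambda>\<theta>. (sin \<theta>)\<^sup>2 * (\<Sum>n. c n * (u\<^sup>2 * (sin \<theta>)\<^sup>2) ^ n)) has_integral
      (pi / 2 * j1_series (u\<^sup>2))) {0..pi/2}" .
  moreover have "(\<Sum>n. c n * (x\<^sup>2) ^ n) = sinc x" for x
  proof (cases "x = 0")
    case True
    have "(\<Sum>n. c n * 0 ^ n) = c 0"
      by simp
    then show ?thesis using True by (simp add: c_def)
  next
    case False
    have "(\<lambda>n. c n * x ^ (2 * n + 1) / x) sums (sin x / x)"
      using sums_divide[OF sin_paired[of x]] unfolding c_def .
    then have "(\<lambda>n. c n * (x\<^sup>2) ^ n) sums (sin x / x)"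
      using False by (simp add: power_mult)
    then show ?thesis
      using False by (simp add: sums_iff)
  qed
  ultimately show ?thesis
    by (simp flip: power_mult_distrib)
qed

text \<open>The coefficients of the Cauchy product are products of binomial coefficients.
  Vandermonde's identity sums them to \<open>(2 * n + 1) choose n\<close>, half a central binomial
  coefficient, which is what the Wallis factor provides.\<close>

lemma j0_j1_series_eq_integral:
  "((\<lambda>\<theta>. (sin \<theta>)\<^sup>2 * j1_series ((2 * u * sin \<theta>)\<^sup>2)) has_integral
    (pi / 4 * (j0_series (u\<^sup>2) * j1_series (u\<^sup>2)))) {0..pi/2}"
proof -
  let ?c = "\<lambda>n. j1_coeff n * 4 ^ n"
  have summ: "summable (\<lambda>n. norm (?c n * q ^ n))" for q
    using summable_norm_j1[of "4 * q"] by (simp add: power_mult_distrib mult_ac)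
  have "(\<lambda>n. \<Sum>i\<le>n. j0_coeff i * (u\<^sup>2) ^ i * (j1_coeff (n - i) * (u\<^sup>2) ^ (n - i)))
      sums (j0_series (u\<^sup>2) * j1_series (u\<^sup>2))"
    unfolding j0_series_def j1_series_def
    by (rule Cauchy_product_sums[OF summable_norm_j0 summable_norm_j1])
  moreover have "(\<Sum>i\<le>n. j0_coeff i * (u\<^sup>2) ^ i * (j1_coeff (n - i) * (u\<^sup>2) ^ (n - i)))
      = 2 * (?c n * (real ((2 * n + 2) choose (n + 1)) / 4 ^ (n + 1)) * (u\<^sup>2) ^ n)" for n
  proof -
    have "j0_coeff i * (u\<^sup>2) ^ i * (j1_coeff (n - i) * (u\<^sup>2) ^ (n - i))
        = j1_coeff n * (u\<^sup>2) ^ n * real ((Suc n choose i) * (n choose (n - i)))" if "i \<le> n" for i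
    proof -
      have 1: "real (n choose (n - i)) = fact n / (fact i * fact (n - i))"
        using that by (simp add: binomial_fact)
      have 2: "real (Suc n choose i) = fact (Suc n) / (fact i * fact (Suc (n - i)))"
        using that by (simp add: binomial_fact Suc_diff_le)
      have 3: "(u\<^sup>2) ^ i * (u\<^sup>2) ^ (n - i) = (u\<^sup>2) ^ n" "(-1/4::real) ^ i * (-1/4) ^ (n - i) = (-1/4) ^ n"
        using that by (simp_all flip: power_add)
      have "j0_coeff i * j1_coeff (n - i) =
          ((-1/4) ^ i * (-1/4) ^ (n - i)) / ((fact i)\<^sup>2 * (2 * fact (n - i) * fact (Suc (n - i))))"
        unfolding j0_coeff_def j1_coeff_def by simp
      also have "\<dots> = j1_coeff n * real ((Suc n choose i) * (n choose (n - i)))"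
        unfolding 3 of_nat_mult 1 2 j1_coeff_def
        by (simp add: power2_eq_square field_simps del: fact_Suc)
      finally show ?thesis
        using 3(1) by (simp add: mult_ac)
    qed
    then have "(\<Sum>i\<le>n. j0_coeff i * (u\<^sup>2) ^ i * (j1_coeff (n - i) * (u\<^sup>2) ^ (n - i)))
        = j1_coeff n * (u\<^sup>2) ^ n * real (\<Sum>i\<le>n. (Suc n choose i) * (n choose (n - i)))"
      by (simp add: sum_distrib_left)
    also have "(\<Sum>i\<le>n. (Suc n choose i) * (n choose (n - i))) = (2 * n + 1) choose n"
      by (subst vandermonde) (simp add: mult_2)
    also have "real ((2 * n + 1) choose n) = real ((2 * n + 2) choose (n + 1)) / 2"
    proof -
      have "(2 * n + 1) choose (n + 1) = (2 * n + 1) choose n"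
        using binomial_symmetric[of n "2 * n + 1"] by simp
      then have "((2 * n + 2) choose (n + 1)) = 2 * ((2 * n + 1) choose n)"
        using binomial_Suc_Suc[of "2 * n + 1" n] by simp
      then show ?thesis by simp
    qed
    finally show ?thesis
      by (simp only: power_add power_one_right) simp
  qed
  ultimately have "(\<lambda>n. ?c n * (real ((2 * n + 2) choose (n + 1)) / 4 ^ (n + 1)) * (u\<^sup>2) ^ n)
      sums (j0_series (u\<^sup>2) * j1_series (u\<^sup>2) / 2)"
    using sums_mult_iff[of "2 :: real" "\<lambda>n. ?c n * (real ((2 * n + 2) choose (n + 1)) / 4 ^ (n + 1)) * (u\<^sup>2) ^ n"
        "j0_series (u\<^sup>2) * j1_series (u\<^sup>2) / 2"] by simp
  from integral_sin_sq_power_series[OF summ this]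
  have "((\<lambda>\<theta>. (sin \<theta>)\<^sup>2 * (\<Sum>n. ?c n * (u\<^sup>2 * (sin \<theta>)\<^sup>2) ^ n)) has_integral
      (pi / 2 * (j0_series (u\<^sup>2) * j1_series (u\<^sup>2) / 2))) {0..pi/2}" .
  moreover have "(\<Sum>n. ?c n * (u\<^sup>2 * (sin \<theta>)\<^sup>2) ^ n) = j1_series ((2 * u * sin \<theta>)\<^sup>2)" for \<theta>
    unfolding j1_series_def
    by (intro suminf_cong) (simp add: power_mult_distrib mult_ac)
  ultimately show ?thesis by simp
qed


section \<open>Derivatives and first bounds\<close>

definition bessel_J1 :: "real \<Rightarrow> real" where
  "bessel_J1 u = u * j1_series (u\<^sup>2)"

lemma has_real_derivative_bessel_J0 [derivative_intros]:
  assumes "(f has_real_derivative f') (at x within S)"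
  shows "((\<lambda>x. bessel_J0 (f x)) has_real_derivative - bessel_J1 (f x) * f') (at x within S)"
  unfolding bessel_J0_eq_series
  by (rule derivative_eq_intros assms refl)+ (simp add: bessel_J1_def)

text \<open>The quotient \<open>J\<^sub>1 u / u\<close> is written \<open>j1_series (u\<^sup>2)\<close>, which has the right value at \<open>0\<close>.\<close>

lemma has_real_derivative_bessel_J1 [derivative_intros]:
  assumes "(f has_real_derivative f') (at x within S)"
  shows "((\<lambda>x. bessel_J1 (f x)) has_real_derivative
    (bessel_J0 (f x) - j1_series ((f x)\<^sup>2)) * f') (at x within S)"
  unfolding bessel_J1_def bessel_J0_eq_series j0_series_ode[symmetric]
  by (rule derivative_eq_intros assms refl)+ (simp add: algebra_simps power2_eq_square)

lemma continuous_on_bessel_J0 [continuous_intros]: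
  "continuous_on S f \<Longrightarrow> continuous_on S (\<lambda>x. bessel_J0 (f x))"
  unfolding bessel_J0_eq_series by (intro continuous_intros)

lemma continuous_on_bessel_J1 [continuous_intros]:
  "continuous_on S f \<Longrightarrow> continuous_on S (\<lambda>x. bessel_J1 (f x))"
  unfolding bessel_J1_def by (intro continuous_intros)

lemma bessel_J0_0: "bessel_J0 0 = 1"
  by (simp add: bessel_J0_eq_series j0_series_def) (simp add: j0_coeff_def)

lemma bessel_J1_0: "bessel_J1 0 = 0"
  by (simp add: bessel_J1_def)

text \<open>The derivative of the sum is \<open>- 2 * J1^2 / u\<close>, so the sum decreases from
  its value 1 at the origin.\<close>

lemma bessel_sq_sum_le_1:
  assumes "u \<ge> 0"
  shows "(bessel_J0 u)\<^sup>2 + (bessel_J1 u)\<^sup>2 \<le> 1"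
proof -
  have "(bessel_J0 u)\<^sup>2 + (bessel_J1 u)\<^sup>2 \<le> (bessel_J0 0)\<^sup>2 + (bessel_J1 0)\<^sup>2"
  proof (rule DERIV_nonpos_imp_nonincreasing[OF assms])
    fix x :: real
    have "((\<lambda>u. (bessel_J0 u)\<^sup>2 + (bessel_J1 u)\<^sup>2) has_real_derivative
        - (2 * x * (j1_series (x\<^sup>2))\<^sup>2)) (at x)"
      by (rule derivative_eq_intros refl)+
        (simp add: bessel_J1_def algebra_simps power2_eq_square)
    moreover assume "0 \<le> x"
    ultimately show "\<exists>y. ((\<lambda>u. (bessel_J0 u)\<^sup>2 + (bessel_J1 u)\<^sup>2) has_real_derivative y) (at x) \<and> y \<le> 0"
      by (auto intro!: exI[of _ "- (2 * x * (j1_series (x\<^sup>2))\<^sup>2)"])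
  qed
  then show ?thesis
    by (simp add: bessel_J0_0 bessel_J1_0)
qed

section \<open>Averages over the angle and the integral of J1(t) / t\<close>

text \<open>Up to the factor \<open>2 / pi\<close>, the derivative in \<open>u\<close> is the
  \<open>sin^2\<close>-weighted integral of \<open>F'\<close>. Taking \<open>F\<close> to be
  \<open>Si\<close> and then \<open>J1_primitive\<close> therefore integrates the two Bessel
  formulas in \<open>u\<close>. The weight \<open>sin\<close> has mass 1, so limits are multiplied
  by \<open>2 / pi\<close> and nothing else.\<close>

definition sin_average :: "(real \<Rightarrow> real) \<Rightarrow> real \<Rightarrow> real" where
  "sin_average F u = 2 / pi * integral {0..pi/2} (\<lambda>\<theta>. sin \<theta> * F (u * sin \<theta>))"

lemma has_real_derivative_sin_average:
  assumes F: "\<And>x. (F has_real_derivative f x) (at x)" and f: "continuous_on UNIV f"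
  shows "(sin_average F has_real_derivative 2 / pi * integral {0..pi/2} (\<lambda>\<theta>. (sin \<theta>)\<^sup>2 * f (u * sin \<theta>))) (at u)"
proof -
  have cF: "continuous_on UNIV F"
    by (rule DERIV_continuous_on, rule has_field_derivative_at_within, rule F)
  have cf: "continuous_on A (\<lambda>x. f (g x))" if "continuous_on A g" for A :: "(real \<times> real) set" and g
    by (rule continuous_on_compose2[OF f that]) auto
  have "((\<lambda>u. integral (cbox 0 (pi/2)) (\<lambda>\<theta>. sin \<theta> * F (u * sin \<theta>))) has_real_derivative
    integral (cbox 0 (pi/2)) (\<lambda>\<theta>. (sin \<theta>)\<^sup>2 * f (u * sin \<theta>))) (at u within UNIV)"
  proof (rule leibniz_rule_field_derivative)
    fix x t :: real
    show "((\<lambda>x. sin t * F (x * sin t)) has_real_derivative (sin t)\<^sup>2 * f (x * sin t)) (at x within UNIV)"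
      by (rule derivative_eq_intros DERIV_chain2[OF F] refl)+ (simp add: power2_eq_square)
    show "(\<lambda>\<theta>. sin \<theta> * F (x * sin \<theta>)) integrable_on cbox 0 (pi/2)"
      by (intro integrable_continuous continuous_intros continuous_on_compose2[OF cF]) auto
  qed (auto simp: split_beta intro!: continuous_intros cf)
  then show ?thesis
    unfolding sin_average_def[abs_def] by (intro DERIV_cmult) (simp add: cbox_interval)
qed

lemma sin_average_tendsto:
  assumes F: "continuous_on UNIV F" and lim: "(F \<longlongrightarrow> l) at_top"
    and bd: "\<And>x. x \<ge> 0 \<Longrightarrow> \<bar>F x\<bar> \<le> K"
  shows "(sin_average F \<longlongrightarrow> 2 / pi * l) at_top"
  unfolding sin_average_def[abs_def]
proof (rule tendsto_mult_left, rule tendsto_at_topI_sequentially)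
  fix X :: "nat \<Rightarrow> real" assume X: "filterlim X at_top sequentially"
  \<comment> \<open>The bound \<open>bd\<close> speaks of nonnegative arguments only, so a tail of
    the sequence is used.\<close>
  have ev: "eventually (\<lambda>n. X n \<ge> 0) sequentially"
    using X by (simp add: filterlim_at_top)
  then obtain N where N: "\<And>n. n \<ge> N \<Longrightarrow> X n \<ge> 0"
    by (auto simp: eventually_sequentially)
  define Y where "Y n = X (n + N)" for n
  have Y0: "Y n \<ge> 0" for n
    using N[of "n + N"] by (simp add: Y_def)
  have Y: "filterlim Y at_top sequentially"
    unfolding Y_def using filterlim_compose[OF X filterlim_add_const_nat_at_top] .
  have lim_const: "((\<lambda>\<theta>::real. sin \<theta> * l) has_integral l) {0..pi/2}"
  proof -
    have "((\<lambda>\<theta>::real. sin \<theta> * l) has_integral (- cos (pi/2) * l - (- cos 0 * l))) {0..pi/2}"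
      by (rule has_integral_real_derivative) (auto intro!: derivative_eq_intros)
    then show ?thesis by simp
  qed
  have "(\<lambda>n. integral {0..pi/2} (\<lambda>\<theta>. sin \<theta> * F (Y n * sin \<theta>)))
      \<longlonglongrightarrow> integral {0..pi/2} (\<lambda>\<theta>. sin \<theta> * l)"
  proof (rule dominated_convergence)
    show "(\<lambda>\<theta>. sin \<theta> * F (Y n * sin \<theta>)) integrable_on {0..pi/2}" for n
      by (intro integrable_continuous_interval continuous_intros continuous_on_compose2[OF F]) auto
    show "(\<lambda>\<theta>. K) integrable_on {0..pi/2}"
      by (rule integrable_const_ivl)
    fix \<theta> :: real assume \<theta>: "\<theta> \<in> {0..pi/2}"
    then have s: "0 \<le> sin \<theta>" "sin \<theta> \<le> 1"
      by (auto intro: sin_ge_zero)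
    show "norm (sin \<theta> * F (Y n * sin \<theta>)) \<le> K" for n
    proof -
      have "\<bar>F (Y n * sin \<theta>)\<bar> \<le> K"
        using s Y0[of n] by (intro bd) simp
      then have "\<bar>sin \<theta>\<bar> * \<bar>F (Y n * sin \<theta>)\<bar> \<le> 1 * K"
        using s by (intro mult_mono) auto
      then show ?thesis by (simp add: abs_mult)
    qed
    show "(\<lambda>n. sin \<theta> * F (Y n * sin \<theta>)) \<longlonglongrightarrow> sin \<theta> * l"
    \<comment> \<open>Where the sine vanishes the argument of \<open>F\<close> stays at 0, but the
      factor in front makes the term 0.\<close>
    proof (cases "sin \<theta> = 0")
      case False
      then have "filterlim (\<lambda>n. Y n * sin \<theta>) at_top sequentially"
        using s by (intro filterlim_at_top_mult_tendsto_pos[OF tendsto_const _ Y]) simp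
      then show ?thesis
        by (intro tendsto_intros filterlim_compose[OF lim])
    qed simp
  qed
  moreover have "integral {0..pi/2} (\<lambda>\<theta>. sin \<theta> * l) = l"
    using lim_const by (rule integral_unique)
  ultimately have "(\<lambda>n. integral {0..pi/2} (\<lambda>\<theta>. sin \<theta> * F (Y n * sin \<theta>))) \<longlonglongrightarrow> l"
    by simp
  then show "(\<lambda>n. integral {0..pi/2} (\<lambda>\<theta>. sin \<theta> * F (X n * sin \<theta>))) \<longlonglongrightarrow> l"
    unfolding Y_def by (rule LIMSEQ_offset)
qed

lemma sin_average_bounded:
  assumes F: "continuous_on UNIV F"
    and bd: "\<And>x. x \<ge> 0 \<Longrightarrow> \<bar>F x\<bar> \<le> K" and u: "u \<ge> 0"
  shows "\<bar>sin_average F u\<bar> \<le> K"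
proof -
  have "norm (integral {0..pi/2} (\<lambda>\<theta>. sin \<theta> * F (u * sin \<theta>))) \<le> K * (pi / 2 - 0)"
  proof (rule integral_bound)
    show "continuous_on {0..pi/2} (\<lambda>\<theta>. sin \<theta> * F (u * sin \<theta>))"
      by (intro continuous_intros continuous_on_compose2[OF F]) auto
    fix \<theta> :: real assume \<theta>: "\<theta> \<in> {0..pi/2}"
    then have s: "0 \<le> sin \<theta>" "sin \<theta> \<le> 1"
      by (auto intro: sin_ge_zero)
    have "\<bar>F (u * sin \<theta>)\<bar> \<le> K"
      using s u by (intro bd) simp
    then have "\<bar>sin \<theta>\<bar> * \<bar>F (u * sin \<theta>)\<bar> \<le> 1 * K"
      using s by (intro mult_mono) auto
    then show "norm (sin \<theta> * F (u * sin \<theta>)) \<le> K"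
      by (simp add: abs_mult)
  qed simp
  then have "2 / pi * \<bar>integral {0..pi/2} (\<lambda>\<theta>. sin \<theta> * F (u * sin \<theta>))\<bar> \<le> 2 / pi * (K * (pi / 2))"
    by (intro mult_left_mono) auto
  then show ?thesis
    unfolding sin_average_def abs_mult by simp
qed

text \<open>\<open>J1_primitive u = \<integral>\<^sub>0\<^sup>u J\<^sub>1(t) / t dt\<close>.\<close>

definition J1_primitive :: "real \<Rightarrow> real" where
  "J1_primitive = sin_average Si"

lemma has_real_derivative_J1_primitive:
  "(J1_primitive has_real_derivative j1_series (u\<^sup>2)) (at u)"
proof -
  have cont: "continuous_on UNIV sinc"
    by (intro continuous_at_imp_continuous_on ballI isCont_sinc)
  have "(J1_primitive has_real_derivative
      2 / pi * integral {0..pi/2} (\<lambda>\<theta>. (sin \<theta>)\<^sup>2 * sinc (u * sin \<theta>))) (at u)"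
    unfolding J1_primitive_def by (rule has_real_derivative_sin_average[OF DERIV_Si cont])
  then show ?thesis
    unfolding integral_unique[OF j1_series_eq_integral] by simp
qed

lemma continuous_on_J1_primitive: "continuous_on UNIV J1_primitive"
  by (rule DERIV_continuous_on, rule has_field_derivative_at_within,
      rule has_real_derivative_J1_primitive)

lemma continuous_on_Si: "continuous_on UNIV Si"
  by (intro continuous_at_imp_continuous_on ballI isCont_Si)

text \<open>\<open>Si\<close> tends to the Dirichlet integral \<open>pi / 2\<close>, which the
  factor \<open>2 / pi\<close> of the average normalises to 1.\<close>

lemma J1_primitive_tendsto: "(J1_primitive \<longlongrightarrow> 1) at_top"
proof -
  obtain K where K: "\<And>x. \<bar>Si x\<bar> \<le> K"
    using bounded_Si by blast
  show ?thesis
    using sin_average_tendsto[OF continuous_on_Si Si_at_top K] by (simp add: J1_primitive_def)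
qed

lemma J1_primitive_bounded: "\<exists>K. \<forall>u\<ge>0. \<bar>J1_primitive u\<bar> \<le> K"
proof -
  obtain K where "\<And>x. \<bar>Si x\<bar> \<le> K"
    using bounded_Si by blast
  then show ?thesis
    using sin_average_bounded[OF continuous_on_Si] unfolding J1_primitive_def by blast
qed

section \<open>The limit of u (J0^2 + J1^2)\<close>

text \<open>\<open>J0^2 + J1^2 = J0^2 + J0'^2\<close> is the energy of the oscillation governed by
  Bessel's equation. It decays like \<open>1 / u\<close>, which the factor \<open>u\<close>
  compensates.\<close>

definition bessel_energy :: "real \<Rightarrow> real" where
  "bessel_energy u = u * ((bessel_J0 u)\<^sup>2 + (bessel_J1 u)\<^sup>2)"

lemma bessel_energy_0 [simp]: "bessel_energy 0 = 0"
  by (simp add: bessel_energy_def)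

lemma has_real_derivative_bessel_energy [derivative_intros]:
  assumes "(f has_real_derivative f') (at x within S)"
  shows "((\<lambda>x. bessel_energy (f x)) has_real_derivative
    ((bessel_J0 (f x))\<^sup>2 - (bessel_J1 (f x))\<^sup>2) * f') (at x within S)"
proof -
  have "(bessel_energy has_real_derivative (bessel_J0 u)\<^sup>2 - (bessel_J1 u)\<^sup>2) (at u)" for u
    unfolding bessel_energy_def[abs_def]
    by (rule derivative_eq_intros refl)+ (simp add: bessel_J1_def algebra_simps power2_eq_square)
  then show ?thesis
    by (rule DERIV_chain2[OF _ assms])
qed

lemma continuous_on_bessel_energy [continuous_intros]:
  "continuous_on S f \<Longrightarrow> continuous_on S (\<lambda>x. bessel_energy (f x))"
  unfolding bessel_energy_def by (intro continuous_intros)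

text \<open>Both sides vanish at 0 and have the derivative \<open>J0 * J1 / u\<close>: on the left
  by the derivatives of \<open>J0\<close> and \<open>J1\<close>, on the right by the product
  formula, whose argument \<open>2 * u\<close> reappears here.\<close>

lemma bessel_energy_eq:
  "bessel_energy u - bessel_J0 u * bessel_J1 u = sin_average J1_primitive (2 * u)"
proof -
  define f where "f u = bessel_energy u - bessel_J0 u * bessel_J1 u - sin_average J1_primitive (2 * u)" for u
  have "(f has_real_derivative 0) (at u)" for u
  proof -
    have "continuous_on UNIV (\<lambda>x. j1_series (x\<^sup>2))"
      by (intro continuous_intros)
    note has_real_derivative_sin_average[OF has_real_derivative_J1_primitive this, of "2 * u",
        unfolded integral_unique[OF j0_j1_series_eq_integral]]
    then have "((\<lambda>u. sin_average J1_primitive (2 * u)) has_real_derivative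
        2 / pi * (pi / 4 * (j0_series (u\<^sup>2) * j1_series (u\<^sup>2))) * 2) (at u)"
      by (rule DERIV_chain2) (auto intro!: derivative_eq_intros)
    from DERIV_diff[OF DERIV_diff[OF has_real_derivative_bessel_energy[OF DERIV_ident]
          DERIV_mult[OF has_real_derivative_bessel_J0[OF DERIV_ident]
            has_real_derivative_bessel_J1[OF DERIV_ident]]] this]
    show ?thesis
      unfolding f_def[abs_def]
      by (rule DERIV_cong) (simp add: algebra_simps power2_eq_square bessel_J1_def bessel_J0_eq_series)
  qed
  then have "f u = f 0"
    by (intro DERIV_isconst_all allI)
  moreover have "Si 0 = 0"
    by (simp add: Si_def zero_ereal_def)
  ultimately show ?thesis
    by (simp add: f_def bessel_J1_0 J1_primitive_def sin_average_def)
qed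

lemma abs_bessel_J0_le_1: "u \<ge> 0 \<Longrightarrow> \<bar>bessel_J0 u\<bar> \<le> 1"
  using bessel_sq_sum_le_1[of u] zero_le_power2[of "bessel_J1 u"]
  by (intro abs_square_le_1[THEN iffD1]) linarith

lemma abs_bessel_J0_J1_le: "\<bar>bessel_J0 u * bessel_J1 u\<bar> \<le> (bessel_J0 u)\<^sup>2 + (bessel_J1 u)\<^sup>2"
proof -
  have "0 \<le> (\<bar>bessel_J0 u\<bar> - \<bar>bessel_J1 u\<bar>)\<^sup>2"
    by simp
  then have "2 * (\<bar>bessel_J0 u\<bar> * \<bar>bessel_J1 u\<bar>) \<le> (bessel_J0 u)\<^sup>2 + (bessel_J1 u)\<^sup>2"
    by (simp add: power2_diff mult.assoc)
  moreover have "0 \<le> \<bar>bessel_J0 u\<bar> * \<bar>bessel_J1 u\<bar>" by simp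
  ultimately show ?thesis unfolding abs_mult by linarith
qed

lemma bessel_energy_bounded:
  obtains K where "K > 0" "\<And>u. u \<ge> 0 \<Longrightarrow> \<bar>bessel_energy u\<bar> \<le> K"
proof -
  obtain K where K: "\<And>u. u \<ge> 0 \<Longrightarrow> \<bar>J1_primitive u\<bar> \<le> K"
    using J1_primitive_bounded by blast
  have "\<bar>bessel_energy u\<bar> \<le> \<bar>K\<bar> + 1" if "u \<ge> 0" for u
    using sin_average_bounded[OF continuous_on_J1_primitive K, of "2 * u"] that
      abs_bessel_J0_J1_le[of u] bessel_sq_sum_le_1[OF that] abs_ge_self[of K]
    unfolding bessel_energy_eq[of u, symmetric] by simp
  then show thesis
    by (intro that[of "\<bar>K\<bar> + 1"]) auto
qed

text \<open>Boundedness of \<open>u * (J0^2 + J1^2)\<close> supplies the decay rate that asymptotic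
  expansions would give.\<close>

lemma abs_bessel_sq_diff_le:
  obtains K where "K > 0" "\<And>u. u > 0 \<Longrightarrow> \<bar>(bessel_J0 u)\<^sup>2 - (bessel_J1 u)\<^sup>2\<bar> \<le> K / u"
proof -
  obtain K where K: "K > 0" "\<And>u. u \<ge> 0 \<Longrightarrow> \<bar>bessel_energy u\<bar> \<le> K"
    using bessel_energy_bounded by blast
  have "\<bar>(bessel_J0 u)\<^sup>2 - (bessel_J1 u)\<^sup>2\<bar> \<le> K / u" if "u > 0" for u
  proof -
    have "u * ((bessel_J0 u)\<^sup>2 + (bessel_J1 u)\<^sup>2) \<le> K"
      using K(2)[of u] that by (simp add: bessel_energy_def)
    then have "(bessel_J0 u)\<^sup>2 + (bessel_J1 u)\<^sup>2 \<le> K / u"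
      using that by (simp add: field_simps)
    then show ?thesis
      using zero_le_power2[of "bessel_J0 u"] zero_le_power2[of "bessel_J1 u"] by linarith
  qed
  then show thesis using that K(1) by blast
qed

text \<open>The average of a function with limit 1 tends to \<open>2 / pi\<close>, and the
  correction \<open>J0 * J1\<close> is at most \<open>K' / u\<close> because the energy is
  bounded.\<close>

lemma bessel_energy_tendsto: "(bessel_energy \<longlongrightarrow> 2 / pi) at_top"
proof -
  obtain K where K: "\<And>u. u \<ge> 0 \<Longrightarrow> \<bar>J1_primitive u\<bar> \<le> K"
    using J1_primitive_bounded by blast
  obtain K' where K': "K' > 0" "\<And>u. u \<ge> 0 \<Longrightarrow> \<bar>bessel_energy u\<bar> \<le> K'"
    using bessel_energy_bounded by blast
  have "filterlim (\<lambda>u::real. 2 * u) at_top at_top"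
    by real_asymp
  from filterlim_compose[OF sin_average_tendsto[OF continuous_on_J1_primitive J1_primitive_tendsto K] this]
  have "((\<lambda>u. bessel_energy u - bessel_J0 u * bessel_J1 u) \<longlongrightarrow> 2 / pi * 1) at_top"
    unfolding bessel_energy_eq .
  moreover have "((\<lambda>u. bessel_J0 u * bessel_J1 u) \<longlongrightarrow> 0) at_top"
  proof (rule Lim_null_comparison)
    show "((\<lambda>u. K' / u) \<longlongrightarrow> 0) at_top"
      by real_asymp
    show "\<forall>\<^sub>F u in at_top. norm (bessel_J0 u * bessel_J1 u) \<le> K' / u"
      using eventually_gt_at_top[of 0]
    proof eventually_elim
      case (elim u)
      have "u * ((bessel_J0 u)\<^sup>2 + (bessel_J1 u)\<^sup>2) \<le> K'"
        using K'(2)[of u] elim by (simp add: bessel_energy_def)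
      then have "(bessel_J0 u)\<^sup>2 + (bessel_J1 u)\<^sup>2 \<le> K' / u"
        using elim by (simp add: field_simps)
      then show ?case
        using abs_bessel_J0_J1_le[of u] unfolding real_norm_def by linarith
    qed
  qed
  ultimately have "((\<lambda>u. bessel_energy u - bessel_J0 u * bessel_J1 u + bessel_J0 u * bessel_J1 u)
      \<longlongrightarrow> 2 / pi * 1 + 0) at_top"
    by (rule tendsto_add)
  then show ?thesis by simp
qed

section \<open>Oscillatory integrals along a line\<close>

text \<open>The derivative of \<open>bessel_energy\<close>, called \<open>e'\<close> in the
  overview.\<close>

definition bessel_sq_diff :: "real \<Rightarrow> real" where
  "bessel_sq_diff u = (bessel_J0 u)\<^sup>2 - (bessel_J1 u)\<^sup>2"

lemma continuous_on_bessel_sq_diff [continuous_intros]: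
  "continuous_on S f \<Longrightarrow> continuous_on S (\<lambda>x. bessel_sq_diff (f x))"
  unfolding bessel_sq_diff_def by (intro continuous_intros)

text \<open>For even \<open>g\<close> this is the oriented integral from 0 to \<open>x\<close>. The
  sign is explicit because the integral over \<open>{0..x}\<close> is 0 for negative
  \<open>x\<close>, the interval being empty.\<close>

definition sgn_integral :: "(real \<Rightarrow> real) \<Rightarrow> real \<Rightarrow> real" where
  "sgn_integral g x = sgn x * integral {0..\<bar>x\<bar>} g"

lemma integral_even_eq_sgn_integral:
  fixes g :: "real \<Rightarrow> real"
  assumes g: "continuous_on UNIV g" and even: "\<And>x. g (- x) = g x" and "a \<le> b"
  shows "integral {a..b} g = sgn_integral g b - sgn_integral g a"
proof -
  have int: "g integrable_on {x..y}" for x y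
    by (rule integrable_continuous_interval, rule continuous_on_subset[OF g]) simp
  have refl: "integral {- y..- x} g = integral {x..y} g" for x y
    using Henstock_Kurzweil_Integration.integral_reflect_real[of y x g] by (simp add: even)
  have comb: "integral {x..y} g + integral {y..z} g = integral {x..z} g" if "x \<le> y" "y \<le> z" for x y z
    by (rule Henstock_Kurzweil_Integration.integral_combine[OF that int])
  consider "0 \<le> a" | "a < 0" "0 \<le> b" | "b < 0" by linarith
  then show ?thesis
  proof cases
    case 1
    then show ?thesis
      using comb[of 0 a b] \<open>a \<le> b\<close> by (auto simp: sgn_integral_def sgn_if)
  next
    case 2
    then have "sgn_integral g b = integral {0..b} g" "sgn_integral g a = - integral {0..- a} g"
      by (auto simp: sgn_integral_def sgn_if)
    then show ?thesis
      using comb[of a 0 b] refl[of "- a" 0, unfolded minus_minus minus_zero] 2 by simp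
  next
    case 3
    then show ?thesis
      using comb[of 0 "-b" "-a"] refl[of "- a" "- b"] \<open>a \<le> b\<close> by (auto simp: sgn_integral_def sgn_if)
  qed
qed

text \<open>The kernel \<open>k e'(k r)\<close> of a point at distance \<open>d\<close> from a line,
  evaluated at the position \<open>v\<close> on that line, measured from the foot of the
  perpendicular.\<close>

definition osc_kernel :: "real \<Rightarrow> real \<Rightarrow> real \<Rightarrow> real" where
  "osc_kernel k d v = k * bessel_sq_diff (k * sqrt (d\<^sup>2 + v\<^sup>2))"

lemma continuous_on_osc_kernel: "continuous_on S (osc_kernel k d)"
  unfolding osc_kernel_def[abs_def] by (intro continuous_intros)

lemma osc_kernel_even: "osc_kernel k d (- v) = osc_kernel k d v"
  by (simp add: osc_kernel_def)

lemma osc_kernel_integrable: "osc_kernel k d integrable_on {a..b}"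
  by (rule integrable_continuous_interval, rule continuous_on_osc_kernel)

lemma integral_osc_kernel_zero:
  assumes "x \<ge> 0"
  shows "integral {0..x} (osc_kernel k 0) = bessel_energy (k * x)"
proof -
  have "(osc_kernel k 0 has_integral (bessel_energy (k * x) - bessel_energy (k * 0))) {0..x}"
  proof (rule has_integral_real_derivative[OF assms])
    fix v assume "v \<in> {0..x}"
    then show "((\<lambda>v. bessel_energy (k * v)) has_real_derivative osc_kernel k 0 v) (at v within {0..x})"
      by (auto intro!: derivative_eq_intros simp: osc_kernel_def bessel_sq_diff_def)
  qed
  then show ?thesis by (simp add: integral_unique)
qed

text \<open>A majorant independent of \<open>k\<close>, for dominated convergence in
  \<open>d\<close>. Its growth \<open>1 / sqrt \<bar>d\<bar>\<close> exceeds the logarithm that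
  \<open>K / r\<close> integrates to, but it is integrable across \<open>d = 0\<close> and its
  integrand has an elementary antiderivative.\<close>

lemma integral_osc_kernel_bound:
  assumes K: "K > 0" "\<And>u. u > 0 \<Longrightarrow> \<bar>bessel_sq_diff u\<bar> \<le> K / u"
    and "k > 0" "d \<noteq> 0" "x \<ge> 0"
  shows "\<bar>integral {0..x} (osc_kernel k d)\<bar> \<le> 4 * K * sqrt (x + \<bar>d\<bar>) / sqrt \<bar>d\<bar>"
proof -
  have d: "\<bar>d\<bar> > 0" using \<open>d \<noteq> 0\<close> by simp
  define w where "w v = 2 * K / (sqrt \<bar>d\<bar> * sqrt (v + \<bar>d\<bar>))" for v
  have w: "(w has_integral (4 * K * sqrt (x + \<bar>d\<bar>) / sqrt \<bar>d\<bar> - 4 * K * sqrt (0 + \<bar>d\<bar>) / sqrt \<bar>d\<bar>)) {0..x}"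
  proof (rule has_integral_real_derivative[OF \<open>x \<ge> 0\<close>])
    fix v assume v: "v \<in> {0..x}"
    show "((\<lambda>v. 4 * K * sqrt (v + \<bar>d\<bar>) / sqrt \<bar>d\<bar>) has_real_derivative w v) (at v within {0..x})"
      using v d by (auto intro!: derivative_eq_intros simp: w_def field_simps)
  qed
  have "norm (integral {0..x} (osc_kernel k d)) \<le> integral {0..x} w"
  proof (rule integral_norm_bound_integral[OF osc_kernel_integrable])
    show "w integrable_on {0..x}"
      using w by blast
    fix v assume v: "v \<in> {0..x}"
    define r where "r = sqrt (d\<^sup>2 + v\<^sup>2)"
    have r: "r > 0" "r\<^sup>2 = d\<^sup>2 + v\<^sup>2"
      using \<open>d \<noteq> 0\<close> by (auto simp: r_def sum_power2_gt_zero_iff)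
    have "\<bar>osc_kernel k d v\<bar> \<le> k * (K / (k * r))"
      unfolding osc_kernel_def abs_mult r_def[symmetric] using K(2)[of "k * r"] \<open>k > 0\<close> r
      by (intro mult_mono) auto
    also have "\<dots> = K / r"
      using \<open>k > 0\<close> by simp
    also have "\<dots> \<le> 2 * K / (sqrt \<bar>d\<bar> * sqrt (v + \<bar>d\<bar>))"
    proof -
      have "sqrt \<bar>d\<bar> * sqrt (v + \<bar>d\<bar>) = sqrt (\<bar>d\<bar> * (v + \<bar>d\<bar>))"
        by (simp add: real_sqrt_mult)
      \<comment> \<open>Squared, this is
        \<open>\<bar>d\<bar> * v + d^2 <= 4 * d^2 + 4 * v^2\<close>, which follows from
        \<open>2 * \<bar>d\<bar> * v <= d^2 + v^2\<close>.\<close>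
      also have "\<dots> \<le> 2 * r"
      proof (rule real_le_lsqrt)
        have "0 \<le> (\<bar>d\<bar> - v)\<^sup>2" by simp
        then show "\<bar>d\<bar> * (v + \<bar>d\<bar>) \<le> (2 * r)\<^sup>2"
        proof -
          have eqs: "(2 * r)\<^sup>2 = 4 * d\<^sup>2 + 4 * v\<^sup>2" "\<bar>d\<bar> * (v + \<bar>d\<bar>) = \<bar>d\<bar> * v + d\<^sup>2"
            by (simp add: power_mult_distrib r, simp add: algebra_simps power2_eq_square)
          have *: "2 * (\<bar>d\<bar> * v) \<le> d\<^sup>2 + v\<^sup>2"
            using \<open>0 \<le> (\<bar>d\<bar> - v)\<^sup>2\<close> by (simp add: power2_diff)
          have "p + q \<le> 4 * q + 4 * w" if "2 * p \<le> q + w" "0 \<le> q" "0 \<le> w"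
            for p q w :: real
            using that by linarith
          from this[OF * zero_le_power2 zero_le_power2] show ?thesis
            unfolding eqs .
        qed
      qed (use r in auto)
      finally have "sqrt \<bar>d\<bar> * sqrt (v + \<bar>d\<bar>) \<le> 2 * r" .
      moreover have "sqrt \<bar>d\<bar> * sqrt (v + \<bar>d\<bar>) > 0"
        using d v by (intro mult_pos_pos real_sqrt_gt_zero add_nonneg_pos) auto
      ultimately have "2 * K / (2 * r) \<le> 2 * K / (sqrt \<bar>d\<bar> * sqrt (v + \<bar>d\<bar>))"
        using K(1) r by (intro divide_left_mono) auto
      then show ?thesis by simp
    qed
    finally show "norm (osc_kernel k d v) \<le> w v"
      by (simp add: w_def)
  qed
  also have "integral {0..x} w \<le> 4 * K * sqrt (x + \<bar>d\<bar>) / sqrt \<bar>d\<bar>"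
    using integral_unique[OF w] K(1) d by simp
  finally show ?thesis by simp
qed

text \<open>Away from \<open>v = 0\<close> the kernel is, up to the factor \<open>r / v\<close>, the derivative of
  \<open>bessel_energy (k * r) - 2 / pi\<close>, which is small.\<close>

lemma integral_osc_kernel_tendsto_0:
  assumes "d \<noteq> 0" "x \<ge> 0"
  shows "((\<lambda>k. integral {0..x} (osc_kernel k d)) \<longlongrightarrow> 0) at_top"
proof (rule tendstoI)
  fix e :: real assume "e > 0"
  obtain K where K: "K > 0" "\<And>u. u > 0 \<Longrightarrow> \<bar>bessel_sq_diff u\<bar> \<le> K / u"
    using abs_bessel_sq_diff_le unfolding bessel_sq_diff_def by blast
  have d: "\<bar>d\<bar> > 0" using \<open>d \<noteq> 0\<close> by simp
  \<comment> \<open>The kernel is at most \<open>K / \<bar>d\<bar>\<close>, so the part over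
    \<open>{0..\<epsilon>}\<close> contributes at most \<open>e / 2\<close>.\<close>
  define \<epsilon> where "\<epsilon> = e * \<bar>d\<bar> / (2 * K)"
  have \<epsilon>: "\<epsilon> > 0" using \<open>e > 0\<close> K d by (simp add: \<epsilon>_def)
  define r where "r v = sqrt (d\<^sup>2 + v\<^sup>2)" for v
  have r: "r v > 0" "(r v)\<^sup>2 = d\<^sup>2 + v\<^sup>2" "\<bar>d\<bar> \<le> r v" for v
    using \<open>d \<noteq> 0\<close> by (auto simp: r_def sum_power2_gt_zero_iff real_le_rsqrt)
  \<comment> \<open>\<open>C\<close> collects the factors of \<open>\<eta>\<close> in the two
    boundary terms and in the remaining integral over \<open>{\<epsilon>..x}\<close>; the summand 1
    gives positivity and a strict inequality at the end.\<close>
  define C where "C = r x / x + r \<epsilon> / \<epsilon> + \<bar>d\<bar> / \<epsilon>\<^sup>2 * x + 1"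
  have C: "C > 0"
    using r[of x] r[of \<epsilon>] \<epsilon> assms unfolding C_def by (intro add_nonneg_pos add_nonneg_nonneg) auto
  define \<eta> where "\<eta> = e / (2 * C)"
  have \<eta>: "\<eta> > 0" using \<open>e > 0\<close> C by (simp add: \<eta>_def)
  define b where "b u = bessel_energy u - 2 / pi" for u
  have "\<forall>\<^sub>F u in at_top. \<bar>b u\<bar> < \<eta>"
    using tendstoD[OF bessel_energy_tendsto \<eta>] by (simp add: b_def dist_real_def)
  then obtain U where U: "\<And>u. u \<ge> U \<Longrightarrow> \<bar>b u\<bar> < \<eta>"
    by (auto simp: eventually_at_top_linorder)
  have small: "\<bar>integral {0..y} (osc_kernel k d)\<bar> \<le> y * K / \<bar>d\<bar>" if "k > 0" "y \<ge> 0" for k y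
  proof -
    have "norm (integral {0..y} (osc_kernel k d)) \<le> K / \<bar>d\<bar> * (y - 0)"
    proof (rule integral_bound[OF \<open>y \<ge> 0\<close> continuous_on_osc_kernel])
      fix v
      have "\<bar>osc_kernel k d v\<bar> \<le> k * (K / (k * r v))"
        unfolding osc_kernel_def abs_mult r_def[symmetric] using K(2)[of "k * r v"] \<open>k > 0\<close> r(1)[of v]
        by (intro mult_mono) auto
      also have "\<dots> = K / r v"
        using \<open>k > 0\<close> by simp
      also have "\<dots> \<le> K / \<bar>d\<bar>"
        using K(1) d r(3)[of v] r(1)[of v] by (intro divide_left_mono) auto
      finally show "norm (osc_kernel k d v) \<le> K / \<bar>d\<bar>" by simp
    qed
    then show ?thesis by (simp add: mult.commute)
  qed
  show "\<forall>\<^sub>F k in at_top. dist (integral {0..x} (osc_kernel k d)) 0 < e"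
    using eventually_gt_at_top[of 0] eventually_ge_at_top[of "U / \<bar>d\<bar>"]
  proof eventually_elim
    case (elim k)
    have b: "\<bar>b (k * r v)\<bar> \<le> \<eta>" for v
    proof -
      have "U \<le> k * \<bar>d\<bar>" using elim d by (simp add: field_simps)
      also have "\<dots> \<le> k * r v" using elim r(3) by (intro mult_left_mono) auto
      finally show ?thesis using U by (intro less_imp_le)
    qed
    show ?case
    proof (cases "x \<le> \<epsilon>")
      case True
      have "\<bar>integral {0..x} (osc_kernel k d)\<bar> \<le> x * K / \<bar>d\<bar>"
        using elim assms by (intro small)
      also have "\<dots> \<le> \<epsilon> * K / \<bar>d\<bar>"
        using True K(1) by (intro divide_right_mono mult_right_mono) auto
      also have "\<dots> = e / 2"
        using K(1) d by (simp add: \<epsilon>_def)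
      finally show ?thesis using \<open>e > 0\<close> by simp
    next
      case False
      then have x: "\<epsilon> < x" by simp
      \<comment> \<open>Integration by parts: one term of the derivative of \<open>G\<close> is the
        kernel, the other is \<open>(r / v)' = - d^2 / (r * v^2)\<close> times the small factor
        \<open>b\<close>.\<close>
      define G where "G v = r v / v * b (k * r v)" for v
      define g where "g v = osc_kernel k d v - d\<^sup>2 / (r v * v\<^sup>2) * b (k * r v)" for v
      have "(g has_integral (G x - G \<epsilon>)) {\<epsilon>..x}"
      proof (rule has_integral_real_derivative)
        fix v assume "v \<in> {\<epsilon>..x}"
        then have v: "v > 0" using \<epsilon> by auto
        have dr: "(r has_real_derivative v / r v) (at v within {\<epsilon>..x})"
          unfolding r_def[abs_def] using r(1)[of v] v \<open>d \<noteq> 0\<close>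
          by (auto intro!: derivative_eq_intros simp: r_def sum_power2_gt_zero_iff divide_simps not_sum_power2_lt_zero)
        have db: "((\<lambda>v. b (k * r v)) has_real_derivative (bessel_sq_diff (k * r v) * (k * (v / r v))))
            (at v within {\<epsilon>..x})"
          unfolding b_def bessel_sq_diff_def
          by (rule derivative_eq_intros dr refl)+ simp
        have "(G has_real_derivative
            (v / r v * v - r v * 1) / (v * v) * b (k * r v)
              + bessel_sq_diff (k * r v) * (k * (v / r v)) * (r v / v)) (at v within {\<epsilon>..x})"
          unfolding G_def[abs_def] using v
          by (intro DERIV_mult DERIV_divide dr db DERIV_ident) auto
        moreover have "(v / r v * v - r v * 1) / (v * v) = - (d\<^sup>2 / (r v * v\<^sup>2))"
        proof -
          have "v / r v * v - r v * 1 = (v\<^sup>2 - (r v)\<^sup>2) / r v"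
            using r(1)[of v] by (simp add: field_simps power2_eq_square)
          then show ?thesis
            unfolding r(2) by (simp add: power2_eq_square)
        qed
        moreover have "bessel_sq_diff (k * r v) * (k * (v / r v)) * (r v / v) = osc_kernel k d v"
          using v r(1)[of v] by (simp add: osc_kernel_def r_def[symmetric])
        ultimately have "(G has_real_derivative (- (d\<^sup>2 / (r v * v\<^sup>2)) * b (k * r v) + osc_kernel k d v))
            (at v within {\<epsilon>..x})"
          by (simp only:)
        then show "(G has_real_derivative g v) (at v within {\<epsilon>..x})"
          by (simp add: g_def)
      qed (use x in auto)
      moreover define h where "h v = d\<^sup>2 / (r v * v\<^sup>2) * b (k * r v)" for v
      have ch: "continuous_on {\<epsilon>..x} h"
        unfolding h_def[abs_def] b_def r_def using \<epsilon> \<open>d \<noteq> 0\<close>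
        by (intro continuous_intros) (auto simp: sum_power2_eq_zero_iff)
      then have "(h has_integral integral {\<epsilon>..x} h) {\<epsilon>..x}"
        by (intro integrable_integral integrable_continuous_interval)
      ultimately have "((\<lambda>v. g v + h v) has_integral (G x - G \<epsilon> + integral {\<epsilon>..x} h)) {\<epsilon>..x}"
        by (rule has_integral_add)
      then have "integral {\<epsilon>..x} (osc_kernel k d) = G x - G \<epsilon> + integral {\<epsilon>..x} h"
        unfolding g_def h_def by (intro integral_unique) (simp add: eta_contract_eq)
      moreover have "norm (integral {\<epsilon>..x} h) \<le> \<bar>d\<bar> / \<epsilon>\<^sup>2 * \<eta> * (x - \<epsilon>)"
      proof (rule integral_bound[OF _ ch])
        fix v assume "v \<in> {\<epsilon>..x}"
        then have v: "v \<ge> \<epsilon>" by simp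
        have "d\<^sup>2 / (r v * v\<^sup>2) \<le> (\<bar>d\<bar> * \<bar>d\<bar>) / (\<bar>d\<bar> * \<epsilon>\<^sup>2)"
          using \<epsilon> v d r(3)[of v] by (intro frac_le mult_mono power_mono) (auto simp: power2_eq_square)
        also have "\<dots> = \<bar>d\<bar> / \<epsilon>\<^sup>2"
          using d by (subst mult_divide_mult_cancel_left) auto
        finally have "d\<^sup>2 / (r v * v\<^sup>2) * \<bar>b (k * r v)\<bar> \<le> \<bar>d\<bar> / \<epsilon>\<^sup>2 * \<eta>"
          using b[of v] d by (intro mult_mono) auto
        moreover have "d\<^sup>2 / (r v * v\<^sup>2) \<ge> 0"
          using r(1)[of v] by simp
        ultimately show "norm (h v) \<le> \<bar>d\<bar> / \<epsilon>\<^sup>2 * \<eta>"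
          by (simp only: h_def real_norm_def abs_mult abs_of_nonneg)
      qed (use x in simp)
      moreover have "\<bar>d\<bar> / \<epsilon>\<^sup>2 * \<eta> * (x - \<epsilon>) \<le> \<bar>d\<bar> / \<epsilon>\<^sup>2 * \<eta> * x"
        using \<epsilon> \<eta> x by (intro mult_left_mono) auto
      moreover have "\<bar>G x\<bar> \<le> r x / x * \<eta>" "\<bar>G \<epsilon>\<bar> \<le> r \<epsilon> / \<epsilon> * \<eta>"
        unfolding G_def abs_mult using b x \<epsilon> r(1)[of x] r(1)[of \<epsilon>] by (auto intro!: divide_right_mono mult_left_mono)
      ultimately have "\<bar>integral {\<epsilon>..x} (osc_kernel k d)\<bar> \<le> (r x / x + r \<epsilon> / \<epsilon> + \<bar>d\<bar> / \<epsilon>\<^sup>2 * x) * \<eta>"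
        by (simp add: algebra_simps abs_le_iff)
      also have "\<dots> < C * \<eta>"
        unfolding C_def using \<eta> by (intro mult_strict_right_mono) auto
      also have "\<dots> = e / 2"
        using C by (simp add: \<eta>_def)
      finally have "\<bar>integral {\<epsilon>..x} (osc_kernel k d)\<bar> < e / 2" .
      moreover have "\<bar>integral {0..\<epsilon>} (osc_kernel k d)\<bar> \<le> e / 2"
        using small[of k \<epsilon>] elim \<epsilon> K(1) d by (simp add: \<epsilon>_def)
      moreover have "integral {0..\<epsilon>} (osc_kernel k d) + integral {\<epsilon>..x} (osc_kernel k d) =
          integral {0..x} (osc_kernel k d)"
        using \<epsilon> x by (intro Henstock_Kurzweil_Integration.integral_combine osc_kernel_integrable) auto
      ultimately show ?thesis
        by simp
    qed
  qed
qed

lemma integral_osc_kernel_eq: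
  assumes "0 \<le> L"
  shows "integral {0..L} (\<lambda>t. osc_kernel k d (t - t0)) =
    sgn_integral (osc_kernel k d) (L - t0) + sgn_integral (osc_kernel k d) t0"
proof -
  have "integral {0..L} (\<lambda>t. osc_kernel k d (t - t0)) = integral {-t0..L - t0} (osc_kernel k d)"
    using integral_shift_Icc_real[of "0 :: real" L "osc_kernel k d" "-t0"] by (simp add: o_def)
  also have "\<dots> = sgn_integral (osc_kernel k d) (L - t0) - sgn_integral (osc_kernel k d) (- t0)"
    using assms by (intro integral_even_eq_sgn_integral continuous_on_osc_kernel osc_kernel_even) auto
  finally show ?thesis
    by (simp add: sgn_integral_def)
qed

lemma sgn_integral_osc_kernel_tendsto:
  "((\<lambda>k. sgn_integral (osc_kernel k d) x) \<longlongrightarrow> (if d = 0 then 2 / pi * sgn x else 0)) at_top"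
proof (cases "d = 0")
  case True
  show ?thesis
  proof (cases "x = 0")
    case False
    have "filterlim (\<lambda>k. \<bar>x\<bar> * k) at_top at_top"
      using False by (intro filterlim_tendsto_pos_mult_at_top[OF tendsto_const] filterlim_ident) auto
    then have "((\<lambda>k. sgn x * bessel_energy (k * \<bar>x\<bar>)) \<longlongrightarrow> sgn x * (2 / pi)) at_top"
      by (intro tendsto_intros filterlim_compose[OF bessel_energy_tendsto]) (simp add: mult.commute)
    then show ?thesis
      using True by (simp add: sgn_integral_def integral_osc_kernel_zero mult_ac)
  qed (simp add: sgn_integral_def)
next
  case False
  have "((\<lambda>k. sgn x * integral {0..\<bar>x\<bar>} (osc_kernel k d)) \<longlongrightarrow> sgn x * 0) at_top"
    by (intro tendsto_intros integral_osc_kernel_tendsto_0 False) simp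
  then show ?thesis
    using False by (simp add: sgn_integral_def)
qed

lemma inverse_sqrt_abs_affine_integrable:
  assumes "0 \<le> L"
  shows "(\<lambda>s. 1 / sqrt \<bar>a + b * s\<bar>) integrable_on {0..L}"
proof (cases "b = 0")
  case False
  \<comment> \<open>\<^term>\<open>sqrt\<close> is an odd function, so this antiderivative is right on both sides of the zero.\<close>
  define F where "F s = 2 / b * sqrt (a + b * s)" for s
  have "((\<lambda>s. 1 / sqrt \<bar>a + b * s\<bar>) has_integral (F L - F 0)) {0..L}"
  proof (rule fundamental_theorem_of_calculus_interior_strong[of "{- a / b}"])
    fix s assume "s \<in> {0<..<L} - {- a / b}"
    then have ne: "a + b * s \<noteq> 0"
      using False by (auto simp: field_simps add_eq_0_iff)
    have "(sqrt has_real_derivative 1 / (2 * sqrt \<bar>y\<bar>)) (at y)" if "y \<noteq> 0" for y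
      using that by (rule DERIV_real_sqrt_generic) (auto simp: real_sqrt_minus field_simps)
    from this[OF ne] have "(F has_real_derivative 2 / b * (1 / (2 * sqrt \<bar>a + b * s\<bar>) * b)) (at s)"
      unfolding F_def
      by (intro DERIV_cmult DERIV_chain2[where g = "\<lambda>s. a + b * s"]) (auto intro!: derivative_eq_intros)
    then show "(F has_vector_derivative 1 / sqrt \<bar>a + b * s\<bar>) (at s)"
      using False by (simp add: has_real_derivative_iff_has_vector_derivative)
  next
    show "continuous_on {0..L} F"
      unfolding F_def by (intro continuous_intros)
  qed (use assms in auto)
  then show ?thesis by blast
qed auto

lemma abs_sgn_integral_le: "\<bar>sgn_integral g x\<bar> \<le> \<bar>integral {0..\<bar>x\<bar>} g\<bar>"
  by (simp add: sgn_integral_def abs_mult sgn_if)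

text \<open>\<open>a + b * s\<close> and \<open>\<alpha> + \<beta> * s\<close> stand for the signed
  distance and the foot of a point moving along the second segment. No distinction by angle is made:
  for \<open>b \<noteq> 0\<close> the limit \<open>l\<close> is nonzero at one point at most, and
  the majorant is integrable across it.\<close>

lemma double_integral_osc_kernel_tendsto:
  fixes a b \<alpha> \<beta> L L' :: real
  assumes L: "0 \<le> L" "0 \<le> L'"
  defines "l \<equiv> (\<lambda>s. if a + b * s = 0 then 2 / pi * (sgn (L - (\<alpha> + \<beta> * s)) + sgn (\<alpha> + \<beta> * s)) else 0)"
  shows "l integrable_on {0..L'}"
    and "((\<lambda>k. integral {0..L'} (\<lambda>s. integral {0..L} (\<lambda>t. osc_kernel k (a + b * s) (t - (\<alpha> + \<beta> * s)))))
      \<longlongrightarrow> integral {0..L'} l) at_top"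
proof -
  obtain K where K: "K > 0" "\<And>u. u > 0 \<Longrightarrow> \<bar>bessel_sq_diff u\<bar> \<le> K / u"
    using abs_bessel_sq_diff_le unfolding bessel_sq_diff_def by blast
  obtain K' where K': "K' > 0" "\<And>u. u \<ge> 0 \<Longrightarrow> \<bar>bessel_energy u\<bar> \<le> K'"
    using bessel_energy_bounded by blast
  \<comment> \<open>\<open>X\<close> bounds \<open>\<bar>x\<bar> + \<bar>a + b * s\<bar>\<close> for
    all upper limits \<open>x\<close> that occur. In \<open>w\<close> the constant serves the points
    with \<open>a + b * s = 0\<close>, where the energy bound applies and the other summand is 0
    since division by zero gives 0. Both summands are doubled for the two pieces on either side of
    the foot.\<close>
  define X where "X = L + \<bar>\<alpha>\<bar> + \<bar>\<beta>\<bar> * L' + \<bar>a\<bar> + \<bar>b\<bar> * L'"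
  define w where "w s = 2 * K' + 8 * K * sqrt X * (1 / sqrt \<bar>a + b * s\<bar>)" for s
  have w: "w integrable_on {0..L'}"
    unfolding w_def[abs_def] using inverse_sqrt_abs_affine_integrable[OF L(2), of a b]
    by (intro integrable_add integrable_on_mult_right) auto
  let ?f = "\<lambda>k s. integral {0..L} (\<lambda>t. osc_kernel k (a + b * s) (t - (\<alpha> + \<beta> * s)))"
  have int: "?f k integrable_on {0..L'}" for k
  proof -
    have "continuous_on UNIV (\<lambda>s. integral (cbox 0 L) (\<lambda>t. osc_kernel k (a + b * s) (t - (\<alpha> + \<beta> * s))))"
      by (rule integral_continuous_on_param) (auto simp: osc_kernel_def split_beta intro!: continuous_intros)
    then show ?thesis
      by (auto intro!: integrable_continuous_interval intro: continuous_on_subset)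
  qed
  have bound: "\<bar>sgn_integral (osc_kernel k (a + b * s)) x\<bar> \<le> w s / 2"
    if "k > 0" "s \<in> {0..L'}" "\<bar>x\<bar> \<le> L + \<bar>\<alpha>\<bar> + \<bar>\<beta>\<bar> * L'" for k s x
  proof (cases "a + b * s = 0")
    case True
    have "\<bar>integral {0..\<bar>x\<bar>} (osc_kernel k 0)\<bar> \<le> K'"
      using K'(2) that by (subst integral_osc_kernel_zero) auto
    then show ?thesis
      using abs_sgn_integral_le[of "osc_kernel k 0" x] True by (simp add: w_def)
  next
    case False
    have "\<bar>b * s\<bar> \<le> \<bar>b\<bar> * L'"
      unfolding abs_mult using that by (intro mult_left_mono) auto
    then have "\<bar>x\<bar> + \<bar>a + b * s\<bar> \<le> X"
      using that unfolding X_def by linarith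
    then have "4 * K * sqrt (\<bar>x\<bar> + \<bar>a + b * s\<bar>) / sqrt \<bar>a + b * s\<bar> \<le> 4 * K * sqrt X / sqrt \<bar>a + b * s\<bar>"
      using K(1) by (intro divide_right_mono mult_left_mono) auto
    moreover have "\<bar>integral {0..\<bar>x\<bar>} (osc_kernel k (a + b * s))\<bar> \<le>
        4 * K * sqrt (\<bar>x\<bar> + \<bar>a + b * s\<bar>) / sqrt \<bar>a + b * s\<bar>"
      using integral_osc_kernel_bound[OF K \<open>k > 0\<close> False] by simp
    ultimately show ?thesis
      using abs_sgn_integral_le[of "osc_kernel k (a + b * s)" x] K'(1) by (simp add: w_def)
  qed
  have le: "\<bar>?f k s\<bar> \<le> w s" if "k > 0" "s \<in> {0..L'}" for k s
  proof -
    have "\<bar>\<beta> * s\<bar> \<le> \<bar>\<beta>\<bar> * L'"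
      unfolding abs_mult using that by (intro mult_left_mono) auto
    then have "\<bar>L - (\<alpha> + \<beta> * s)\<bar> \<le> L + \<bar>\<alpha>\<bar> + \<bar>\<beta>\<bar> * L'" "\<bar>\<alpha> + \<beta> * s\<bar> \<le> L + \<bar>\<alpha>\<bar> + \<bar>\<beta>\<bar> * L'"
      using L by linarith+
    from bound[OF that this(1)] bound[OF that this(2)] show ?thesis
      unfolding integral_osc_kernel_eq[OF L(1)] by linarith
  qed
  have lim: "((\<lambda>k. ?f k s) \<longlongrightarrow> l s) at_top" for s
  proof -
    have "((\<lambda>k. ?f k s) \<longlongrightarrow> (if a + b * s = 0 then 2 / pi * sgn (L - (\<alpha> + \<beta> * s)) else 0)
        + (if a + b * s = 0 then 2 / pi * sgn (\<alpha> + \<beta> * s) else 0)) at_top"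
      unfolding integral_osc_kernel_eq[OF L(1)] by (intro tendsto_add sgn_integral_osc_kernel_tendsto)
    also have "(if a + b * s = 0 then 2 / pi * sgn (L - (\<alpha> + \<beta> * s)) else 0)
        + (if a + b * s = 0 then 2 / pi * sgn (\<alpha> + \<beta> * s) else 0) = l s"
      by (simp add: l_def algebra_simps)
    finally show ?thesis .
  qed
  \<comment> \<open>The majorant holds for positive \<open>k\<close>, so positive sequences come
    first; a general sequence is shifted below.\<close>
  have dom: "l integrable_on {0..L'} \<and> (\<lambda>n. integral {0..L'} (?f (X n))) \<longlonglongrightarrow> integral {0..L'} l"
    if X: "filterlim X at_top sequentially" and pos: "\<And>n. X n > 0" for X :: "nat \<Rightarrow> real"
    using dominated_convergence[of "\<lambda>n. ?f (X n)" "{0..L'}" w l, OF int w]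
      le[OF pos] filterlim_compose[OF lim X] by auto
  show "l integrable_on {0..L'}"
    using dom[of "\<lambda>n. real (Suc n)"] filterlim_compose[OF filterlim_real_sequentially filterlim_Suc] by auto
  show "((\<lambda>k. integral {0..L'} (?f k)) \<longlongrightarrow> integral {0..L'} l) at_top"
  proof (rule tendsto_at_topI_sequentially)
    fix X :: "nat \<Rightarrow> real" assume X: "filterlim X at_top sequentially"
    then have "\<forall>\<^sub>F n in sequentially. X n > 0"
      by (simp add: filterlim_at_top_dense)
    then obtain N where N: "\<And>n. n \<ge> N \<Longrightarrow> X n > 0"
      by (auto simp: eventually_sequentially)
    have "(\<lambda>n. integral {0..L'} (?f (X (n + N)))) \<longlonglongrightarrow> integral {0..L'} l"
      using dom[of "\<lambda>n. X (n + N)"] N filterlim_compose[OF X filterlim_add_const_nat_at_top] by auto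
    then show "(\<lambda>n. integral {0..L'} (?f (X n))) \<longlonglongrightarrow> integral {0..L'} l"
      by (rule LIMSEQ_offset)
  qed
qed

section \<open>One-dimensional Hausdorff measure\<close>

lemma subadditive_of_countably_subadditive:
  fixes f :: "'a set \<Rightarrow> ennreal"
  assumes "f {} = 0" and "\<And>A :: nat \<Rightarrow> 'a set. f (\<Union>i. A i) \<le> (\<Sum>i. f (A i))"
  shows "f (A \<union> B) \<le> f A + f B"
proof -
  have "f (\<Union>i. binaryset A B i) \<le> (\<Sum>i. f (binaryset A B i))"
    by (rule assms(2))
  then show ?thesis
    using suminf_binaryset_eq[of f A B] assms(1) by (simp add: UN_binaryset_eq)
qed

text \<open>The layers \<open>An n\<close> stay away from \<open>F\<close> and exhaust
  \<open>A - F\<close>. The rings \<open>D n\<close> between them are separated when their indices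
  differ by at least two, so the even and the odd rings each have total at most \<open>f A\<close>.
  The series over all rings converges, and its tail bounds what \<open>An N\<close> misses.\<close>

theorem metric_outer_measure_closed_split:
  fixes f :: "'a::metric_space set \<Rightarrow> ennreal"
  assumes empty: "f {} = 0"
    and mono: "\<And>A B. A \<subseteq> B \<Longrightarrow> f A \<le> f B"
    and csub: "\<And>A :: nat \<Rightarrow> 'a set. f (\<Union>i. A i) \<le> (\<Sum>i. f (A i))"
    and metric: "\<And>A B d. 0 < d \<Longrightarrow> (\<And>x y. x \<in> A \<Longrightarrow> y \<in> B \<Longrightarrow> d \<le> dist x y) \<Longrightarrow> f A + f B \<le> f (A \<union> B)"
    and F: "closed F"
  shows "f (A \<inter> F) + f (A - F) = f A"
proof (rule antisym)
  show "f A \<le> f (A \<inter> F) + f (A - F)"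
    using subadditive_of_countably_subadditive[OF empty csub, of "A \<inter> F" "A - F"] by (simp add: Int_Diff_Un)
  show "f (A \<inter> F) + f (A - F) \<le> f A"
  \<comment> \<open>For empty \<open>F\<close> the distance \<open>infdist\<close> is 0 by
    convention, so the layers would carry no information.\<close>
  proof (cases "F = {} \<or> f A = top")
    case True
    then show ?thesis
      using empty mono by auto
  next
    case False
    then have F0: "F \<noteq> {}" and fin: "f A < top"
      by (auto simp: less_top)
    define g where "g x = infdist x F" for x
    have g_lip: "g x \<le> g y + dist x y" for x y
      unfolding g_def by (rule infdist_triangle)
    define An where "An n = {x \<in> A. 1 / real (n + 1) \<le> g x}" for n
    define D where "D n = An (Suc n) - An n" for n
    have An_mono: "An n \<subseteq> An m" if "n \<le> m" for n m
    proof -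
      have "1 / real (m + 1) \<le> 1 / real (n + 1)"
        using that by (intro divide_left_mono) auto
      then show ?thesis
        unfolding An_def by auto
    qed
    have sep: "f X + f Y \<le> f (X \<union> Y)"
      if X: "\<And>x. x \<in> X \<Longrightarrow> a \<le> g x" and Y: "\<And>y. y \<in> Y \<Longrightarrow> g y \<le> b" and "b < a" for X Y a b
    proof (rule metric[of "a - b"])
      fix x y assume "x \<in> X" "y \<in> Y"
      then show "a - b \<le> dist x y"
        using X[of x] Y[of y] g_lip[of x y] by linarith
    qed (use that in simp)
    have D_sub: "D n \<subseteq> An (Suc n)" "D n \<subseteq> A" for n
      by (auto simp: D_def An_def)
    \<comment> \<open>Only every second ring is summed, since adjacent rings may touch; the offset
      \<open>c\<close> is used with 0 and 1 to select the parity.\<close>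
    have sum_le_Un: "(\<Sum>i<N. f (D (2 * i + c))) \<le> f (\<Union>i<N. D (2 * i + c))" for N c
    proof (induction N)
      case (Suc N)
      have "(\<Sum>i<Suc N. f (D (2 * i + c))) \<le> f (\<Union>i<N. D (2 * i + c)) + f (D (2 * N + c))"
        using Suc by (simp add: add_right_mono)
      also have "\<dots> \<le> f ((\<Union>i<N. D (2 * i + c)) \<union> D (2 * N + c))"
      \<comment> \<open>For \<open>N = 0\<close> there is no earlier ring, and with
        \<open>c = 0\<close> the index \<open>2 * N + c - 1\<close> would be truncated.\<close>
      proof (cases "N = 0")
        case False
        show ?thesis
        proof (rule sep)
          fix x assume "x \<in> (\<Union>i<N. D (2 * i + c))"
          then obtain i where i: "i < N" "x \<in> An (Suc (2 * i + c))"
            using D_sub by blast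
          moreover have "Suc (2 * i + c) \<le> 2 * N + c - 1"
            using i by linarith
          ultimately have "x \<in> An (2 * N + c - 1)"
            using An_mono by blast
          then show "1 / real (2 * N + c) \<le> g x"
            using i by (simp add: An_def)
        next
          fix y assume "y \<in> D (2 * N + c)"
          then show "g y \<le> 1 / real (2 * N + c + 1)"
            by (auto simp: D_def An_def)
        next
          show "1 / real (2 * N + c + 1) < 1 / real (2 * N + c)"
            using False by (intro divide_strict_left_mono) auto
        qed
      qed (simp add: empty)
      also have "(\<Union>i<N. D (2 * i + c)) \<union> D (2 * N + c) = (\<Union>i<Suc N. D (2 * i + c))"
        by (auto simp: lessThan_Suc)
      finally show ?case .
    qed (simp add: empty)
    have sum_le: "(\<Sum>i<N. f (D (2 * i + c))) \<le> f A" for N c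
      using sum_le_Un[of c N] mono[of "\<Union>i<N. D (2 * i + c)" A] D_sub(2) by (meson UN_least order_trans)
    have "(\<Sum>n<2 * N. f (D n)) = (\<Sum>i<N. f (D (2 * i + 0))) + (\<Sum>i<N. f (D (2 * i + 1)))" for N
      by (induction N) (simp_all add: add_ac)
    then have sum2: "(\<Sum>n<2 * N. f (D n)) \<le> f A + f A" for N
      using add_mono[OF sum_le[of 0 N] sum_le[of 1 N]] by simp
    have "(\<Sum>n. f (D n)) \<le> f A + f A"
    proof (rule suminf_le_const[OF summableI])
      fix N
      have "(\<Sum>n<N. f (D n)) \<le> (\<Sum>n<2 * N. f (D n))"
        by (rule sum_mono2) auto
      then show "(\<Sum>n<N. f (D n)) \<le> f A + f A"
        using sum2[of N] by (rule order_trans)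
    qed
    also have "\<dots> < top"
      using fin by simp
    finally have fin_sum: "(\<Sum>n. f (D n)) < top" .
    define h where "h n = enn2real (f (D n))" for n
    have h0: "h n \<ge> 0" for n
      by (simp add: h_def)
    have h: "f (D n) = ennreal (h n)" for n
    proof -
      have "f (D n) \<le> f A"
        by (rule mono[OF D_sub(2)])
      then show ?thesis
        using fin by (simp add: h_def)
    qed
    have summ: "summable h"
      using fin_sum h0 unfolding h by (intro summable_suminf_not_top) (auto simp: less_top)
    show ?thesis
    proof (rule ennreal_le_epsilon)
      fix e :: real assume "0 < e"
      from suminf_exist_split[OF this summ] obtain N where N: "norm (\<Sum>i. h (i + N)) < e"
        by auto
      have tail: "(\<Sum>i. f (D (i + N))) \<le> ennreal e"
      proof -
        have "(\<Sum>i. f (D (i + N))) = ennreal (\<Sum>i. h (i + N))"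
          unfolding h using h0 summable_ignore_initial_segment[OF summ, of N] by (intro suminf_ennreal2) auto
        also have "\<dots> \<le> ennreal e"
          using N by (intro ennreal_leI) simp
        finally show ?thesis .
      qed
      have "A - F \<subseteq> An N \<union> (\<Union>i. D (i + N))"
      proof
        fix x assume x: "x \<in> A - F"
        then have "g x > 0"
          unfolding g_def using infdist_pos_not_in_closed[OF F F0] by simp
        then obtain n where "inverse (real (Suc n)) < g x"
          using reals_Archimedean by blast
        then have n: "x \<in> An n"
          using x by (simp add: An_def inverse_eq_divide)
        show "x \<in> An N \<union> (\<Union>i. D (i + N))"
        proof (cases "x \<in> An N")
          case False
          \<comment> \<open>The first layer that contains \<open>x\<close>; as \<open>x\<close> is
            not in the layer before it, \<open>x\<close> lies in the ring
            \<open>D (m - 1)\<close>.\<close>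
          define m where "m = (LEAST m. x \<in> An m)"
          have m: "x \<in> An m"
            unfolding m_def using n by (rule LeastI)
          then have "N < m"
            using False An_mono[of m N] by (meson in_mono not_le)
          then have "x \<notin> An (m - 1)"
            using not_less_Least[of "m - 1" "\<lambda>m. x \<in> An m"] unfolding m_def[symmetric] by simp
          then have "x \<in> D ((m - 1 - N) + N)"
            using m \<open>N < m\<close> by (simp add: D_def)
          then show ?thesis by blast
        qed simp
      qed
      then have "f (A - F) \<le> f (An N \<union> (\<Union>i. D (i + N)))"
        by (rule mono)
      also have "\<dots> \<le> f (An N) + f (\<Union>i. D (i + N))"
        by (rule subadditive_of_countably_subadditive[OF empty csub])
      also have "\<dots> \<le> f (An N) + (\<Sum>i. f (D (i + N)))"
        by (intro add_left_mono csub)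
      also have "\<dots> \<le> f (An N) + ennreal e"
        by (intro add_left_mono tail)
      finally have "f (A \<inter> F) + f (A - F) \<le> f (A \<inter> F) + (f (An N) + ennreal e)"
        by (rule add_left_mono)
      also have "\<dots> = (f (An N) + f (A \<inter> F)) + ennreal e"
        by (simp add: add_ac)
      also have "f (An N) + f (A \<inter> F) \<le> f (An N \<union> (A \<inter> F))"
        by (rule sep[of _ "1 / real (N + 1)" _ 0]) (auto simp: An_def g_def)
      also have "\<dots> \<le> f A"
        by (rule mono) (auto simp: An_def)
      finally show "f (A \<inter> F) + f (A - F) \<le> f A + ennreal e"
        by (simp add: add_right_mono)
    qed
  qed
qed

text \<open>By Caratheodory's theorem the sets that split every set additively form a sigma-algebra
  on which \<open>f\<close> is a measure. It contains the closed sets by the preceding theorem,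
  hence the Borel sets.\<close>

theorem metric_outer_measure_imp_measure_space:
  fixes f :: "'a::metric_space set \<Rightarrow> ennreal"
  assumes empty: "f {} = 0"
    and mono: "\<And>A B. A \<subseteq> B \<Longrightarrow> f A \<le> f B"
    and csub: "\<And>A :: nat \<Rightarrow> 'a set. f (\<Union>i. A i) \<le> (\<Sum>i. f (A i))"
    and metric: "\<And>A B d. 0 < d \<Longrightarrow> (\<And>x y. x \<in> A \<Longrightarrow> y \<in> B \<Longrightarrow> d \<le> dist x y) \<Longrightarrow> f A + f B \<le> f (A \<union> B)"
  shows "measure_space UNIV (sets borel) f"
proof -
  let ?L = "lambda_system UNIV (Pow UNIV) f"
  have "outer_measure_space (Pow UNIV) f"
    using empty mono csub
    by (auto simp: outer_measure_space_def positive_def increasing_def countably_subadditive_def)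
  then have L: "measure_space UNIV ?L f"
    by (rule sigma_algebra.caratheodory_lemma[OF sigma_algebra_Pow])
  then have "sigma_algebra UNIV ?L"
    by (simp add: measure_space_def)
  moreover have "Collect closed \<subseteq> ?L"
  proof
    fix F :: "'a set" assume "F \<in> Collect closed"
    then have "closed F" by simp
    have "f (A \<inter> F) + f (A - F) = f A" for A
    proof (rule metric_outer_measure_closed_split)
      show "f X + f Y \<le> f (X \<union> Y)" if "0 < d" "\<And>x y. x \<in> X \<Longrightarrow> y \<in> Y \<Longrightarrow> d \<le> dist x y" for X Y d
        using that by (rule metric)
    qed (fact empty mono csub \<open>closed F\<close>)+
    then show "F \<in> ?L"
      by (simp add: lambda_system_def Int_commute Compl_eq_Diff_UNIV[symmetric] Diff_eq)
  qed
  ultimately have "sigma_sets UNIV (Collect closed) \<subseteq> ?L"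
    by (rule sigma_algebra.sigma_sets_subset)
  moreover have "sets (borel :: 'a measure) = sigma_sets UNIV (Collect closed)"
    by (simp add: borel_eq_closed)
  ultimately show ?thesis
    using measure_down[OF L, of "sets borel"] sets.sigma_algebra_axioms[of "borel :: 'a measure"] by simp
qed

section \<open>Hausdorff measure as a metric outer measure\<close>

abbreviation hausdorff1_cover :: "real \<Rightarrow> 'a::metric_space set \<Rightarrow> (nat \<Rightarrow> 'a set) set" where
  "hausdorff1_cover \<delta> A \<equiv> {U. A \<subseteq> (\<Union>i. U i) \<and> (\<forall>i. bounded (U i) \<and> diameter (U i) \<le> \<delta>)}"

lemma hausdorff1_pre_le:
  assumes "A \<subseteq> (\<Union>i. U i)" "\<And>i. bounded (U i)" "\<And>i. diameter (U i) \<le> \<delta>"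
  shows "hausdorff1_pre \<delta> A \<le> (\<Sum>i. ennreal (diameter (U i)))"
  unfolding hausdorff1_pre_def using assms by (intro INF_lower) auto

lemma hausdorff1_pre_ge:
  assumes "\<And>U :: nat \<Rightarrow> _. A \<subseteq> (\<Union>i. U i) \<Longrightarrow> (\<And>i. bounded (U i)) \<Longrightarrow> (\<And>i. diameter (U i) \<le> \<delta>)
    \<Longrightarrow> c \<le> (\<Sum>i. ennreal (diameter (U i)))"
  shows "c \<le> hausdorff1_pre \<delta> A"
  unfolding hausdorff1_pre_def using assms by (intro INF_greatest) auto

lemma hausdorff1_pre_mono: "A \<subseteq> B \<Longrightarrow> hausdorff1_pre \<delta> A \<le> hausdorff1_pre \<delta> B"
  by (rule hausdorff1_pre_ge) (auto intro!: hausdorff1_pre_le)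

lemma hausdorff1_pre_antimono: "\<delta> \<le> \<epsilon> \<Longrightarrow> hausdorff1_pre \<epsilon> A \<le> hausdorff1_pre \<delta> A"
  by (rule hausdorff1_pre_ge) (auto intro!: hausdorff1_pre_le intro: order_trans)

lemma hausdorff1_pre_empty: "\<delta> > 0 \<Longrightarrow> hausdorff1_pre \<delta> {} = 0"
  using hausdorff1_pre_le[of "{}" "\<lambda>_. {}" \<delta>] by simp

lemma hausdorff1_pre_UN_le:
  fixes A :: "nat \<Rightarrow> 'a::metric_space set"
  shows "hausdorff1_pre \<delta> (\<Union>i. A i) \<le> (\<Sum>i. hausdorff1_pre \<delta> (A i))"
proof (rule ennreal_le_epsilon)
  fix e :: real assume e: "0 < e" and fin: "(\<Sum>i. hausdorff1_pre \<delta> (A i)) < top"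
  \<comment> \<open>Each cover exceeds its infimum by less than \<open>e / 2 ^ (n + 1)\<close>, in
    total by at most \<open>e\<close>; strictness needs the infimum to be finite.\<close>
  have "\<exists>U. U \<in> hausdorff1_cover \<delta> (A n) \<and> (\<Sum>i. ennreal (diameter (U i))) < hausdorff1_pre \<delta> (A n) + e * (1/2) ^ Suc n" for n
  proof -
    have "hausdorff1_pre \<delta> (A n) < top"
      using fin by (auto simp add: less_top dest!: ennreal_suminf_lessD)
    then have "hausdorff1_pre \<delta> (A n) < hausdorff1_pre \<delta> (A n) + e * (1/2) ^ Suc n"
      using e by auto
    then show ?thesis
      by (subst (asm) (1) hausdorff1_pre_def) (simp only: INF_less_iff Bex_def)
  qed
  then have "\<forall>n. \<exists>U. U \<in> hausdorff1_cover \<delta> (A n) \<and> (\<Sum>i. ennreal (diameter (U i))) < hausdorff1_pre \<delta> (A n) + e * (1/2) ^ Suc n"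
    by (rule allI)
  from choice[OF this] obtain U where
    "\<forall>n. U n \<in> hausdorff1_cover \<delta> (A n) \<and> (\<Sum>i. ennreal (diameter (U n i))) < hausdorff1_pre \<delta> (A n) + e * (1/2) ^ Suc n"
    by (rule exE)
  then have U: "U n \<in> hausdorff1_cover \<delta> (A n)"
    and less: "(\<Sum>i. ennreal (diameter (U n i))) < hausdorff1_pre \<delta> (A n) + e * (1/2) ^ Suc n" for n
    by simp_all
  define C where "C = case_prod U \<circ> prod_decode"
  have "hausdorff1_pre \<delta> (\<Union>i. A i) \<le> (\<Sum>i. ennreal (diameter (C i)))"
  proof (rule hausdorff1_pre_le)
    show "(\<Union>i. A i) \<subseteq> (\<Union>i. C i)"
    proof
      fix x assume "x \<in> (\<Union>i. A i)"
      then obtain n i where "x \<in> U n i"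
        using U by blast
      then have "x \<in> C (prod_encode (n, i))"
        by (simp add: C_def)
      then show "x \<in> (\<Union>i. C i)" by blast
    qed
  qed (use U in \<open>auto simp: C_def split: prod.split\<close>)
  also have "\<dots> = (\<Sum>n. \<Sum>i. ennreal (diameter (U n i)))"
    unfolding C_def comp_def by (intro suminf_ennreal_2dimen) auto
  also have "\<dots> \<le> (\<Sum>n. hausdorff1_pre \<delta> (A n) + e * (1/2) ^ Suc n)"
    using less by (intro suminf_le) (auto intro: less_imp_le)
  also have "\<dots> = (\<Sum>n. hausdorff1_pre \<delta> (A n)) + (\<Sum>n. ennreal e * ennreal ((1/2) ^ Suc n))"
    using e by (subst suminf_add[symmetric])
      (auto simp del: ennreal_suminf_cmult simp add: ennreal_mult[symmetric])
  also have "\<dots> = (\<Sum>n. hausdorff1_pre \<delta> (A n)) + e"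
    unfolding ennreal_suminf_cmult
    by (subst suminf_ennreal_eq[OF zero_le_power power_half_series]) auto
  finally show "hausdorff1_pre \<delta> (\<Union>i. A i) \<le> (\<Sum>i. hausdorff1_pre \<delta> (A i)) + ennreal e" .
qed

lemma hausdorff1_outer_upper: "\<delta> > 0 \<Longrightarrow> hausdorff1_pre \<delta> A \<le> hausdorff1_outer A"
  unfolding hausdorff1_outer_def by (intro SUP_upper) auto

lemma hausdorff1_outer_least: "(\<And>\<delta>. \<delta> > 0 \<Longrightarrow> hausdorff1_pre \<delta> A \<le> c) \<Longrightarrow> hausdorff1_outer A \<le> c"
  unfolding hausdorff1_outer_def by (intro SUP_least) auto

text \<open>A set of diameter at most \<open>\<delta> < d\<close> meets at most one of
  \<open>A\<close> and \<open>B\<close>, so a cover of the union falls apart into disjoint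
  subfamilies covering each.\<close>

lemma hausdorff1_pre_metric:
  assumes "\<And>x y. x \<in> A \<Longrightarrow> y \<in> B \<Longrightarrow> d \<le> dist x y" and "\<delta> < d"
  shows "hausdorff1_pre \<delta> A + hausdorff1_pre \<delta> B \<le> hausdorff1_pre \<delta> (A \<union> B)"
proof (rule hausdorff1_pre_ge)
  fix U :: "nat \<Rightarrow> _" assume U: "A \<union> B \<subseteq> (\<Union>i. U i)" "\<And>i. bounded (U i)" "\<And>i. diameter (U i) \<le> \<delta>"
  \<comment> \<open>Sets that miss \<open>X\<close> are emptied rather than removed: the index set
    stays, and they contribute diameter 0.\<close>
  define V where "V X i = (if U i \<inter> X = {} then {} else U i)" for X i
  have "\<delta> \<ge> 0"
    using diameter_ge_0[OF U(2)] U(3) by (rule order_trans)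
  have V: "hausdorff1_pre \<delta> X \<le> (\<Sum>i. ennreal (diameter (V X i)))" if XAB: "X \<subseteq> A \<union> B" for X
  proof (rule hausdorff1_pre_le)
    show "X \<subseteq> (\<Union>i. V X i)"
    proof
      fix x assume "x \<in> X"
      moreover from this obtain i where "x \<in> U i"
        using U(1) XAB by blast
      ultimately have "x \<in> V X i"
        by (auto simp: V_def)
      then show "x \<in> (\<Union>i. V X i)" by blast
    qed
  qed (use U \<open>\<delta> \<ge> 0\<close> in \<open>auto simp: V_def\<close>)
  have disj: "U i \<inter> A = {} \<or> U i \<inter> B = {}" for i
  proof (rule ccontr)
    assume "\<not> (U i \<inter> A = {} \<or> U i \<inter> B = {})"
    then obtain x y where "x \<in> U i" "x \<in> A" "y \<in> U i" "y \<in> B"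
      by auto
    then show False
      using assms(1)[of x y] diameter_bounded_bound[OF U(2), of x i y] U(3)[of i] \<open>\<delta> < d\<close> by linarith
  qed
  have "hausdorff1_pre \<delta> A + hausdorff1_pre \<delta> B
      \<le> (\<Sum>i. ennreal (diameter (V A i))) + (\<Sum>i. ennreal (diameter (V B i)))"
    by (intro add_mono V) auto
  also have "\<dots> = (\<Sum>i. ennreal (diameter (V A i)) + ennreal (diameter (V B i)))"
    by (rule suminf_add) auto
  also have "\<dots> \<le> (\<Sum>i. ennreal (diameter (U i)))"
    using disj by (intro suminf_le) (auto simp: V_def)
  finally show "hausdorff1_pre \<delta> A + hausdorff1_pre \<delta> B \<le> (\<Sum>i. ennreal (diameter (U i)))" .
qed

lemma measure_space_hausdorff1_outer:
  "measure_space UNIV (sets borel) (hausdorff1_outer :: 'a::metric_space set \<Rightarrow> ennreal)"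
proof (rule metric_outer_measure_imp_measure_space)
  show "hausdorff1_outer {} = 0"
    by (intro antisym hausdorff1_outer_least) (auto simp: hausdorff1_pre_empty)
  show "hausdorff1_outer A \<le> hausdorff1_outer B" if "A \<subseteq> B" for A B :: "'a set"
    using hausdorff1_pre_mono[OF that] hausdorff1_outer_upper[of _ B]
    by (intro hausdorff1_outer_least) (meson order_trans)
  show "hausdorff1_outer (\<Union>i. A i) \<le> (\<Sum>i. hausdorff1_outer (A i))" for A :: "nat \<Rightarrow> 'a set"
  proof (rule hausdorff1_outer_least)
    fix \<delta> :: real assume "\<delta> > 0"
    have "hausdorff1_pre \<delta> (\<Union>i. A i) \<le> (\<Sum>i. hausdorff1_pre \<delta> (A i))"
      by (rule hausdorff1_pre_UN_le)
    also have "\<dots> \<le> (\<Sum>i. hausdorff1_outer (A i))"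
      using hausdorff1_outer_upper[OF \<open>\<delta> > 0\<close>] by (intro suminf_le) auto
    finally show "hausdorff1_pre \<delta> (\<Union>i. A i) \<le> (\<Sum>i. hausdorff1_outer (A i))" .
  qed
  fix A B :: "'a set" and d :: real
  assume d: "d > 0" "\<And>x y. x \<in> A \<Longrightarrow> y \<in> B \<Longrightarrow> d \<le> dist x y"
  have le: "hausdorff1_pre \<delta> A + hausdorff1_pre \<epsilon> B \<le> hausdorff1_outer (A \<union> B)" if "\<delta> > 0" "\<epsilon> > 0" for \<delta> \<epsilon>
  proof -
    \<comment> \<open>The two suprema run over independent scales. Passing to a common smaller scale
      below \<open>d\<close> only increases both terms.\<close>
    define \<eta> where "\<eta> = min (min \<delta> \<epsilon>) (d / 2)"
    have \<eta>: "\<eta> > 0" "\<eta> \<le> \<delta>" "\<eta> \<le> \<epsilon>" "\<eta> < d"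
      using that d(1) by (auto simp: \<eta>_def)
    have "hausdorff1_pre \<delta> A + hausdorff1_pre \<epsilon> B \<le> hausdorff1_pre \<eta> A + hausdorff1_pre \<eta> B"
      using \<eta> by (intro add_mono hausdorff1_pre_antimono)
    also have "\<dots> \<le> hausdorff1_pre \<eta> (A \<union> B)"
      by (rule hausdorff1_pre_metric[OF d(2) \<eta>(4)])
    also have "\<dots> \<le> hausdorff1_outer (A \<union> B)"
      by (rule hausdorff1_outer_upper[OF \<eta>(1)])
    finally show ?thesis .
  qed
  have "hausdorff1_outer A + hausdorff1_pre \<epsilon> B \<le> hausdorff1_outer (A \<union> B)" if "\<epsilon> > 0" for \<epsilon>
  proof -
    have "hausdorff1_outer A + hausdorff1_pre \<epsilon> B = (SUP \<delta> \<in> {0<..}. hausdorff1_pre \<delta> A + hausdorff1_pre \<epsilon> B)"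
      unfolding hausdorff1_outer_def by (rule ennreal_SUP_add_left[symmetric]) auto
    also have "\<dots> \<le> hausdorff1_outer (A \<union> B)"
      using le that by (intro SUP_least) auto
    finally show ?thesis .
  qed
  moreover have "hausdorff1_outer A + hausdorff1_outer B = (SUP \<epsilon> \<in> {0<..}. hausdorff1_outer A + hausdorff1_pre \<epsilon> B)"
    unfolding hausdorff1_outer_def[of B] by (subst ennreal_SUP_add_right) auto
  ultimately show "hausdorff1_outer A + hausdorff1_outer B \<le> hausdorff1_outer (A \<union> B)"
    by (auto intro!: SUP_least)
qed

lemma space_hausdorff1 [simp]: "space hausdorff1 = UNIV"
  by (simp add: hausdorff1_def space_measure_of_conv)

lemma sets_hausdorff1 [simp, measurable_cong]: "sets hausdorff1 = sets borel"
  by (simp add: hausdorff1_def sets_measure_of_conv sets.sigma_sets_eq[of borel, simplified])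

lemma emeasure_hausdorff1:
  fixes A :: "'a::metric_space set"
  assumes "A \<in> sets borel"
  shows "emeasure hausdorff1 A = hausdorff1_outer A"
  unfolding hausdorff1_def
proof (rule emeasure_measure_of_sigma)
  show "sigma_algebra UNIV (sets (borel :: 'a measure))"
    using sets.sigma_algebra_axioms[of "borel :: 'a measure"] by simp
  show "positive (sets borel) (hausdorff1_outer :: 'a set \<Rightarrow> ennreal)"
    "countably_additive (sets borel) (hausdorff1_outer :: 'a set \<Rightarrow> ennreal)"
    using measure_space_hausdorff1_outer by (auto simp: measure_space_def)
qed fact

section \<open>Length of subsets of a line\<close>

text \<open>Pulled back along the isometry, a covering set lies in a closed interval no longer than
  its diameter, and Lebesgue measure is countably subadditive. The scale 1 is enough because
  \<open>hausdorff1_outer\<close> is a supremum over scales.\<close>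

lemma hausdorff1_outer_line_ge:
  fixes \<gamma> :: "real \<Rightarrow> 'a::metric_space"
  assumes iso: "\<And>s t. dist (\<gamma> s) (\<gamma> t) = \<bar>s - t\<bar>" and "l \<le> u"
  shows "ennreal (u - l) \<le> hausdorff1_outer (\<gamma> ` {l<..<u})"
proof -
  have "ennreal (u - l) \<le> hausdorff1_pre 1 (\<gamma> ` {l<..<u})"
  proof (rule hausdorff1_pre_ge)
    fix U :: "nat \<Rightarrow> 'a set" assume U: "\<gamma> ` {l<..<u} \<subseteq> (\<Union>i. U i)" "\<And>i. bounded (U i)"
    \<comment> \<open>The pullback itself may fail to be measurable, hence the interval from its
      infimum to its supremum.\<close>
    have ex: "\<exists>V. V \<in> sets borel \<and> \<gamma> -` U i \<subseteq> V \<and> emeasure lborel V \<le> ennreal (diameter (U i))" for i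
    proof (cases "\<gamma> -` U i = {}")
      case False
      let ?P = "\<gamma> -` U i"
      have d: "\<bar>s - t\<bar> \<le> diameter (U i)" if "s \<in> ?P" "t \<in> ?P" for s t
        using diameter_bounded_bound[OF U(2)] that by (simp flip: iso)
      obtain s where s: "s \<in> ?P" using False by blast
      have bdd: "bdd_above ?P" "bdd_below ?P"
        using d[OF _ s] by (auto intro!: bdd_aboveI[of _ "s + diameter (U i)"] bdd_belowI[of _ "s - diameter (U i)"]
          simp: abs_le_iff algebra_simps)
      have "Sup ?P \<le> Inf ?P + diameter (U i)"
      proof (rule cSup_least[OF False])
        fix x assume x: "x \<in> ?P"
        have "x - diameter (U i) \<le> Inf ?P"
          using d[OF x] by (intro cInf_greatest[OF False]) (simp add: abs_le_iff algebra_simps)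
        then show "x \<le> Inf ?P + diameter (U i)" by simp
      qed
      moreover have "Inf ?P \<le> Sup ?P"
        using cInf_lower[OF s bdd(2)] cSup_upper[OF s bdd(1)] by linarith
      ultimately have "emeasure lborel {Inf ?P..Sup ?P} \<le> ennreal (diameter (U i))"
        by (auto intro!: ennreal_leI)
      moreover have "?P \<subseteq> {Inf ?P..Sup ?P}"
        using cInf_lower[OF _ bdd(2)] cSup_upper[OF _ bdd(1)] by auto
      ultimately show ?thesis
        by (intro exI[of _ "{Inf ?P..Sup ?P}"] conjI) simp
    qed (auto intro!: exI[of _ "{}"])
    obtain V where
      "\<forall>i. V i \<in> sets borel \<and> \<gamma> -` U i \<subseteq> V i \<and> emeasure lborel (V i) \<le> ennreal (diameter (U i))"
      using choice[OF allI[OF ex]] by (rule exE)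
    then have V: "V i \<in> sets borel" "\<gamma> -` U i \<subseteq> V i"
      "emeasure lborel (V i) \<le> ennreal (diameter (U i))" for i
      by simp_all
    have "ennreal (u - l) = emeasure lborel {l<..<u}"
      using \<open>l \<le> u\<close> by simp
    also have "\<dots> \<le> emeasure lborel (\<Union>i. V i)"
    proof (rule emeasure_mono)
      show "{l<..<u} \<subseteq> (\<Union>i. V i)"
      proof
        fix t assume "t \<in> {l<..<u}"
        then obtain i where "\<gamma> t \<in> U i"
          using U(1) by blast
        then have "t \<in> V i"
          using V(2)[of i] by auto
        then show "t \<in> (\<Union>i. V i)" by blast
      qed
    qed (use V(1) in simp)
    also have "\<dots> \<le> (\<Sum>i. emeasure lborel (V i))"
      using V(1) by (intro emeasure_subadditive_countably) auto
    also have "\<dots> \<le> (\<Sum>i. ennreal (diameter (U i)))"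
      using V(3) by (intro suminf_le) auto
    finally show "ennreal (u - l) \<le> (\<Sum>i. ennreal (diameter (U i)))" .
  qed
  also have "\<dots> \<le> hausdorff1_outer (\<gamma> ` {l<..<u})"
    by (rule hausdorff1_outer_upper) simp
  finally show ?thesis .
qed

text \<open>Division into \<open>n\<close> equal closed pieces of length
  \<open>h <= \<delta>\<close>: their lengths add up to \<open>u - l\<close> at every scale.\<close>

lemma hausdorff1_outer_line_le:
  fixes \<gamma> :: "real \<Rightarrow> 'a::metric_space"
  assumes iso: "\<And>s t. dist (\<gamma> s) (\<gamma> t) = \<bar>s - t\<bar>" and "l \<le> u"
  shows "hausdorff1_outer (\<gamma> ` {l<..<u}) \<le> ennreal (u - l)"
proof (rule hausdorff1_outer_least)
  fix \<delta> :: real assume "\<delta> > 0"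
  obtain n :: nat where n: "(u - l) / \<delta> < real n"
    using reals_Archimedean2 by blast
  have "n > 0"
    using n \<open>l \<le> u\<close> \<open>\<delta> > 0\<close> by (cases n) (auto simp: field_simps)
  define h where "h = (u - l) / real n"
  have h: "0 \<le> h" "h \<le> \<delta>" "real n * h = u - l"
    using n \<open>l \<le> u\<close> \<open>\<delta> > 0\<close> \<open>n > 0\<close> by (auto simp: h_def field_simps)
  \<comment> \<open>Empty sets pad the finite division to a sequence, as the definition of the
    covers asks.\<close>
  define U where "U i = (if i < n then \<gamma> ` {l + real i * h..l + real (Suc i) * h} else {})" for i
  have dist_le: "dist x y \<le> h" if "x \<in> U i" "y \<in> U i" for x y i
    using that by (auto simp: U_def iso abs_le_iff algebra_simps split: if_splits)
  have bounded: "bounded (U i)" for i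
  proof (cases "U i = {}")
    case False
    then obtain x where "x \<in> U i" by blast
    then show ?thesis
      using dist_le unfolding bounded_def by blast
  qed simp
  have diam: "diameter (U i) \<le> h" for i
  proof (cases "U i = {}")
    case False
    then show ?thesis
      using dist_le unfolding diameter_def by (auto intro!: cSUP_least)
  qed (use h in simp)
  have "hausdorff1_pre \<delta> (\<gamma> ` {l<..<u}) \<le> (\<Sum>i. ennreal (diameter (U i)))"
  proof (rule hausdorff1_pre_le)
    show "\<gamma> ` {l<..<u} \<subseteq> (\<Union>i. U i)"
    proof safe
      fix t assume t: "t \<in> {l<..<u}"
      then have "h > 0"
        using h \<open>n > 0\<close> by (cases "h = 0") auto
      define i where "i = nat \<lfloor>(t - l) / h\<rfloor>"
      have "real i \<le> (t - l) / h" "(t - l) / h < real i + 1"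
        using t \<open>h > 0\<close> unfolding i_def by (auto simp: of_nat_nat le_floor_iff intro: of_int_floor_le)
      then have i: "l + real i * h \<le> t" "t \<le> l + real (Suc i) * h"
        using \<open>h > 0\<close> by (auto simp: field_simps)
      have "real i * h < real n * h"
        using i(1) t h(3) by simp
      then have "i < n"
        using \<open>h > 0\<close> by simp
      then have "\<gamma> t \<in> U i"
        using i by (auto simp: U_def)
      then show "\<gamma> t \<in> (\<Union>i. U i)" by blast
    qed
  qed (use bounded diam h(2) order_trans in \<open>blast+\<close>)
  also have "\<dots> = (\<Sum>i<n. ennreal (diameter (U i)))"
    by (rule suminf_finite) (auto simp: U_def)
  also have "\<dots> \<le> (\<Sum>i<n. ennreal h)"
    by (intro sum_mono ennreal_leI diam)
  also have "\<dots> = ennreal (u - l)"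
    using h by (simp add: ennreal_of_nat_eq_real_of_nat ennreal_mult[symmetric])
  finally show "hausdorff1_pre \<delta> (\<gamma> ` {l<..<u}) \<le> ennreal (u - l)" .
qed

text \<open>Pulling \<open>hausdorff1\<close> back to the parameter gives a Borel measure with the
  right value on bounded open intervals, and these determine Lebesgue measure.\<close>

lemma emeasure_hausdorff1_line:
  fixes p v :: "'a::euclidean_space"
  assumes v: "norm v = 1" and T: "T \<in> sets borel"
  shows "emeasure hausdorff1 ((\<lambda>t. p + t *\<^sub>R v) ` T) = emeasure lborel T"
    and "(\<lambda>t. p + t *\<^sub>R v) ` T \<in> sets borel"
proof -
  define \<gamma> where "\<gamma> t = p + t *\<^sub>R v" for t
  \<comment> \<open>The coordinate along the line is a continuous left inverse of
    \<open>\<gamma>\<close>. It turns images under \<open>\<gamma>\<close> into preimages within the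
    closed range, which makes them measurable.\<close>
  define \<pi> where "\<pi> x = (x - p) \<bullet> v" for x
  have vv: "v \<bullet> v = 1"
    using v by (simp add: dot_square_norm)
  have \<pi>: "\<pi> (\<gamma> t) = t" for t
    by (simp add: \<pi>_def \<gamma>_def vv)
  have iso: "dist (\<gamma> s) (\<gamma> t) = \<bar>s - t\<bar>" for s t
    using v by (simp add: \<gamma>_def dist_norm flip: scaleR_diff_left)
  have [measurable]: "\<pi> \<in> borel_measurable borel"
    unfolding \<pi>_def by measurable
  have range: "range \<gamma> = {x. \<gamma> (\<pi> x) = x}"
    using \<pi> by (auto, metis rangeI)
  have [measurable]: "range \<gamma> \<in> sets borel"
    unfolding range by (intro borel_closed closed_Collect_eq) (auto simp: \<gamma>_def \<pi>_def intro!: continuous_intros)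
  have image: "\<gamma> ` S = \<pi> -` S \<inter> range \<gamma>" for S
    using \<pi> by (auto simp: image_iff)
  have sets: "\<gamma> ` S \<in> sets borel" if "S \<in> sets borel" for S
  proof -
    have "\<pi> -` S \<inter> space borel \<in> sets borel"
      using that by (rule measurable_sets[rotated]) measurable
    then have "\<pi> -` S \<in> sets borel" by simp
    then show ?thesis
      unfolding image[of S] using \<open>range \<gamma> \<in> sets borel\<close> by (rule sets.Int)
  qed
  define N where "N = distr (density hausdorff1 (indicator (range \<gamma>))) borel \<pi>"
  have N: "emeasure N S = emeasure hausdorff1 (\<gamma> ` S)" if S: "S \<in> sets borel" for S
  proof -
    have "\<pi> -` S \<inter> space borel \<in> sets borel"
      using S by (rule measurable_sets[rotated]) measurable
    then have \<pi>S: "\<pi> -` S \<in> sets borel" by simp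
    have "emeasure N S = emeasure (density hausdorff1 (indicator (range \<gamma>))) (\<pi> -` S)"
    proof -
      have "\<pi> \<in> measurable (density hausdorff1 (indicator (range \<gamma>))) borel"
        using \<open>\<pi> \<in> borel_measurable borel\<close>
        by (simp only: measurable_density_eq1 cong: measurable_cong_sets[OF sets_hausdorff1 refl])
      from emeasure_distr[OF this S] show ?thesis
        unfolding N_def by (simp only: space_density space_hausdorff1 Int_UNIV_right)
    qed
    also have "\<dots> = (\<integral>\<^sup>+x. indicator (range \<gamma>) x * indicator (\<pi> -` S) x \<partial>hausdorff1)"
      by (rule emeasure_density) (use \<pi>S in \<open>simp_all\<close>)
    also have "\<dots> = (\<integral>\<^sup>+x. indicator (\<gamma> ` S) x \<partial>hausdorff1)"
      by (intro nn_integral_cong, subst image) (auto split: split_indicator)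
    also have "\<dots> = emeasure hausdorff1 (\<gamma> ` S)"
      using sets[OF S] by simp
    finally show ?thesis .
  qed
  have "lborel = N"
  proof (rule lborel_eqI)
    fix l u :: real assume "\<And>b. b \<in> Basis \<Longrightarrow> l \<bullet> b \<le> u \<bullet> b"
    then have "l \<le> u" by simp
    then have "hausdorff1_outer (\<gamma> ` {l<..<u}) = ennreal (u - l)"
      by (intro antisym hausdorff1_outer_line_le hausdorff1_outer_line_ge iso)
    then show "emeasure N (box l u) = (\<Prod>b\<in>Basis. (u - l) \<bullet> b)"
      using sets[of "{l<..<u}"] by (simp add: N emeasure_hausdorff1 box_real)
  qed (simp add: N_def)
  then show "emeasure hausdorff1 ((\<lambda>t. p + t *\<^sub>R v) ` T) = emeasure lborel T"
    using N[OF T] unfolding \<gamma>_def by simp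
  show "(\<lambda>t. p + t *\<^sub>R v) ` T \<in> sets borel"
    using sets[OF T] unfolding \<gamma>_def .
qed

section \<open>Frames and parametrizations of segments\<close>

definition seg_tangent :: "oseg \<Rightarrow> real^2" where
  "seg_tangent S = vector [cos (seg_angle S), sin (seg_angle S)]"

lemma inner_real2: "(x :: real^2) \<bullet> y = x $ 1 * y $ 1 + x $ 2 * y $ 2"
  by (simp add: inner_vec_def sum_2)

lemma seg_param_eq: "seg_param S t = seg_start S + t *\<^sub>R seg_tangent S"
  by (simp add: seg_param_def seg_tangent_def)

lemma norm_seg_tangent [simp]: "norm (seg_tangent S) = 1"
  by (simp add: norm_eq_sqrt_inner inner_real2 seg_tangent_def flip: power2_eq_square)

lemma seg_normal_normal [simp]: "seg_normal S \<bullet> seg_normal S = 1"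
  by (simp add: inner_real2 seg_normal_def flip: power2_eq_square)

lemma seg_tangent_inner [simp]: "seg_tangent S \<bullet> seg_tangent S = 1" "seg_tangent S \<bullet> seg_normal S = 0"
  by (simp_all add: inner_real2 seg_tangent_def seg_normal_def flip: power2_eq_square)

lemma continuous_on_seg_param [continuous_intros]: "continuous_on A f \<Longrightarrow> continuous_on A (\<lambda>x. seg_param S (f x))"
  unfolding seg_param_eq by (intro continuous_intros)

lemma seg_param_measurable [measurable]: "seg_param S \<in> borel_measurable borel"
  by (intro borel_measurable_continuous_onI continuous_on_seg_param continuous_on_id)

lemma inj_seg_param: "inj (seg_param S)"
proof (rule injI)
  fix s t assume "seg_param S s = seg_param S t"
  then have "(s - t) *\<^sub>R seg_tangent S = 0"
    by (simp add: seg_param_eq scaleR_diff_left)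
  then show "s = t"
    using norm_seg_tangent[of S] by (metis eq_iff_diff_eq_0 norm_zero scaleR_eq_0_iff zero_neq_one)
qed

lemma emeasure_hausdorff1_seg_param:
  assumes "T \<in> sets borel"
  shows "emeasure hausdorff1 (seg_param S ` T) = emeasure lborel T"
    and "seg_param S ` T \<in> sets borel"
  using emeasure_hausdorff1_line[OF norm_seg_tangent assms, of "seg_start S" S]
  unfolding seg_param_eq[abs_def] by auto

lemma seg_set_borel [measurable]: "seg_set S \<in> sets borel"
  unfolding seg_set_def by (rule emeasure_hausdorff1_seg_param) simp

lemma seg_set_eq_closed_segment:
  assumes "is_oseg S"
  shows "seg_set S = closed_segment (seg_param S 0) (seg_param S (seg_length S))"
proof -
  have L: "seg_length S > 0" using assms by (simp add: is_oseg_def)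
  have "(1 - u) *\<^sub>R seg_param S 0 + u *\<^sub>R seg_param S (seg_length S) = seg_param S (u * seg_length S)" for u
    by (simp add: seg_param_eq algebra_simps)
  then have "closed_segment (seg_param S 0) (seg_param S (seg_length S)) = (\<lambda>u. seg_param S (u * seg_length S)) ` {0..1}"
    by (auto simp: closed_segment_def image_iff)
  also have "\<dots> = seg_param S ` ((\<lambda>u. u * seg_length S) ` {0..1})"
    by (simp add: image_image)
  also have "(\<lambda>u. u * seg_length S) ` {0..1} = {0..seg_length S}"
    using L by (simp add: image_mult_atLeastAtMost_if' )
  finally show ?thesis
    by (simp add: seg_set_def)
qed

lemma emeasure_hausdorff1_singleton: "emeasure hausdorff1 {x :: real^2} = 0"
proof -
  define S where "S = OSeg x 0 1"
  have "emeasure hausdorff1 (seg_param S ` {0}) = 0"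
    by (subst emeasure_hausdorff1_seg_param) auto
  then show ?thesis
    by (simp add: seg_param_def S_def)
qed

lemma emeasure_hausdorff1_finite: "finite A \<Longrightarrow> emeasure hausdorff1 (A :: (real^2) set) = 0"
  by (subst emeasure_eq_sum_singleton) (auto simp: emeasure_hausdorff1_singleton)

text \<open>An equality of measures, so that integrability as well as integrals over a segment can
  be moved to the parameter interval.\<close>

lemma density_hausdorff1_seg:
  "density hausdorff1 (\<lambda>x. ennreal (indicator (seg_set S) x)) =
   distr (density lborel (\<lambda>t. ennreal (indicator {0..seg_length S} t))) borel (seg_param S)"
proof (rule measure_eqI)
  fix A assume "A \<in> sets (density hausdorff1 (\<lambda>x. ennreal (indicator (seg_set S) x)))"
  then have A: "A \<in> sets borel" by simp
  have pA: "seg_param S -` A \<in> sets borel"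
    using measurable_sets[OF seg_param_measurable A] by simp
  have "emeasure (density hausdorff1 (\<lambda>x. ennreal (indicator (seg_set S) x))) A =
      emeasure hausdorff1 (seg_set S \<inter> A)"
    using A by (simp add: emeasure_density ennreal_indicator flip: indicator_inter_arith)
  also have "seg_set S \<inter> A = seg_param S ` ({0..seg_length S} \<inter> seg_param S -` A)"
    by (auto simp: seg_set_def)
  also have "emeasure hausdorff1 \<dots> = emeasure lborel ({0..seg_length S} \<inter> seg_param S -` A)"
    using pA by (intro emeasure_hausdorff1_seg_param) auto
  also have "\<dots> = emeasure (density lborel (\<lambda>t. ennreal (indicator {0..seg_length S} t))) (seg_param S -` A)"
    using pA by (simp add: emeasure_density ennreal_indicator flip: indicator_inter_arith)
  also have "\<dots> = emeasure (distr (density lborel (\<lambda>t. ennreal (indicator {0..seg_length S} t))) borel (seg_param S)) A"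
    using A by (simp add: emeasure_distr)
  finally show "emeasure (density hausdorff1 (\<lambda>x. ennreal (indicator (seg_set S) x))) A =
      emeasure (distr (density lborel (\<lambda>t. ennreal (indicator {0..seg_length S} t))) borel (seg_param S)) A" .
qed simp

lemma
  fixes f :: "real^2 \<Rightarrow> real"
  assumes f: "f \<in> borel_measurable borel"
  shows set_integral_seg: "(LINT x:seg_set S|hausdorff1. f x) = (LINT t:{0..seg_length S}|lborel. f (seg_param S t))"
    and set_integrable_seg: "set_integrable hausdorff1 (seg_set S) f \<longleftrightarrow>
      set_integrable lborel {0..seg_length S} (\<lambda>t. f (seg_param S t))"
proof -
  have f': "f \<in> borel_measurable hausdorff1" "(\<lambda>t. f (seg_param S t)) \<in> borel_measurable lborel"
    using f measurable_compose[OF seg_param_measurable f] by auto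
  have "(LINT x:seg_set S|hausdorff1. f x) =
      integral\<^sup>L (density hausdorff1 (\<lambda>x. ennreal (indicator (seg_set S) x))) f"
    unfolding set_lebesgue_integral_def using f' by (subst integral_density) auto
  also have "\<dots> = (LINT t:{0..seg_length S}|lborel. f (seg_param S t))"
    unfolding set_lebesgue_integral_def density_hausdorff1_seg
    using f f' by (simp add: integral_distr integral_density)
  finally show "(LINT x:seg_set S|hausdorff1. f x) = (LINT t:{0..seg_length S}|lborel. f (seg_param S t))" .
  have "set_integrable hausdorff1 (seg_set S) f \<longleftrightarrow>
      integrable (density hausdorff1 (\<lambda>x. ennreal (indicator (seg_set S) x))) f"
    unfolding set_integrable_def using f' by (subst integrable_density) auto
  also have "\<dots> \<longleftrightarrow> set_integrable lborel {0..seg_length S} (\<lambda>t. f (seg_param S t))"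
    unfolding set_integrable_def density_hausdorff1_seg
    using f f' by (simp add: integrable_distr_eq integrable_density)
  finally show "set_integrable hausdorff1 (seg_set S) f \<longleftrightarrow>
      set_integrable lborel {0..seg_length S} (\<lambda>t. f (seg_param S t))" .
qed

lemma measure_hausdorff1_seg_Int:
  assumes A: "A \<in> sets borel"
  shows "measure hausdorff1 (seg_set S \<inter> A) = measure lborel {t \<in> {0..seg_length S}. seg_param S t \<in> A}"
proof -
  have pA: "seg_param S -` A \<in> sets borel"
    using measurable_sets[OF seg_param_measurable A] by simp
  have "seg_set S \<inter> A = seg_param S ` ({0..seg_length S} \<inter> seg_param S -` A)"
    by (auto simp: seg_set_def)
  moreover have "{0..seg_length S} \<inter> seg_param S -` A = {t \<in> {0..seg_length S}. seg_param S t \<in> A}"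
    by auto
  moreover have "emeasure hausdorff1 (seg_param S ` ({0..seg_length S} \<inter> seg_param S -` A)) =
      emeasure lborel ({0..seg_length S} \<inter> seg_param S -` A)"
    using pA by (intro emeasure_hausdorff1_seg_param) auto
  ultimately show ?thesis
    unfolding measure_def by simp
qed

section \<open>Polygonal chains\<close>

abbreviation connected_chain :: "oseg list \<Rightarrow> bool" where
  "connected_chain C \<equiv>
    (\<forall>k. Suc k < length C \<longrightarrow> seg_param (C ! k) (seg_length (C ! k)) = seg_param (C ! Suc k) 0)"

lemma connected_chain_Cons:
  assumes "connected_chain (S # T # C)"
  shows "connected_chain (T # C)" "seg_param S (seg_length S) = seg_param T 0"
proof -
  show "connected_chain (T # C)"
  proof (intro allI impI)
    fix k assume "Suc k < length (T # C)"
    then show "seg_param ((T # C) ! k) (seg_length ((T # C) ! k)) = seg_param ((T # C) ! Suc k) 0"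
      using assms[rule_format, of "Suc k"] by simp
  qed
  show "seg_param S (seg_length S) = seg_param T 0"
    using assms[rule_format, of 0] by simp
qed

lemma chain_path_endpoint_image:
  assumes "C \<noteq> []" "\<forall>S \<in> set C. is_oseg S" "connected_chain C"
  shows "pathstart (chain_path C) = seg_param (hd C) 0 \<and> path_image (chain_path C) = chain_set C"
  using assms
proof (induction C rule: chain_path.induct)
  case (3 S T C)
  note conn = connected_chain_Cons[OF 3(4)]
  have IH: "pathstart (chain_path (T # C)) = seg_param T 0" "path_image (chain_path (T # C)) = chain_set (T # C)"
    using 3(1)[OF _ _ conn(1)] 3(3) by auto
  have "path_image (chain_path (S # T # C)) =
      closed_segment (seg_param S 0) (seg_param S (seg_length S)) \<union> chain_set (T # C)"
    using conn(2) IH by (simp add: path_image_join del: chain_path.simps(2))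
  then show ?case
    using 3(3) seg_set_eq_closed_segment[of S] by (auto simp: chain_set_def)
qed (auto simp: chain_set_def seg_set_eq_closed_segment)

text \<open>When a join is simple, its first segment meets the rest at most in its own start and in
  the junction, and the rest is an arc, hence again a simple path. This is the induction
  step.\<close>

lemma polygonal_chain_pairwise_finite:
  assumes "C \<noteq> []" "\<forall>S \<in> set C. is_oseg S" "connected_chain C" "simple_path (chain_path C)"
  shows "i < k \<Longrightarrow> k < length C \<Longrightarrow> finite (seg_set (C ! i) \<inter> seg_set (C ! k))"
  using assms
proof (induction C arbitrary: i k rule: chain_path.induct)
  case (3 S T C)
  note conn = connected_chain_Cons[OF 3(6)]
  let ?g = "linepath (seg_param S 0) (seg_param S (seg_length S))"
  have img: "pathstart (chain_path (T # C)) = seg_param T 0" "path_image (chain_path (T # C)) = chain_set (T # C)"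
    using chain_path_endpoint_image[of "T # C"] conn(1) 3(5) by auto
  have simple: "simple_path (?g +++ chain_path (T # C))"
    using 3(7) by simp
  have fs: "pathfinish ?g = pathstart (chain_path (T # C))"
    using conn(2) img(1) by simp
  obtain arc: "arc (chain_path (T # C))"
    and Int: "path_image ?g \<inter> path_image (chain_path (T # C)) \<subseteq> {pathstart ?g, pathstart (chain_path (T # C))}"
    using simple_path_joinE[OF simple fs] by blast
  show ?case
  proof (cases i)
    case 0
    then obtain k' where k: "k = Suc k'" "k' < length (T # C)"
      using 3(2,3) by (cases k) auto
    have "seg_set S = path_image ?g"
      using 3(5) seg_set_eq_closed_segment[of S] by simp
    moreover have "seg_set ((T # C) ! k') \<subseteq> path_image (chain_path (T # C))"
      unfolding img(2) chain_set_def using k(2) nth_mem by blast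
    ultimately have "seg_set ((S # T # C) ! i) \<inter> seg_set ((S # T # C) ! k) \<subseteq>
        {pathstart ?g, pathstart (chain_path (T # C))}"
      using Int 0 k by auto
    then show ?thesis
      by (rule finite_subset) simp
  next
    case (Suc i')
    then obtain k' where k: "k = Suc k'" "i' < k'" "k' < length (T # C)"
      using 3(2,3) by (cases k) auto
    have "finite (seg_set ((T # C) ! i') \<inter> seg_set ((T # C) ! k'))"
      using 3(1)[OF k(2,3) _ _ conn(1) arc_imp_simple_path[OF arc]] 3(5) by auto
    then show ?thesis
      using Suc k by simp
  qed
qed auto

lemma polygonal_chain_finite_Int:
  assumes "polygonal_chain C" "i \<noteq> k" "i < length C" "k < length C"
  shows "finite (seg_set (C ! i) \<inter> seg_set (C ! k))"
  using polygonal_chain_pairwise_finite[of C i k] polygonal_chain_pairwise_finite[of C k i] assms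
  unfolding polygonal_chain_def by (cases "i < k") (auto simp: Int_commute)

text \<open>Away from these points at most one segment of the chain contains the point, and then in
  its relative interior, so indicator and normal of the chain are those of that segment. For a
  polygonal chain the set is finite and thus null.\<close>

definition chain_exceptional :: "oseg list \<Rightarrow> (real^2) set" where
  "chain_exceptional C =
    (\<Union>k<length C. {seg_param (C ! k) 0, seg_param (C ! k) (seg_length (C ! k))}) \<union>
    (\<Union>k<length C. \<Union>i\<in>{..<length C} - {k}. seg_set (C ! i) \<inter> seg_set (C ! k))"

lemma finite_chain_exceptional: "polygonal_chain C \<Longrightarrow> finite (chain_exceptional C)"
  unfolding chain_exceptional_def
  by (intro finite_UnI finite_UN_I polygonal_chain_finite_Int) auto

lemma indicator_chain_set_eq:
  assumes "x \<notin> chain_exceptional C"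
  shows "indicator (chain_set C) x = (\<Sum>k<length C. indicator (seg_set (C ! k)) x :: real)"
proof (cases "\<exists>k<length C. x \<in> seg_set (C ! k)")
  case True
  then obtain k where k: "k < length C" "x \<in> seg_set (C ! k)" by blast
  have "(\<Sum>i<length C. indicator (seg_set (C ! i)) x :: real) = (\<Sum>i<length C. if i = k then 1 else 0)"
    using k assms by (intro sum.cong) (auto simp: chain_exceptional_def indicator_def)
  moreover have "x \<in> chain_set C"
    using k nth_mem unfolding chain_set_def by blast
  ultimately show ?thesis
    using k by simp
next
  case False
  then have "x \<notin> chain_set C"
    by (auto simp: chain_set_def in_set_conv_nth)
  then show ?thesis
    using False by simp
qed

lemma chain_normal_eq:
  assumes C: "polygonal_chain C" and x: "x \<notin> chain_exceptional C" and k: "k < length C" "x \<in> seg_set (C ! k)"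
  shows "chain_normal C x = seg_normal (C ! k)"
proof -
  have oseg: "is_oseg (C ! i)" if "i < length C" for i
    using C that by (auto simp: polygonal_chain_def)
  have rel: "rel_interior (seg_set (C ! i)) = seg_set (C ! i) - {seg_param (C ! i) 0, seg_param (C ! i) (seg_length (C ! i))}"
    if "i < length C" for i
  proof -
    have "seg_param (C ! i) 0 \<noteq> seg_param (C ! i) (seg_length (C ! i))"
      using oseg[OF that] inj_seg_param[of "C ! i"] by (auto simp: is_oseg_def inj_eq)
    then show ?thesis
      unfolding seg_set_eq_closed_segment[OF oseg[OF that]]
      by (simp add: rel_interior_closed_segment open_segment_def)
  qed
  have "i < length C \<and> x \<in> rel_interior (seg_set (C ! i)) \<longleftrightarrow> i = k" for i
  proof
    assume i: "i < length C \<and> x \<in> rel_interior (seg_set (C ! i))"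
    then have "x \<in> seg_set (C ! i)"
      using rel by auto
    then show "i = k"
      using i k x unfolding chain_exceptional_def by blast
  next
    assume "i = k"
    then show "i < length C \<and> x \<in> rel_interior (seg_set (C ! i))"
      using k x rel[OF k(1)] unfolding chain_exceptional_def by blast
  qed
  then show ?thesis
    unfolding chain_normal_def by auto
qed

text \<open>Off the null set \<open>chain_exceptional C\<close> the integrand is a sum over the
  segments, with a constant normal on each; every summand is then parametrized by arc
  length.\<close>

theorem integral_chain_normal:
  fixes V :: "real^2 \<Rightarrow> real^2"
  assumes C: "polygonal_chain C" and V: "continuous_on UNIV V"
  shows "(LINT x:chain_set C|hausdorff1. V x \<bullet> chain_normal C x) =
    (\<Sum>k<length C. LINT t:{0..seg_length (C ! k)}|lborel. V (seg_param (C ! k) t) \<bullet> seg_normal (C ! k))"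
proof -
  have Vn: "(\<lambda>x. V x \<bullet> seg_normal (C ! k)) \<in> borel_measurable borel" for k
    by (intro borel_measurable_continuous_onI continuous_intros V)
  have int: "set_integrable hausdorff1 (seg_set (C ! k)) (\<lambda>x. V x \<bullet> seg_normal (C ! k))" for k
    unfolding set_integrable_seg[OF Vn]
    by (intro borel_integrable_atLeastAtMost' continuous_intros continuous_on_compose2[OF V]) auto
  have "(LINT x:chain_set C|hausdorff1. V x \<bullet> chain_normal C x) =
      (LINT x|hausdorff1. (\<Sum>k<length C. indicator (seg_set (C ! k)) x *\<^sub>R (V x \<bullet> seg_normal (C ! k))))"
    unfolding set_lebesgue_integral_def
  proof (rule integral_discrete_difference)
    show "countable (chain_exceptional C)"
      using finite_chain_exceptional[OF C] by (rule countable_finite)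
    fix x assume x: "x \<notin> chain_exceptional C"
    have "indicator (chain_set C) x *\<^sub>R (V x \<bullet> chain_normal C x) =
        (\<Sum>k<length C. indicator (seg_set (C ! k)) x * (V x \<bullet> chain_normal C x))"
      by (simp add: indicator_chain_set_eq[OF x] sum_distrib_right)
    also have "\<dots> = (\<Sum>k<length C. indicator (seg_set (C ! k)) x * (V x \<bullet> seg_normal (C ! k)))"
      using chain_normal_eq[OF C x] by (intro sum.cong) (auto simp: indicator_def)
    finally show "indicator (chain_set C) x *\<^sub>R (V x \<bullet> chain_normal C x) =
        (\<Sum>k<length C. indicator (seg_set (C ! k)) x *\<^sub>R (V x \<bullet> seg_normal (C ! k)))" by simp
  qed (auto simp: emeasure_hausdorff1_singleton)
  also have "\<dots> = (\<Sum>k<length C. LINT x:seg_set (C ! k)|hausdorff1. V x \<bullet> seg_normal (C ! k))"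
    unfolding set_lebesgue_integral_def
    by (rule Bochner_Integration.integral_sum) (use int in \<open>simp add: set_integrable_def\<close>)
  also have "\<dots> = (\<Sum>k<length C. LINT t:{0..seg_length (C ! k)}|lborel. V (seg_param (C ! k) t) \<bullet> seg_normal (C ! k))"
    by (simp add: set_integral_seg[OF Vn])
  finally show ?thesis .
qed

lemma chain_set_borel: "chain_set C \<in> sets borel"
  unfolding chain_set_def by auto

lemma emeasure_seg_set_finite: "emeasure hausdorff1 (seg_set S) < top"
  unfolding seg_set_def by (subst emeasure_hausdorff1_seg_param) (auto simp: emeasure_lborel_Icc_eq)

text \<open>Distinct segments of a chain meet in finitely many points, so only the diagonal of the
  double sum survives, and a unit normal has inner product 1 with itself.\<close>

lemma chain_length_eq_signed_length:
  assumes C: "polygonal_chain C"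
  shows "chain_length C = signed_length C C"
proof -
  have int: "integrable hausdorff1 (indicator (seg_set S) :: _ \<Rightarrow> real)" for S
    using emeasure_seg_set_finite by (intro integrable_real_indicator) auto
  have "chain_length C = (LINT x|hausdorff1. indicator (chain_set C) x)"
    using chain_set_borel by (simp add: chain_length_def)
  also have "\<dots> = (LINT x|hausdorff1. (\<Sum>k<length C. indicator (seg_set (C ! k)) x))"
    using countable_finite[OF finite_chain_exceptional[OF C]]
    by (rule integral_discrete_difference) (auto simp: emeasure_hausdorff1_singleton indicator_chain_set_eq)
  also have "\<dots> = (\<Sum>k<length C. measure hausdorff1 (seg_set (C ! k)))"
    by (subst Bochner_Integration.integral_sum) (auto simp: int)
  also have "\<dots> = (\<Sum>k<length C. \<Sum>i<length C. if i = k then measure hausdorff1 (seg_set (C ! k)) else 0)"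
    by simp
  also have "\<dots> = signed_length C C"
    unfolding signed_length_def seg_signed_length_def
  proof (intro sum.cong refl)
    fix k i assume "k \<in> {..<length C}" "i \<in> {..<length C}"
    then show "(if i = k then measure hausdorff1 (seg_set (C ! k)) else 0) =
        measure hausdorff1 (seg_set (C ! k) \<inter> seg_set (C ! i)) * (seg_normal (C ! k) \<bullet> seg_normal (C ! i))"
      using polygonal_chain_finite_Int[OF C, of k i]
      by (auto simp: measure_def emeasure_hausdorff1_finite)
  qed
  finally show ?thesis .
qed

section \<open>Gaussian moments\<close>

text \<open>With a density, the even normal moments give \<open>\<sigma>^2\<close> and
  \<open>3 * \<sigma>^4\<close>. In the degenerate case the mean hypothesis forces the constant to
  be 0, and all these moments vanish.\<close>

lemma gaussian_rv_moments:
  assumes "prob_space M" and X: "gaussian_rv M X" and mean: "integral\<^sup>L M X = 0"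
  shows "integrable M X" "integrable M (\<lambda>w. (X w)\<^sup>2)" "integrable M (\<lambda>w. X w ^ 4)"
    "integral\<^sup>L M (\<lambda>w. X w ^ 4) = 3 * (integral\<^sup>L M (\<lambda>w. (X w)\<^sup>2))\<^sup>2"
proof -
  interpret prob_space M by fact
  have [measurable]: "X \<in> borel_measurable M"
    using X by (simp add: gaussian_rv_def)
  obtain \<mu> \<sigma> where cases: "(\<sigma> > 0 \<and> distributed M lborel X (\<lambda>x. ennreal (normal_density \<mu> \<sigma> x))) \<or> (AE w in M. X w = \<mu>)"
    using X by (auto simp: gaussian_rv_def)
  have "integrable M X \<and> integrable M (\<lambda>w. (X w)\<^sup>2) \<and> integrable M (\<lambda>w. X w ^ 4) \<and>
    integral\<^sup>L M (\<lambda>w. X w ^ 4) = 3 * (integral\<^sup>L M (\<lambda>w. (X w)\<^sup>2))\<^sup>2"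
    using cases
  proof
    assume A: "\<sigma> > 0 \<and> distributed M lborel X (\<lambda>x. ennreal (normal_density \<mu> \<sigma> x))"
    then have \<sigma>: "\<sigma> > 0" and D: "distributed M lborel X (\<lambda>x. ennreal (normal_density \<mu> \<sigma> x))" by auto
    have \<mu>: "\<mu> = 0"
      using normal_distributed_expectation[OF \<sigma> D] mean by simp
    have int: "integrable M (\<lambda>w. X w ^ n)" for n
      using distributed_integrable[OF D, of "\<lambda>x. x ^ n"] integrable_normal_moment[OF \<sigma>, of 0 n] \<mu> by simp
    have eq: "integral\<^sup>L M (\<lambda>w. X w ^ (2 * n)) = fact (2 * n) / ((2 / \<sigma>\<^sup>2) ^ n * fact n)" for n
      using distributed_integral[OF D, of "\<lambda>x. x ^ (2 * n)"] integral_normal_moment_even[OF \<sigma>, of 0 n] \<mu> by simp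
    have "integral\<^sup>L M (\<lambda>w. (X w)\<^sup>2) = \<sigma>\<^sup>2"
      using eq[of 1] by (simp add: fact_numeral)
    moreover have "integral\<^sup>L M (\<lambda>w. X w ^ 4) = 3 * (\<sigma>\<^sup>2)\<^sup>2"
      using eq[of 2] \<sigma> by (simp add: fact_numeral power2_eq_square field_simps)
    ultimately show ?thesis
      using int[of 1] int[of 2] int[of 4] by simp
  next
    assume A: "AE w in M. X w = \<mu>"
    have "integral\<^sup>L M X = integral\<^sup>L M (\<lambda>w. \<mu>)"
      using A by (intro integral_cong_AE) auto
    then have "\<mu> = 0"
      using mean by (simp add: prob_space)
    then have AE0: "AE w in M. X w = 0" using A by simp
    have "integrable M (\<lambda>w. X w ^ n) \<and> integral\<^sup>L M (\<lambda>w. X w ^ n) = 0" if "n > 0" for n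
    proof -
      have "AE w in M. X w ^ n = 0"
        using AE0 by eventually_elim (use that in simp)
      then show ?thesis
        by (auto intro: integral_eq_zero_AE simp: integrable_cong_AE[of "\<lambda>w. X w ^ n" M "\<lambda>_. 0"])
    qed
    from this[of 1] this[of 2] this[of 4] show ?thesis by simp
  qed
  then show "integrable M X" "integrable M (\<lambda>w. (X w)\<^sup>2)" "integrable M (\<lambda>w. X w ^ 4)"
    "integral\<^sup>L M (\<lambda>w. X w ^ 4) = 3 * (integral\<^sup>L M (\<lambda>w. (X w)\<^sup>2))\<^sup>2"
    by auto
qed

lemma integrable_mult_of_squares:
  fixes X Y :: "'w \<Rightarrow> real"
  assumes [measurable]: "X \<in> borel_measurable M" "Y \<in> borel_measurable M"
    and "integrable M (\<lambda>w. (X w)\<^sup>2)" "integrable M (\<lambda>w. (Y w)\<^sup>2)"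
  shows "integrable M (\<lambda>w. X w * Y w)"
proof (rule Bochner_Integration.integrable_bound)
  show "integrable M (\<lambda>w. (X w)\<^sup>2 + (Y w)\<^sup>2)"
    using assms by auto
  have "\<bar>x * y\<bar> \<le> x\<^sup>2 + y\<^sup>2" for x y :: real
  proof -
    have "2 * (\<bar>x\<bar> * \<bar>y\<bar>) \<le> x\<^sup>2 + y\<^sup>2"
      using sum_squares_bound[of "\<bar>x\<bar>" "\<bar>y\<bar>"] by (simp add: mult.assoc)
    moreover have "0 \<le> \<bar>x\<bar> * \<bar>y\<bar>" by simp
    ultimately show ?thesis unfolding abs_mult by linarith
  qed
  then show "AE w in M. norm (X w * Y w) \<le> norm ((X w)\<^sup>2 + (Y w)\<^sup>2)"
    by simp
qed simp

text \<open>The Gaussian case of Isserlis' theorem needed here follows by polarization from the fourth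
  moments of \<open>U + V\<close> and \<open>U - V\<close>.\<close>

lemma gaussian_pair_square_moment:
  assumes M: "prob_space M" and U: "gaussian_rv M U" "integral\<^sup>L M U = 0" "integral\<^sup>L M (\<lambda>w. (U w)\<^sup>2) = 1"
    and V: "gaussian_rv M V" "integral\<^sup>L M V = 0" "integral\<^sup>L M (\<lambda>w. (V w)\<^sup>2) = 1"
    and add: "gaussian_rv M (\<lambda>w. U w + V w)" and diff: "gaussian_rv M (\<lambda>w. U w - V w)"
    and \<rho>: "integral\<^sup>L M (\<lambda>w. U w * V w) = \<rho>"
  shows "integrable M (\<lambda>w. (U w)\<^sup>2 * (V w)\<^sup>2)" "integral\<^sup>L M (\<lambda>w. (U w)\<^sup>2 * (V w)\<^sup>2) = 1 + 2 * \<rho>\<^sup>2"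
proof -
  interpret prob_space M by fact
  note Um = gaussian_rv_moments[OF M U(1,2)]
  note Vm = gaussian_rv_moments[OF M V(1,2)]
  have [measurable]: "U \<in> borel_measurable M" "V \<in> borel_measurable M"
    using U(1) V(1) by (simp_all add: gaussian_rv_def)
  have UV: "integrable M (\<lambda>w. U w * V w)"
    using Um Vm by (intro integrable_mult_of_squares) auto
  have "integral\<^sup>L M (\<lambda>w. U w + V w) = 0" "integral\<^sup>L M (\<lambda>w. U w - V w) = 0"
    using Um Vm U V by auto
  note am = gaussian_rv_moments[OF M add this(1)] and dm = gaussian_rv_moments[OF M diff this(2)]
  have "(\<lambda>w. (U w + V w)\<^sup>2) = (\<lambda>w. (U w)\<^sup>2 + (V w)\<^sup>2 + 2 * (U w * V w))"
    by (auto simp: power2_sum algebra_simps)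
  then have a2: "integral\<^sup>L M (\<lambda>w. (U w + V w)\<^sup>2) = 2 + 2 * \<rho>"
    using Um Vm UV U V \<rho> by simp
  have "(\<lambda>w. (U w - V w)\<^sup>2) = (\<lambda>w. (U w)\<^sup>2 + (V w)\<^sup>2 - 2 * (U w * V w))"
    by (auto simp: power2_diff algebra_simps)
  then have d2: "integral\<^sup>L M (\<lambda>w. (U w - V w)\<^sup>2) = 2 - 2 * \<rho>"
    using Um Vm UV U V \<rho> by simp
  have id: "(U w)\<^sup>2 * (V w)\<^sup>2 = 1/12 * ((U w + V w) ^ 4 + (U w - V w) ^ 4 - 2 * U w ^ 4 - 2 * V w ^ 4)" for w
    by (simp add: power2_eq_square power4_eq_xxxx algebra_simps)
  show "integrable M (\<lambda>w. (U w)\<^sup>2 * (V w)\<^sup>2)"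
    unfolding id using am dm Um Vm by auto
  have "integral\<^sup>L M (\<lambda>w. (U w)\<^sup>2 * (V w)\<^sup>2) = 1/12 * (3 * (2 + 2 * \<rho>)\<^sup>2 + 3 * (2 - 2 * \<rho>)\<^sup>2 - 2 * 3 - 2 * 3)"
    unfolding id using am(3,4) dm(3,4) Um(3,4) Vm(3,4) U(3) V(3) a2 d2 by simp
  also have "\<dots> = 1 + 2 * \<rho>\<^sup>2"
    by (simp add: power2_eq_square algebra_simps)
  finally show "integral\<^sup>L M (\<lambda>w. (U w)\<^sup>2 * (V w)\<^sup>2) = 1 + 2 * \<rho>\<^sup>2" .
qed

section \<open>Limits in mean square\<close>

text \<open>The indices tend to infinity independently: convergence along the diagonal alone would
  not control the mean square of \<open>X n - X m\<close>.\<close>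

definition cross_moment_limit :: "'w measure \<Rightarrow> (nat \<Rightarrow> 'w \<Rightarrow> real) \<Rightarrow> (nat \<Rightarrow> 'w \<Rightarrow> real) \<Rightarrow> real \<Rightarrow> bool" where
  "cross_moment_limit M X Y c \<longleftrightarrow>
    (\<forall>e>0. \<exists>N. \<forall>n\<ge>N. \<forall>m\<ge>N. \<bar>integral\<^sup>L M (\<lambda>w. X n w * Y m w) - c\<bar> \<le> e)"

lemma cross_moment_limit_tendsto:
  assumes "cross_moment_limit M X Y c"
  shows "(\<lambda>n. integral\<^sup>L M (\<lambda>w. X n w * Y n w)) \<longlonglongrightarrow> c"
proof (rule LIMSEQ_I)
  fix r :: real assume "r > 0"
  then obtain N where "\<forall>n\<ge>N. \<bar>integral\<^sup>L M (\<lambda>w. X n w * Y n w) - c\<bar> \<le> r / 2"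
    using assms unfolding cross_moment_limit_def by (meson half_gt_zero)
  then show "\<exists>N. \<forall>n\<ge>N. norm (integral\<^sup>L M (\<lambda>w. X n w * Y n w) - c) < r"
    using \<open>r > 0\<close> by (intro exI[of _ N]) fastforce
qed

text \<open>The second moment of \<open>X n - X m\<close> is small since the limits
  \<open>c - 2 * c + c\<close> cancel. Fatou's lemma in \<open>m\<close> carries this over to the
  pointwise limit \<open>X'\<close>, which is thereby a mean-square limit too.\<close>

lemma mean_square_limit:
  fixes X :: "nat \<Rightarrow> 'w \<Rightarrow> real"
  assumes [measurable]: "\<And>n. X n \<in> borel_measurable M" "X' \<in> borel_measurable M"
    and lim: "\<And>w. w \<in> space M \<Longrightarrow> (\<lambda>n. X n w) \<longlonglongrightarrow> X' w"
    and int: "\<And>n m. integrable M (\<lambda>w. X n w * X m w)"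
    and cauchy: "cross_moment_limit M X X c"
  shows "\<And>n. integrable M (\<lambda>w. (X n w - X' w)\<^sup>2)" "integrable M (\<lambda>w. (X' w)\<^sup>2)"
    "(\<lambda>n. integral\<^sup>L M (\<lambda>w. (X n w - X' w)\<^sup>2)) \<longlonglongrightarrow> 0"
proof -
  have le: "\<exists>N. \<forall>n\<ge>N. (\<integral>\<^sup>+w. ennreal ((X n w - X' w)\<^sup>2) \<partial>M) \<le> ennreal (4 * e)" if e: "e > 0" for e
  proof -
    obtain N where N: "\<And>n m. n \<ge> N \<Longrightarrow> m \<ge> N \<Longrightarrow> \<bar>integral\<^sup>L M (\<lambda>w. X n w * X m w) - c\<bar> \<le> e"
      using cauchy e unfolding cross_moment_limit_def by blast
    have diff: "(\<integral>\<^sup>+w. ennreal ((X n w - X m w)\<^sup>2) \<partial>M) \<le> ennreal (4 * e)" if "n \<ge> N" "m \<ge> N" for n m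
    proof -
      have eq: "(\<lambda>w. (X n w - X m w)\<^sup>2) = (\<lambda>w. X n w * X n w - 2 * (X n w * X m w) + X m w * X m w)"
        by (auto simp: power2_eq_square algebra_simps)
      have "integral\<^sup>L M (\<lambda>w. (X n w - X m w)\<^sup>2) = integral\<^sup>L M (\<lambda>w. X n w * X n w)
          - 2 * integral\<^sup>L M (\<lambda>w. X n w * X m w) + integral\<^sup>L M (\<lambda>w. X m w * X m w)"
        unfolding eq using int by simp
      \<comment> \<open>The three expectations are within \<open>e\<close> of \<open>c\<close> and
        enter with the weights 1, 2 and 1.\<close>
      also have "\<dots> \<le> 4 * e"
        using N[of n n] N[of n m] N[of m m] that by (simp add: abs_le_iff)
      finally have "integral\<^sup>L M (\<lambda>w. (X n w - X m w)\<^sup>2) \<le> 4 * e" .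
      moreover have "integrable M (\<lambda>w. (X n w - X m w)\<^sup>2)"
        unfolding eq using int by auto
      ultimately show ?thesis
        by (subst nn_integral_eq_integral) (auto intro: ennreal_leI)
    qed
    have "(\<integral>\<^sup>+w. ennreal ((X n w - X' w)\<^sup>2) \<partial>M) \<le> ennreal (4 * e)" if n: "n \<ge> N" for n
    proof -
      have "(\<integral>\<^sup>+w. ennreal ((X n w - X' w)\<^sup>2) \<partial>M) = (\<integral>\<^sup>+w. liminf (\<lambda>m. ennreal ((X n w - X m w)\<^sup>2)) \<partial>M)"
      proof (rule nn_integral_cong)
        fix w assume "w \<in> space M"
        then have "(\<lambda>m. ennreal ((X n w - X m w)\<^sup>2)) \<longlonglongrightarrow> ennreal ((X n w - X' w)\<^sup>2)"
          by (intro tendsto_ennrealI tendsto_intros lim)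
        then show "ennreal ((X n w - X' w)\<^sup>2) = liminf (\<lambda>m. ennreal ((X n w - X m w)\<^sup>2))"
          by (rule lim_imp_Liminf[OF sequentially_bot, symmetric])
      qed
      also have "\<dots> \<le> liminf (\<lambda>m. \<integral>\<^sup>+w. ennreal ((X n w - X m w)\<^sup>2) \<partial>M)"
        by (rule nn_integral_liminf) simp
      also have "\<dots> \<le> limsup (\<lambda>m. \<integral>\<^sup>+w. ennreal ((X n w - X m w)\<^sup>2) \<partial>M)"
        by (rule Liminf_le_Limsup) simp
      also have "\<dots> \<le> ennreal (4 * e)"
        using diff[OF n] by (intro Limsup_bounded) (auto simp: eventually_sequentially)
      finally show ?thesis .
    qed
    then show ?thesis by blast
  qed
  obtain N where N: "(\<integral>\<^sup>+w. ennreal ((X N w - X' w)\<^sup>2) \<partial>M) \<le> ennreal 4"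
    using le[of 1] by auto
  have sq: "integrable M (\<lambda>w. (X n w)\<^sup>2)" for n
    using int[of n n] by (simp add: power2_eq_square)
  have dN: "integrable M (\<lambda>w. (X N w - X' w)\<^sup>2)"
    using N by (intro integrableI_bounded) (auto intro: le_less_trans)
  have bound: "(a - b)\<^sup>2 \<le> 2 * a\<^sup>2 + 2 * b\<^sup>2" for a b :: real
    using zero_le_power2[of "a + b"] by (simp add: power2_sum power2_diff)
  show X': "integrable M (\<lambda>w. (X' w)\<^sup>2)"
  proof (rule Bochner_Integration.integrable_bound)
    show "integrable M (\<lambda>w. 2 * (X N w)\<^sup>2 + 2 * (X N w - X' w)\<^sup>2)"
      using sq dN by auto
    show "AE w in M. norm ((X' w)\<^sup>2) \<le> norm (2 * (X N w)\<^sup>2 + 2 * (X N w - X' w)\<^sup>2)"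
      using bound[of "X N w" "X N w - X' w" for w] by simp
  qed simp
  show d: "integrable M (\<lambda>w. (X n w - X' w)\<^sup>2)" for n
  proof (rule Bochner_Integration.integrable_bound)
    show "integrable M (\<lambda>w. 2 * (X n w)\<^sup>2 + 2 * (X' w)\<^sup>2)"
      using sq X' by auto
    show "AE w in M. norm ((X n w - X' w)\<^sup>2) \<le> norm (2 * (X n w)\<^sup>2 + 2 * (X' w)\<^sup>2)"
      using bound[of "X n w" "X' w" for w] by simp
  qed simp
  show "(\<lambda>n. integral\<^sup>L M (\<lambda>w. (X n w - X' w)\<^sup>2)) \<longlonglongrightarrow> 0"
  proof (rule LIMSEQ_I)
    fix r :: real assume "r > 0"
    then obtain N where N: "\<And>n. n \<ge> N \<Longrightarrow> (\<integral>\<^sup>+w. ennreal ((X n w - X' w)\<^sup>2) \<partial>M) \<le> ennreal (4 * (r / 8))"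
      using le[of "r / 8"] by auto
    have "norm (integral\<^sup>L M (\<lambda>w. (X n w - X' w)\<^sup>2) - 0) < r" if "n \<ge> N" for n
    proof -
      have "ennreal (integral\<^sup>L M (\<lambda>w. (X n w - X' w)\<^sup>2)) \<le> ennreal (4 * (r / 8))"
        using N[OF that] d[of n] by (subst (asm) nn_integral_eq_integral) auto
      then have "integral\<^sup>L M (\<lambda>w. (X n w - X' w)\<^sup>2) \<le> 4 * (r / 8)"
        using \<open>r > 0\<close> by (subst (asm) ennreal_le_iff) auto
      then show ?thesis
        using \<open>r > 0\<close> by simp
    qed
    then show "\<exists>N. \<forall>n\<ge>N. norm (integral\<^sup>L M (\<lambda>w. (X n w - X' w)\<^sup>2) - 0) < r" by blast
  qed
qed

text \<open>The difference of the products splits as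
  \<open>(X n - X') * Y n + (Y n - Y') * X'\<close>. An arithmetic-geometric inequality with weight
  \<open>\<delta>\<close> does the work of Cauchy-Schwarz: as \<open>n\<close> grows an error
  \<open>\<delta> * C\<close> remains, for every positive \<open>\<delta>\<close>.\<close>

lemma mean_square_limit_product:
  fixes X Y :: "nat \<Rightarrow> 'w \<Rightarrow> real"
  assumes X [measurable]: "\<And>n. X n \<in> borel_measurable M" "X' \<in> borel_measurable M"
    and limX: "\<And>w. w \<in> space M \<Longrightarrow> (\<lambda>n. X n w) \<longlonglongrightarrow> X' w"
    and intX: "\<And>n m. integrable M (\<lambda>w. X n w * X m w)"
    and cauchyX: "cross_moment_limit M X X c"
    and Y [measurable]: "\<And>n. Y n \<in> borel_measurable M" "Y' \<in> borel_measurable M"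
    and limY: "\<And>w. w \<in> space M \<Longrightarrow> (\<lambda>n. Y n w) \<longlonglongrightarrow> Y' w"
    and intY: "\<And>n m. integrable M (\<lambda>w. Y n w * Y m w)"
    and cauchyY: "cross_moment_limit M Y Y c'"
    and prod: "cross_moment_limit M X Y d"
  shows "integrable M (\<lambda>w. X' w * Y' w)" "integral\<^sup>L M (\<lambda>w. X' w * Y' w) = d"
proof -
  note x = mean_square_limit[OF X limX intX cauchyX] and y = mean_square_limit[OF Y limY intY cauchyY]
  show XY: "integrable M (\<lambda>w. X' w * Y' w)"
    using x y by (intro integrable_mult_of_squares) auto
  have sqX: "integrable M (\<lambda>w. (X n w)\<^sup>2)" and sqY: "integrable M (\<lambda>w. (Y n w)\<^sup>2)" for n
    using intX[of n n] intY[of n n] by (simp_all add: power2_eq_square)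
  have XYn: "integrable M (\<lambda>w. X n w * Y n w)" for n
    by (intro integrable_mult_of_squares sqX sqY) auto
  have limY2: "(\<lambda>n. integral\<^sup>L M (\<lambda>w. (Y n w)\<^sup>2)) \<longlonglongrightarrow> c'"
    using cross_moment_limit_tendsto[OF cauchyY] by (simp add: power2_eq_square)
  define C where "C = (c' + integral\<^sup>L M (\<lambda>w. (X' w)\<^sup>2)) / 2"
  have bound: "\<bar>d - integral\<^sup>L M (\<lambda>w. X' w * Y' w)\<bar> \<le> \<delta> * C" if "\<delta> > 0" for \<delta>
  proof (rule LIMSEQ_le)
    show "(\<lambda>n. \<bar>integral\<^sup>L M (\<lambda>w. X n w * Y n w) - integral\<^sup>L M (\<lambda>w. X' w * Y' w)\<bar>)
        \<longlonglongrightarrow> \<bar>d - integral\<^sup>L M (\<lambda>w. X' w * Y' w)\<bar>"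
      by (intro tendsto_intros cross_moment_limit_tendsto prod)
    let ?R = "\<lambda>n. integral\<^sup>L M (\<lambda>w. (X n w - X' w)\<^sup>2) / (2 * \<delta>) + \<delta> / 2 * integral\<^sup>L M (\<lambda>w. (Y n w)\<^sup>2)
      + (\<delta> / 2 * integral\<^sup>L M (\<lambda>w. (X' w)\<^sup>2) + integral\<^sup>L M (\<lambda>w. (Y n w - Y' w)\<^sup>2) / (2 * \<delta>))"
    have "?R \<longlonglongrightarrow> 0 / (2 * \<delta>) + \<delta> / 2 * c' + (\<delta> / 2 * integral\<^sup>L M (\<lambda>w. (X' w)\<^sup>2) + 0 / (2 * \<delta>))"
      by (intro tendsto_intros x(3) y(3) limY2) (use that in auto)
    moreover have "0 / (2 * \<delta>) + \<delta> / 2 * c' + (\<delta> / 2 * integral\<^sup>L M (\<lambda>w. (X' w)\<^sup>2) + 0 / (2 * \<delta>)) = \<delta> * C"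
      by (simp add: C_def field_simps)
    ultimately show "?R \<longlonglongrightarrow> \<delta> * C"
      by (simp only:)
    have amgm: "\<bar>a * b\<bar> \<le> a\<^sup>2 / (2 * \<delta>) + \<delta> / 2 * b\<^sup>2" for a b
    proof -
      have "0 \<le> (\<bar>a\<bar> - \<delta> * \<bar>b\<bar>)\<^sup>2 / (2 * \<delta>)"
        using that by simp
      also have "\<dots> = a\<^sup>2 / (2 * \<delta>) + \<delta> / 2 * b\<^sup>2 - \<bar>a * b\<bar>"
        using that by (simp add: power2_diff power_mult_distrib abs_mult field_simps power2_eq_square)
      finally show ?thesis by simp
    qed
    have "\<bar>integral\<^sup>L M (\<lambda>w. X n w * Y n w) - integral\<^sup>L M (\<lambda>w. X' w * Y' w)\<bar> \<le> ?R n" for n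
    proof -
      have "integral\<^sup>L M (\<lambda>w. X n w * Y n w) - integral\<^sup>L M (\<lambda>w. X' w * Y' w) =
          integral\<^sup>L M (\<lambda>w. X n w * Y n w - X' w * Y' w)"
        using XYn XY by simp
      also have "\<bar>\<dots>\<bar> \<le> integral\<^sup>L M (\<lambda>w. \<bar>X n w * Y n w - X' w * Y' w\<bar>)"
        by (rule integral_abs_bound)
      also have "\<dots> \<le> integral\<^sup>L M (\<lambda>w. (X n w - X' w)\<^sup>2 / (2 * \<delta>) + \<delta> / 2 * (Y n w)\<^sup>2
          + (\<delta> / 2 * (X' w)\<^sup>2 + (Y n w - Y' w)\<^sup>2 / (2 * \<delta>)))"
      proof (rule integral_mono)
        fix w
        have "X n w * Y n w - X' w * Y' w = (X n w - X' w) * Y n w + (Y n w - Y' w) * X' w"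
          by (simp add: algebra_simps)
        then show "\<bar>X n w * Y n w - X' w * Y' w\<bar> \<le> (X n w - X' w)\<^sup>2 / (2 * \<delta>) + \<delta> / 2 * (Y n w)\<^sup>2
          + (\<delta> / 2 * (X' w)\<^sup>2 + (Y n w - Y' w)\<^sup>2 / (2 * \<delta>))"
          using amgm[of "X n w - X' w" "Y n w"] amgm[of "Y n w - Y' w" "X' w"] by linarith
      qed (use XYn XY x(1,2) y(1) sqY in auto)
      also have "\<dots> = ?R n"
        using x(1,2) y(1) sqY by simp
      finally show ?thesis .
    qed
    then show "\<exists>N. \<forall>n\<ge>N. \<bar>integral\<^sup>L M (\<lambda>w. X n w * Y n w) - integral\<^sup>L M (\<lambda>w. X' w * Y' w)\<bar> \<le> ?R n" by blast
  qed
  have "\<bar>d - integral\<^sup>L M (\<lambda>w. X' w * Y' w)\<bar> \<le> 0"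
  proof (rule field_le_epsilon)
    fix e :: real assume "e > 0"
    have "\<bar>d - integral\<^sup>L M (\<lambda>w. X' w * Y' w)\<bar> \<le> e / (\<bar>C\<bar> + 1) * C"
      using \<open>e > 0\<close> by (intro bound) auto
    also have "\<dots> \<le> e / (\<bar>C\<bar> + 1) * (\<bar>C\<bar> + 1)"
      using \<open>e > 0\<close> by (intro mult_left_mono) auto
    finally show "\<bar>d - integral\<^sup>L M (\<lambda>w. X' w * Y' w)\<bar> \<le> 0 + e" by simp
  qed
  then show "integral\<^sup>L M (\<lambda>w. X' w * Y' w) = d" by simp
qed

section \<open>The squared covariance function\<close>

definition sq_cov :: "real \<Rightarrow> real^2 \<Rightarrow> real" where
  "sq_cov k z = (bessel_J0 (k * norm z))\<^sup>2"

text \<open>First derivative of the squared covariance in \<open>q = z \<bullet> z\<close>; the next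
  definition is the second. The profile is smooth at \<open>q = 0\<close>, so gradient and Hessian
  below are valid at coinciding points as well.\<close>

definition sq_cov_profile' :: "real \<Rightarrow> real \<Rightarrow> real" where
  "sq_cov_profile' k q = - k\<^sup>2 * (j0_series (k\<^sup>2 * q) * j1_series (k\<^sup>2 * q))"

definition sq_cov_profile'' :: "real \<Rightarrow> real \<Rightarrow> real" where
  "sq_cov_profile'' k q = k ^ 4 * ((j1_series (k\<^sup>2 * q))\<^sup>2 / 2 - j0_series (k\<^sup>2 * q) * j1_series_deriv (k\<^sup>2 * q))"

definition sq_cov_hess :: "real \<Rightarrow> real^2 \<Rightarrow> real^2 \<Rightarrow> real^2 \<Rightarrow> real" where
  "sq_cov_hess k z u v = 2 * (u \<bullet> v) * sq_cov_profile' k (z \<bullet> z)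
     + 4 * (z \<bullet> u) * (z \<bullet> v) * sq_cov_profile'' k (z \<bullet> z)"

definition sq_cov_grad :: "real \<Rightarrow> real^2 \<Rightarrow> real^2 \<Rightarrow> real" where
  "sq_cov_grad k z u = 2 * (z \<bullet> u) * sq_cov_profile' k (z \<bullet> z)"

lemma sq_cov_eq: "sq_cov k z = (j0_series (k\<^sup>2 * (z \<bullet> z)))\<^sup>2"
  by (simp add: sq_cov_def bessel_J0_eq_series power_mult_distrib power2_norm_eq_inner)

lemma has_real_derivative_sq_cov_profile:
  "((\<lambda>q. (j0_series (k\<^sup>2 * q))\<^sup>2) has_real_derivative sq_cov_profile' k q) (at q)"
  by (rule derivative_eq_intros refl)+ (simp add: sq_cov_profile'_def)

lemma has_real_derivative_sq_cov_profile':
  "(sq_cov_profile' k has_real_derivative sq_cov_profile'' k q) (at q)"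
  unfolding sq_cov_profile'_def[abs_def]
  by (rule derivative_eq_intros refl)+
    (simp add: sq_cov_profile''_def power2_eq_square power4_eq_xxxx algebra_simps)

lemma inner_line_derivative:
  "((\<lambda>a. (z + a *\<^sub>R u) \<bullet> (z + a *\<^sub>R u)) has_real_derivative 2 * ((z + a *\<^sub>R u) \<bullet> u)) (at a)"
  "((\<lambda>a. (z + a *\<^sub>R u) \<bullet> v) has_real_derivative u \<bullet> v) (at a)"
  unfolding inner_add_left inner_add_right inner_scaleR_left inner_scaleR_right
  by (auto intro!: derivative_eq_intros simp: inner_commute algebra_simps)

lemma has_real_derivative_sq_cov:
  "((\<lambda>a. sq_cov k (z + a *\<^sub>R u)) has_real_derivative sq_cov_grad k (z + a *\<^sub>R u) u) (at a)"
  unfolding sq_cov_eq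
  using DERIV_chain2[OF has_real_derivative_sq_cov_profile inner_line_derivative(1)]
  by (simp add: sq_cov_grad_def mult_ac)

lemma has_real_derivative_sq_cov_grad:
  "((\<lambda>a. sq_cov_grad k (z + a *\<^sub>R v) u) has_real_derivative sq_cov_hess k (z + a *\<^sub>R v) u v) (at a)"
proof -
  have "((\<lambda>a. 2 * ((z + a *\<^sub>R v) \<bullet> u) * sq_cov_profile' k ((z + a *\<^sub>R v) \<bullet> (z + a *\<^sub>R v))) has_real_derivative
      2 * (v \<bullet> u) * sq_cov_profile' k ((z + a *\<^sub>R v) \<bullet> (z + a *\<^sub>R v)) +
      sq_cov_profile'' k ((z + a *\<^sub>R v) \<bullet> (z + a *\<^sub>R v)) * (2 * ((z + a *\<^sub>R v) \<bullet> v)) * (2 * ((z + a *\<^sub>R v) \<bullet> u))) (at a)"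
    by (intro DERIV_mult DERIV_cmult inner_line_derivative
        DERIV_chain2[OF has_real_derivative_sq_cov_profile' inner_line_derivative(1)])
  then show ?thesis
    unfolding sq_cov_grad_def sq_cov_hess_def
    by (rule DERIV_cong) (simp add: inner_commute algebra_simps)
qed

lemma continuous_on_sq_cov_hess [continuous_intros]:
  "continuous_on S f \<Longrightarrow> continuous_on S (\<lambda>x. sq_cov_hess k (f x) u v)"
  unfolding sq_cov_hess_def sq_cov_profile'_def sq_cov_profile''_def by (intro continuous_intros) auto

text \<open>In two dimensions the second derivative along the normals is the Laplacian minus the second
  derivative along the tangents; the latter integrates to boundary terms.\<close>

lemma sq_cov_hess_normal:
  "sq_cov_hess k z (seg_normal S) (seg_normal T) =
    - 2 * k\<^sup>2 * (seg_normal S \<bullet> seg_normal T) * bessel_sq_diff (k * norm z)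
    - sq_cov_hess k z (seg_tangent S) (seg_tangent T)"
proof -
  define q where "q = z \<bullet> z"
  have tt: "seg_tangent S \<bullet> seg_tangent T = seg_normal S \<bullet> seg_normal T"
    by (simp add: inner_real2 seg_tangent_def seg_normal_def)
  \<comment> \<open>The frames of \<open>S\<close> and \<open>T\<close> differ by a rotation, so the
    two products add up to the squared norm times the cosine of the angle between them.\<close>
  have zz: "(z \<bullet> seg_normal S) * (z \<bullet> seg_normal T) + (z \<bullet> seg_tangent S) * (z \<bullet> seg_tangent T)
      = q * (seg_normal S \<bullet> seg_normal T)"
    by (simp add: inner_real2 seg_tangent_def seg_normal_def q_def algebra_simps)
  \<comment> \<open>The left side is the planar Laplacian of a function of
    \<open>z \<bullet> z\<close>; Bessel's equation eliminates
    \<open>j1_series_deriv\<close>.\<close>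
  have lap: "4 * sq_cov_profile' k q + 4 * q * sq_cov_profile'' k q = - 2 * k\<^sup>2 * bessel_sq_diff (k * norm z)"
  proof -
    have n2: "(k * norm z)\<^sup>2 = k\<^sup>2 * q"
      by (simp add: power_mult_distrib power2_norm_eq_inner q_def)
    have J1: "(bessel_J1 (k * norm z))\<^sup>2 = k\<^sup>2 * q * (j1_series (k\<^sup>2 * q))\<^sup>2"
      unfolding bessel_J1_def power_mult_distrib[of _ "j1_series _"] n2 ..
    have J0: "(bessel_J0 (k * norm z))\<^sup>2 = j0_series (k\<^sup>2 * q) * j0_series (k\<^sup>2 * q)"
      unfolding bessel_J0_eq_series n2 by (simp add: power2_eq_square)
    have ode: "2 * (k\<^sup>2 * q) * j1_series_deriv (k\<^sup>2 * q) + 2 * j1_series (k\<^sup>2 * q) = j0_series (k\<^sup>2 * q)"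
      by (rule j0_series_ode)
    have "4 * (- K * (a * b)) + 4 * q * (K\<^sup>2 * (b\<^sup>2 / 2 - a * c)) = - 2 * K * (a * a - K * q * b\<^sup>2)"
      if "2 * (K * q) * c + 2 * b = a" for K a b c :: real
      unfolding that[symmetric] by (simp add: power2_eq_square algebra_simps)
    from this[OF ode] show ?thesis
      unfolding sq_cov_profile'_def sq_cov_profile''_def bessel_sq_diff_def J0 J1 by simp
  qed
  have "sq_cov_hess k z (seg_normal S) (seg_normal T) + sq_cov_hess k z (seg_tangent S) (seg_tangent T) =
      4 * (seg_normal S \<bullet> seg_normal T) * sq_cov_profile' k q +
      4 * ((z \<bullet> seg_normal S) * (z \<bullet> seg_normal T) + (z \<bullet> seg_tangent S) * (z \<bullet> seg_tangent T)) * sq_cov_profile'' k q"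
    unfolding sq_cov_hess_def tt q_def[symmetric] by (simp add: algebra_simps)
  also have "\<dots> = (seg_normal S \<bullet> seg_normal T) * (4 * sq_cov_profile' k q + 4 * q * sq_cov_profile'' k q)"
    unfolding zz by (simp add: algebra_simps)
  finally show ?thesis
    unfolding lap by (simp add: algebra_simps)
qed

text \<open>The mean value theorem once in each variable. The steps \<open>h\<close> and
  \<open>h'\<close> stay independent, as the double limit in \<open>cross_moment_limit\<close>
  requires.\<close>

lemma second_difference_mvt:
  fixes P :: "real \<Rightarrow> real \<Rightarrow> real"
  assumes Pa: "\<And>a b. ((\<lambda>a. P a b) has_real_derivative Pa a b) (at a)"
    and Pab: "\<And>a b. (Pa a has_real_derivative Pab a b) (at b)"
    and h: "0 < h" "0 < h'"
  shows "\<exists>\<xi> \<eta>. 0 < \<xi> \<and> \<xi> < h \<and> 0 < \<eta> \<and> \<eta> < h' \<and> P h h' - P h 0 - P 0 h' + P 0 0 = h * h' * Pab \<xi> \<eta>"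
proof -
  obtain \<xi> where \<xi>: "0 < \<xi>" "\<xi> < h" "(P h h' - P h 0) - (P 0 h' - P 0 0) = (h - 0) * (Pa \<xi> h' - Pa \<xi> 0)"
    using MVT2[OF h(1), of "\<lambda>a. P a h' - P a 0" "\<lambda>a. Pa a h' - Pa a 0"] DERIV_diff[OF Pa Pa] by blast
  obtain \<eta> where \<eta>: "0 < \<eta>" "\<eta> < h'" "Pa \<xi> h' - Pa \<xi> 0 = (h' - 0) * Pab \<xi> \<eta>"
    using MVT2[OF h(2), of "Pa \<xi>" "Pab \<xi>"] Pab by blast
  show ?thesis
    using \<xi> \<eta> by (intro exI[of _ \<xi>] exI[of _ \<eta>]) (simp add: algebra_simps)
qed

text \<open>\<open>z\<close> stands for the difference of two points, of which \<open>x\<close>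
  displaces the first and \<open>y\<close> the second; hence the minus sign in front of
  \<open>y\<close>.\<close>

definition sq_cov_diff2 :: "real \<Rightarrow> real^2 \<Rightarrow> real^2 \<Rightarrow> real^2 \<Rightarrow> real" where
  "sq_cov_diff2 k z x y = sq_cov k (z + x - y) - sq_cov k (z + x) - sq_cov k (z - y) + sq_cov k z"

text \<open>The second displacement enters negatively, so the quotient tends to minus the Hessian;
  continuity of the Hessian absorbs the intermediate point of the mean value theorem.\<close>

lemma sq_cov_second_difference:
  assumes "e > 0"
  shows "\<exists>\<delta>>0. \<forall>h h'. 0 < h \<longrightarrow> h < \<delta> \<longrightarrow> 0 < h' \<longrightarrow> h' < \<delta> \<longrightarrow>
    \<bar>sq_cov_diff2 k z (h *\<^sub>R u) (h' *\<^sub>R v) / (h * h')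
      + sq_cov_hess k z u v\<bar> < e"
proof -
  have "continuous_on UNIV (\<lambda>p. sq_cov_hess k (z + fst p *\<^sub>R u - snd p *\<^sub>R v) u v)"
    by (intro continuous_intros)
  then have "isCont (\<lambda>p. sq_cov_hess k (z + fst p *\<^sub>R u - snd p *\<^sub>R v) u v) (0, 0)"
    by (simp add: continuous_on_eq_continuous_at)
  then obtain d where d: "d > 0" "\<And>p. dist p (0, 0) < d \<Longrightarrow>
      dist (sq_cov_hess k (z + fst p *\<^sub>R u - snd p *\<^sub>R v) u v) (sq_cov_hess k z u v) < e"
    using assms unfolding continuous_at_eps_delta by fastforce
  have "\<bar>sq_cov_diff2 k z (h *\<^sub>R u) (h' *\<^sub>R v) / (h * h')
      + sq_cov_hess k z u v\<bar> < e" if h: "0 < h" "h < d / 2" "0 < h'" "h' < d / 2" for h h'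
  proof -
    define P where "P a b = sq_cov k (z + a *\<^sub>R u - b *\<^sub>R v)" for a b
    have Pa: "((\<lambda>a. P a b) has_real_derivative sq_cov_grad k (z + a *\<^sub>R u - b *\<^sub>R v) u) (at a)" for a b
      using has_real_derivative_sq_cov[of k "z - b *\<^sub>R v" u a] by (simp add: P_def algebra_simps)
    have Pab: "((\<lambda>b. sq_cov_grad k (z + a *\<^sub>R u - b *\<^sub>R v) u) has_real_derivative
        - sq_cov_hess k (z + a *\<^sub>R u - b *\<^sub>R v) u v) (at b)" for a b
    proof -
      have "((\<lambda>b. sq_cov_grad k (z + a *\<^sub>R u + (- b) *\<^sub>R v) u) has_real_derivative
        sq_cov_hess k (z + a *\<^sub>R u + (- b) *\<^sub>R v) u v * (- 1)) (at b)"
        by (rule DERIV_chain2[OF has_real_derivative_sq_cov_grad]) (auto intro!: derivative_eq_intros)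
      then show ?thesis by simp
    qed
    obtain \<xi> \<eta> where \<xi>\<eta>: "0 < \<xi>" "\<xi> < h" "0 < \<eta>" "\<eta> < h'"
      "P h h' - P h 0 - P 0 h' + P 0 0 = h * h' * (- sq_cov_hess k (z + \<xi> *\<^sub>R u - \<eta> *\<^sub>R v) u v)"
      using second_difference_mvt[OF Pa Pab h(1,3)] by blast
    have "dist (\<xi>, \<eta>) (0, 0) \<le> \<bar>\<xi>\<bar> + \<bar>\<eta>\<bar>"
      using norm_Pair_le[of \<xi> \<eta>] by (simp add: dist_norm)
    also have "\<dots> < d"
      using \<xi>\<eta> h by linarith
    finally have "\<bar>sq_cov_hess k (z + \<xi> *\<^sub>R u - \<eta> *\<^sub>R v) u v - sq_cov_hess k z u v\<bar> < e"
      using d(2)[of "(\<xi>, \<eta>)"] by (simp add: dist_real_def)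
    moreover have "(P h h' - P h 0 - P 0 h' + P 0 0) / (h * h') = - sq_cov_hess k (z + \<xi> *\<^sub>R u - \<eta> *\<^sub>R v) u v"
      using \<xi>\<eta>(5) h by simp
    ultimately show ?thesis
      by (simp add: P_def sq_cov_diff2_def abs_minus_commute)
  qed
  then show ?thesis
    using d(1) by (intro exI[of _ "d / 2"]) auto
qed

lemma sq_cov_bounds: "k \<ge> 0 \<Longrightarrow> 0 \<le> sq_cov k z \<and> sq_cov k z \<le> 1"
  using abs_bessel_J0_le_1[of "k * norm z"] by (simp add: sq_cov_def abs_square_le_1)

text \<open>The integrand is minus a mixed derivative in \<open>t\<close> and \<open>s\<close>. What
  remains is an alternating sum of four values in \<open>{0..1}\<close>, bounded independently of
  \<open>k\<close>.\<close>

lemma double_integral_sq_cov_hess_tangent: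
  assumes "k \<ge> 0" "0 \<le> L" "0 \<le> L'"
  shows "\<bar>integral {0..L'} (\<lambda>s. integral {0..L} (\<lambda>t. sq_cov_hess k (z + t *\<^sub>R u - s *\<^sub>R v) u v))\<bar> \<le> 2"
proof -
  have inner: "integral {0..L} (\<lambda>t. sq_cov_hess k (z + t *\<^sub>R u - s *\<^sub>R v) u v) =
      sq_cov_grad k (z + L *\<^sub>R u - s *\<^sub>R v) v - sq_cov_grad k (z - s *\<^sub>R v) v" for s
  proof -
    have "((\<lambda>t. sq_cov_hess k (z + t *\<^sub>R u - s *\<^sub>R v) u v) has_integral
        (sq_cov_grad k (z - s *\<^sub>R v + L *\<^sub>R u) v - sq_cov_grad k (z - s *\<^sub>R v + 0 *\<^sub>R u) v)) {0..L}"
    proof (rule has_integral_real_derivative)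
      fix t
      have "sq_cov_hess k w v u = sq_cov_hess k w u v" for w
        by (simp add: sq_cov_hess_def inner_commute mult_ac)
      then show "((\<lambda>t. sq_cov_grad k (z - s *\<^sub>R v + t *\<^sub>R u) v) has_real_derivative
          sq_cov_hess k (z + t *\<^sub>R u - s *\<^sub>R v) u v) (at t within {0..L})"
        using has_field_derivative_at_within[OF has_real_derivative_sq_cov_grad[of k "z - s *\<^sub>R v" u v t]]
        by (simp add: algebra_simps)
    qed fact
    then show ?thesis
      by (simp add: integral_unique algebra_simps)
  qed
  have outer: "((\<lambda>s. sq_cov_grad k (w - s *\<^sub>R v) v) has_integral (sq_cov k w - sq_cov k (w - L' *\<^sub>R v))) {0..L'}" for w
  proof -
    have "((\<lambda>s. sq_cov_grad k (w - s *\<^sub>R v) v) has_integral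
        (- sq_cov k (w + (- L') *\<^sub>R v) - - sq_cov k (w + (- 0) *\<^sub>R v))) {0..L'}"
    proof (rule has_integral_real_derivative)
      fix s
      have "((\<lambda>s. sq_cov k (w + (- s) *\<^sub>R v)) has_real_derivative sq_cov_grad k (w + (- s) *\<^sub>R v) v * (- 1)) (at s)"
        by (rule DERIV_chain2[OF has_real_derivative_sq_cov]) (auto intro!: derivative_eq_intros)
      from has_field_derivative_at_within[OF DERIV_minus[OF this]]
      show "((\<lambda>s. - sq_cov k (w + (- s) *\<^sub>R v)) has_real_derivative sq_cov_grad k (w - s *\<^sub>R v) v) (at s within {0..L'})"
        by simp
    qed fact
    then show ?thesis by simp
  qed
  have "integral {0..L'} (\<lambda>s. integral {0..L} (\<lambda>t. sq_cov_hess k (z + t *\<^sub>R u - s *\<^sub>R v) u v)) =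
      (sq_cov k (z + L *\<^sub>R u) - sq_cov k (z + L *\<^sub>R u - L' *\<^sub>R v)) - (sq_cov k z - sq_cov k (z - L' *\<^sub>R v))"
    unfolding inner by (rule integral_unique[OF has_integral_diff[OF outer outer]])
  then show ?thesis
    using sq_cov_bounds[OF assms(1), of "z + L *\<^sub>R u"] sq_cov_bounds[OF assms(1), of "z + L *\<^sub>R u - L' *\<^sub>R v"]
      sq_cov_bounds[OF assms(1), of z] sq_cov_bounds[OF assms(1), of "z - L' *\<^sub>R v"]
    by (simp add: abs_le_iff)
qed

section \<open>Integrating a random field along a segment\<close>

text \<open>Joint measurability for Fubini's theorem. Rounding \<open>t\<close> down to a grid of
  mesh \<open>1 / (n + 1)\<close> leaves countably many sections, each measurable in the random
  variable, and continuity recovers \<open>f\<close> in the limit.\<close>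

lemma borel_measurable_pair_continuous:
  fixes f :: "real \<Rightarrow> 'w \<Rightarrow> real"
  assumes meas: "\<And>t. f t \<in> borel_measurable M"
    and cont: "\<And>w. w \<in> space M \<Longrightarrow> continuous_on UNIV (\<lambda>t. f t w)"
  shows "(\<lambda>p. f (fst p) (snd p)) \<in> borel_measurable (borel \<Otimes>\<^sub>M M)"
proof (rule borel_measurable_LIMSEQ_real[where
      u = "\<lambda>n p. f (of_int \<lfloor>real (Suc n) * fst p\<rfloor> / real (Suc n)) (snd p)"])
  let ?r = "\<lambda>n t. of_int \<lfloor>real (Suc n) * t\<rfloor> / real (Suc n) :: real"
  fix p assume "p \<in> space ((borel :: real measure) \<Otimes>\<^sub>M M)"
  then have "snd p \<in> space M"
    by (auto simp: space_pair_measure)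
  then have "isCont (\<lambda>t. f t (snd p)) (fst p)"
    using cont by (simp add: continuous_on_eq_continuous_at)
  moreover have "(\<lambda>n. ?r n (fst p)) \<longlonglongrightarrow> fst p"
  proof (rule LIM_zero_cancel, rule Lim_null_comparison)
    show "(\<lambda>n. 1 / real (Suc n)) \<longlonglongrightarrow> 0"
      using LIMSEQ_inverse_real_of_nat by (simp add: inverse_eq_divide)
    have "norm (?r n x - x) \<le> 1 / real (Suc n)" for n x
    proof -
      have "?r n x - x = (of_int \<lfloor>real (Suc n) * x\<rfloor> - real (Suc n) * x) / real (Suc n)"
        by (simp add: field_simps)
      moreover have "\<bar>of_int \<lfloor>real (Suc n) * x\<rfloor> - real (Suc n) * x\<bar> \<le> 1"
        by linarith
      ultimately show ?thesis
        by (simp add: divide_right_mono)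
    qed
    then show "\<forall>\<^sub>F n in sequentially. norm (?r n (fst p) - fst p) \<le> 1 / real (Suc n)"
      by simp
  qed
  ultimately show "(\<lambda>n. f (of_int \<lfloor>real (Suc n) * fst p\<rfloor> / real (Suc n)) (snd p)) \<longlonglongrightarrow> f (fst p) (snd p)"
    by (rule isCont_tendsto_compose)
next
  fix n
  show "(\<lambda>p. f (of_int \<lfloor>real (Suc n) * fst p\<rfloor> / real (Suc n)) (snd p)) \<in> borel_measurable (borel \<Otimes>\<^sub>M M)"
  proof (rule measurable_compose_countable[where f = "\<lambda>(i::int) p. f (of_int i / real (Suc n)) (snd p)"
        and g = "\<lambda>p. \<lfloor>real (Suc n) * fst p\<rfloor>"])
    show "(\<lambda>p. f (of_int i / real (Suc n)) (snd p)) \<in> borel_measurable (borel \<Otimes>\<^sub>M M)" for i :: int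
      by (rule measurable_compose[OF measurable_snd meas])
    show "(\<lambda>p. \<lfloor>real (Suc n) * fst p\<rfloor>) \<in> measurable (borel \<Otimes>\<^sub>M M) (count_space UNIV)"
      by measurable
  qed
qed

text \<open>Shaped for two successive applications: the first and third conclusions along one
  segment become the hypotheses \<open>int\<close> and \<open>bound\<close> along the other. The
  case \<open>W = 1\<close> gives the means.\<close>

lemma expectation_integral_times:
  fixes f :: "real \<Rightarrow> 'w \<Rightarrow> real"
  assumes M: "prob_space M"
    and meas: "\<And>t. f t \<in> borel_measurable M"
    and cont: "\<And>w. w \<in> space M \<Longrightarrow> continuous_on UNIV (\<lambda>t. f t w)"
    and W: "W \<in> borel_measurable M"
    and int: "\<And>t. integrable M (\<lambda>w. f t w * W w)"
    and bound: "\<And>t. integral\<^sup>L M (\<lambda>w. \<bar>f t w * W w\<bar>) \<le> c"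
    and L: "0 \<le> L"
  shows "integrable M (\<lambda>w. (LINT t:{0..L}|lborel. f t w) * W w)"
    and "integral\<^sup>L M (\<lambda>w. (LINT t:{0..L}|lborel. f t w) * W w) = (LINT t:{0..L}|lborel. integral\<^sup>L M (\<lambda>w. f t w * W w))"
    and "integral\<^sup>L M (\<lambda>w. \<bar>(LINT t:{0..L}|lborel. f t w) * W w\<bar>) \<le> c * L"
proof -
  interpret prob_space M by fact
  interpret P: pair_sigma_finite lborel M ..
  define g where "g t w = indicator {0..L} t * (f t w * W w)" for t w
  have c: "0 \<le> c"
    using bound[of 0] by (rule order_trans[rotated]) simp
  have sets_eq: "sets (lborel \<Otimes>\<^sub>M M) = sets (borel \<Otimes>\<^sub>M M)"
    by (rule sets_pair_measure_cong) simp_all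
  have "(\<lambda>p. f (fst p) (snd p)) \<in> borel_measurable (lborel \<Otimes>\<^sub>M M)"
    using borel_measurable_pair_continuous[OF meas cont] measurable_cong_sets[OF sets_eq refl] by blast
  moreover have "(\<lambda>p. W (snd p)) \<in> borel_measurable (lborel \<Otimes>\<^sub>M M)"
    by (rule measurable_compose[OF measurable_snd W])
  moreover have "(\<lambda>p. indicator {0..L} (fst p) :: real) \<in> borel_measurable (lborel \<Otimes>\<^sub>M M)"
    by (rule measurable_compose[OF measurable_fst]) simp
  ultimately have gm: "(\<lambda>p. g (fst p) (snd p)) \<in> borel_measurable (lborel \<Otimes>\<^sub>M M)"
    unfolding g_def by (intro borel_measurable_times)
  have norm_g: "(\<integral>w. norm (g t w) \<partial>M) \<le> indicator {0..L} t * c" for t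
    using bound[of t] by (auto simp: g_def indicator_def)
  have int_c: "integrable lborel (\<lambda>t. indicator {0..L} t * c)"
    using L by (intro integrable_mult_left integrable_real_indicator) auto
  have int_norm: "integrable lborel (\<lambda>t. \<integral>w. norm (g t w) \<partial>M)"
  proof (rule Bochner_Integration.integrable_bound[OF int_c])
    have "(\<lambda>p. norm (g (fst p) (snd p))) \<in> borel_measurable (lborel \<Otimes>\<^sub>M M)"
      by (rule measurable_compose[OF gm borel_measurable_norm])
    then have "(\<lambda>(t, w). norm (g t w)) \<in> borel_measurable (lborel \<Otimes>\<^sub>M M)"
      by (simp add: split_beta')
    then show "(\<lambda>t. \<integral>w. norm (g t w) \<partial>M) \<in> borel_measurable lborel"
      by (rule borel_measurable_lebesgue_integral)
    show "AE t in lborel. norm (\<integral>w. norm (g t w) \<partial>M) \<le> norm (indicator {0..L} t * c)"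
      using norm_g c by (auto intro!: AE_I2)
  qed
  have int_g: "integrable (lborel \<Otimes>\<^sub>M M) (\<lambda>p. g (fst p) (snd p))"
  proof (rule P.Fubini_integrable[OF gm])
    show "integrable lborel (\<lambda>t. \<integral>w. norm (g (fst (t, w)) (snd (t, w))) \<partial>M)"
      using int_norm by simp
    show "AE t in lborel. integrable M (\<lambda>w. g (fst (t, w)) (snd (t, w)))"
      using int by (auto simp: g_def)
  qed
  then have int_g': "integrable (lborel \<Otimes>\<^sub>M M) (case_prod g)"
    by (simp add: split_beta')
  have eq: "(\<integral>t. g t w \<partial>lborel) = (LINT t:{0..L}|lborel. f t w) * W w" for w
    unfolding g_def set_lebesgue_integral_def
    by (subst integral_mult_left_zero[symmetric]) (simp add: mult.assoc)
  show 1: "integrable M (\<lambda>w. (LINT t:{0..L}|lborel. f t w) * W w)"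
    using P.integrable_snd[OF int_g'] unfolding eq .
  have "integral\<^sup>L M (\<lambda>w. \<integral>t. g t w \<partial>lborel) = (\<integral>t. integral\<^sup>L M (g t) \<partial>lborel)"
    by (rule P.Fubini_integral[OF int_g'])
  moreover have "integral\<^sup>L M (g t) = indicator {0..L} t *\<^sub>R integral\<^sup>L M (\<lambda>w. f t w * W w)" for t
    unfolding g_def[abs_def] by simp
  ultimately show "integral\<^sup>L M (\<lambda>w. (LINT t:{0..L}|lborel. f t w) * W w) = (LINT t:{0..L}|lborel. integral\<^sup>L M (\<lambda>w. f t w * W w))"
    unfolding eq by (simp only: set_lebesgue_integral_def)
  have int_ng: "integrable (lborel \<Otimes>\<^sub>M M) (case_prod (\<lambda>t w. norm (g t w)))"
    using integrable_norm[OF int_g] by (simp add: split_beta')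
  have "integral\<^sup>L M (\<lambda>w. \<bar>\<integral>t. g t w \<partial>lborel\<bar>) \<le> integral\<^sup>L M (\<lambda>w. \<integral>t. norm (g t w) \<partial>lborel)"
  proof (rule integral_mono)
    show "integrable M (\<lambda>w. \<bar>\<integral>t. g t w \<partial>lborel\<bar>)"
      unfolding eq using 1 by auto
    show "integrable M (\<lambda>w. \<integral>t. norm (g t w) \<partial>lborel)"
      by (rule P.integrable_snd[OF int_ng])
    show "\<bar>\<integral>t. g t w \<partial>lborel\<bar> \<le> (\<integral>t. norm (g t w) \<partial>lborel)" for w
      using integral_norm_bound[of lborel "\<lambda>t. g t w"] by simp
  qed
  also have "\<dots> = (\<integral>t. \<integral>w. norm (g t w) \<partial>M \<partial>lborel)"
    by (rule P.Fubini_integral[OF int_ng])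
  also have "\<dots> \<le> (\<integral>t. indicator {0..L} t * c \<partial>lborel)"
    by (rule integral_mono[OF int_norm int_c norm_g])
  also have "\<dots> = c * L"
    using L by simp
  finally show "integral\<^sup>L M (\<lambda>w. \<bar>(LINT t:{0..L}|lborel. f t w) * W w\<bar>) \<le> c * L"
    unfolding eq .
qed

section \<open>Smooth functions and their gradients\<close>

lemma smooth_fun_gradient:
  fixes f :: "'a::euclidean_space \<Rightarrow> real"
  assumes "smooth_fun f"
  shows "(f has_derivative (\<lambda>h. h \<bullet> gradient f x)) (at x)"
    and "continuous_on UNIV (gradient f)"
proof -
  have C1: "Ck_fun (Suc 0) f"
    using assms by (simp only: smooth_fun_def)
  then have diff: "f differentiable (at x)" for x
    by (simp add: differentiable_on_def)
  \<comment> \<open>The candidate is assembled from the partial derivatives, from which it inherits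
    continuity.\<close>
  define D where "D x = (\<Sum>b\<in>Basis. frechet_derivative f (at x) b *\<^sub>R b)" for x
  have D: "(f has_derivative (\<lambda>h. h \<bullet> D x)) (at x)" for x
  proof -
    have fd: "(f has_derivative frechet_derivative f (at x)) (at x)"
      using diff frechet_derivative_works by blast
    interpret bounded_linear "frechet_derivative f (at x)"
      using fd by (rule has_derivative_bounded_linear)
    have "frechet_derivative f (at x) h = h \<bullet> D x" for h
    proof -
      have "frechet_derivative f (at x) h = frechet_derivative f (at x) (\<Sum>b\<in>Basis. (h \<bullet> b) *\<^sub>R b)"
        by (simp only: euclidean_representation)
      also have "\<dots> = (\<Sum>b\<in>Basis. (h \<bullet> b) * frechet_derivative f (at x) b)"
        by (simp only: sum scaleR real_scaleR_def)
      also have "\<dots> = h \<bullet> D x"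
        by (simp add: D_def inner_sum_right mult.commute)
      finally show ?thesis .
    qed
    then have "frechet_derivative f (at x) = (\<lambda>h. h \<bullet> D x)" by (rule ext)
    with fd show ?thesis by simp
  qed
  have grad: "gradient f x = D x" for x
    unfolding gradient_def
  proof (rule the_equality)
    show "GDERIV f x :> D x"
      using D by (simp add: gderiv_def)
    fix D' assume "GDERIV f x :> D'"
    then have "(\<lambda>h. h \<bullet> D') = (\<lambda>h. h \<bullet> D x)"
      using has_derivative_unique[OF _ D] by (simp add: gderiv_def)
    then show "D' = D x"
      by (metis vector_eq_ldot)
  qed
  then have "gradient f = D" by (rule ext)
  then show "(f has_derivative (\<lambda>h. h \<bullet> gradient f x)) (at x)"
    using D by simp
  have "continuous_on UNIV D"
    unfolding D_def using C1 by (intro continuous_intros) auto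
  then show "continuous_on UNIV (gradient f)"
    using \<open>gradient f = D\<close> by simp
qed

section \<open>The field on a fixed energy level\<close>

text \<open>The covariance of the fluxes through \<open>S\<close> and \<open>T\<close>, as shown in
  \<open>seg_flux_cov\<close>.\<close>

definition seg_pair_integral :: "real \<Rightarrow> oseg \<Rightarrow> oseg \<Rightarrow> real" where
  "seg_pair_integral k S T =
    (LINT s:{0..seg_length T}|lborel. LINT t:{0..seg_length S}|lborel.
      - sq_cov_hess k (seg_param S t - seg_param T s) (seg_normal S) (seg_normal T) / 2)"

context
  fixes M :: "'w measure" and B :: "real^2 \<Rightarrow> 'w \<Rightarrow> real" and E :: real
  assumes berry: "berry_wave M E B"
begin

interpretation prob_space M
  using berry by (simp add: berry_wave_def)

abbreviation (input) wave_number :: real where "wave_number \<equiv> 2 * pi * sqrt E"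

lemma berry_linear: "gaussian_rv M (\<lambda>w. a * B x w + b * B y w)"
proof -
  \<comment> \<open>The index set \<open>{x, y}\<close> collapses when \<open>x = y\<close>.
    Coefficients built from two conditionals then add up, which covers both cases.\<close>
  have "gaussian_rv M (\<lambda>w. \<Sum>i\<in>{x, y}. ((if i = x then a else 0) + (if i = y then b else 0)) * B i w)"
  proof -
    have "gaussian_field M B"
      using berry by (simp add: berry_wave_def)
    then show ?thesis
      unfolding gaussian_field_def by simp
  qed
  also have "(\<lambda>w. \<Sum>i\<in>{x, y}. ((if i = x then a else 0) + (if i = y then b else 0)) * B i w) =
      (\<lambda>w. a * B x w + b * B y w)"
    by (cases "x = y") (auto simp: algebra_simps)
  finally show ?thesis .
qed

lemma berry_gaussian: "gaussian_rv M (B x)"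
  using berry_linear[of 1 x 0 x] by simp

lemma berry_measurable [measurable]: "B x \<in> borel_measurable M"
  using berry_gaussian by (simp add: gaussian_rv_def)

lemma berry_mean: "expectation (B x) = 0"
  using berry by (simp add: berry_wave_def)

lemma berry_cov: "expectation (\<lambda>w. B x w * B y w) = bessel_J0 (wave_number * norm (x - y))"
  using berry by (simp add: berry_wave_def)

lemma berry_variance: "expectation (\<lambda>w. (B x w)\<^sup>2) = 1"
  using berry_cov[of x x] by (simp add: power2_eq_square bessel_J0_0)

lemma
  shows berry_sq_integrable: "integrable M (\<lambda>w. (B x w)\<^sup>2 * (B y w)\<^sup>2)"
    and berry_sq_cov: "expectation (\<lambda>w. (B x w)\<^sup>2 * (B y w)\<^sup>2) = 1 + 2 * sq_cov wave_number (x - y)"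
  using gaussian_pair_square_moment[OF prob_space_axioms berry_gaussian berry_mean berry_variance
      berry_gaussian berry_mean berry_variance _ _ berry_cov, of x y]
    berry_linear[of 1 x 1 y] berry_linear[of 1 x "-1" y]
  by (simp_all add: sq_cov_def)

text \<open>Difference quotient of \<open>B^2 / 2\<close> along \<open>u\<close>. It involves only
  values of the field, whose mixed moments are known, and tends to the flux density.\<close>

definition sq_quotient :: "real \<Rightarrow> real^2 \<Rightarrow> real^2 \<Rightarrow> 'w \<Rightarrow> real" where
  "sq_quotient h x u w = ((B (x + h *\<^sub>R u) w)\<^sup>2 - (B x w)\<^sup>2) / (2 * h)"

definition flux_density :: "real^2 \<Rightarrow> real^2 \<Rightarrow> 'w \<Rightarrow> real" where
  "flux_density x u w = B x w * (gradient (\<lambda>y. B y w) x \<bullet> u)"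

lemma sq_quotient_measurable [measurable]: "sq_quotient h x u \<in> borel_measurable M"
  unfolding sq_quotient_def[abs_def] by measurable

lemma
  shows sq_quotient_integrable: "integrable M (\<lambda>w. sq_quotient h x u w * sq_quotient h' y v w)"
    and sq_quotient_cov: "expectation (\<lambda>w. sq_quotient h x u w * sq_quotient h' y v w) =
      sq_cov_diff2 wave_number (x - y) (h *\<^sub>R u) (h' *\<^sub>R v) / (h * h') / 2"
proof -
  have eq: "sq_quotient h x u w * sq_quotient h' y v w =
      ((B (x + h *\<^sub>R u) w)\<^sup>2 * (B (y + h' *\<^sub>R v) w)\<^sup>2 - (B (x + h *\<^sub>R u) w)\<^sup>2 * (B y w)\<^sup>2
        - (B x w)\<^sup>2 * (B (y + h' *\<^sub>R v) w)\<^sup>2 + (B x w)\<^sup>2 * (B y w)\<^sup>2) / (4 * (h * h'))" for w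
    by (simp add: sq_quotient_def algebra_simps)
  show "integrable M (\<lambda>w. sq_quotient h x u w * sq_quotient h' y v w)"
    unfolding eq using berry_sq_integrable by auto
  have "expectation (\<lambda>w. sq_quotient h x u w * sq_quotient h' y v w) =
    ((1 + 2 * sq_cov wave_number (x + h *\<^sub>R u - (y + h' *\<^sub>R v))) - (1 + 2 * sq_cov wave_number (x + h *\<^sub>R u - y))
      - (1 + 2 * sq_cov wave_number (x - (y + h' *\<^sub>R v))) + (1 + 2 * sq_cov wave_number (x - y))) / (4 * (h * h'))"
    unfolding eq using berry_sq_integrable by (simp add: berry_sq_cov)
  also have "\<dots> = (sq_cov wave_number (x + h *\<^sub>R u - (y + h' *\<^sub>R v)) - sq_cov wave_number (x + h *\<^sub>R u - y)
      - sq_cov wave_number (x - (y + h' *\<^sub>R v)) + sq_cov wave_number (x - y)) / (h * h') / 2"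
    by (simp add: add_divide_distrib diff_divide_distrib)
  finally show "expectation (\<lambda>w. sq_quotient h x u w * sq_quotient h' y v w) =
      sq_cov_diff2 wave_number (x - y) (h *\<^sub>R u) (h' *\<^sub>R v) / (h * h') / 2"
    by (simp add: sq_cov_diff2_def algebra_simps)
qed

abbreviation (input) step :: "nat \<Rightarrow> real" where "step n \<equiv> inverse (real (Suc n))"

lemma sq_quotient_tendsto:
  assumes "w \<in> space M"
  shows "(\<lambda>n. sq_quotient (step n) x u w) \<longlonglongrightarrow> flux_density x u w"
proof -
  have smooth: "smooth_fun (\<lambda>x. B x w)"
    using berry assms by (simp add: berry_wave_def)
  have "((\<lambda>h. B (x + h *\<^sub>R u) w) has_derivative (\<lambda>h. (h *\<^sub>R u) \<bullet> gradient (\<lambda>y. B y w) x)) (at 0)"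
  proof -
    have 1: "((\<lambda>h. x + h *\<^sub>R u) has_derivative (\<lambda>h. h *\<^sub>R u)) (at 0)"
      by (auto intro!: derivative_eq_intros)
    have 2: "((\<lambda>y. B y w) has_derivative (\<lambda>h. h \<bullet> gradient (\<lambda>y. B y w) x)) (at (x + 0 *\<^sub>R u))"
      using smooth_fun_gradient(1)[OF smooth, of x] by simp
    show ?thesis
      using has_derivative_compose[OF 1 2] by simp
  qed
  then have d: "((\<lambda>h. B (x + h *\<^sub>R u) w) has_real_derivative gradient (\<lambda>y. B y w) x \<bullet> u) (at 0)"
    unfolding has_field_derivative_def by (rule has_derivative_eq_rhs) (auto simp: inner_commute)
  have "((\<lambda>h. (B (x + h *\<^sub>R u) w)\<^sup>2 / 2) has_real_derivative flux_density x u w) (at 0)"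
    by (rule derivative_eq_intros d refl)+ (auto simp: flux_density_def)
  then have "((\<lambda>h. ((B (x + h *\<^sub>R u) w)\<^sup>2 / 2 - (B x w)\<^sup>2 / 2) / h) \<longlongrightarrow> flux_density x u w) (at 0)"
    by (simp add: has_field_derivative_iff)
  moreover have "(\<lambda>h. ((B (x + h *\<^sub>R u) w)\<^sup>2 / 2 - (B x w)\<^sup>2 / 2) / h) = (\<lambda>h. sq_quotient h x u w)"
    by (auto simp: sq_quotient_def field_simps)
  ultimately have "((\<lambda>h. sq_quotient h x u w) \<longlongrightarrow> flux_density x u w) (at 0)"
    by simp
  moreover have "filterlim step (at 0) sequentially"
    using LIMSEQ_inverse_real_of_nat by (simp add: filterlim_at del: of_nat_Suc)
  ultimately show ?thesis
    by (rule filterlim_compose)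
qed

lemma flux_density_measurable [measurable]: "flux_density x u \<in> borel_measurable M"
  by (rule borel_measurable_LIMSEQ_real[OF sq_quotient_tendsto]) simp_all

lemma sq_quotient_cov_limit:
  "cross_moment_limit M (\<lambda>n. sq_quotient (step n) x u) (\<lambda>n. sq_quotient (step n) y v)
    (- sq_cov_hess wave_number (x - y) u v / 2)"
  unfolding cross_moment_limit_def
proof (intro allI impI)
  fix e :: real assume e: "e > 0"
  obtain \<delta> where \<delta>: "\<delta> > 0" "\<And>h h'. 0 < h \<Longrightarrow> h < \<delta> \<Longrightarrow> 0 < h' \<Longrightarrow> h' < \<delta> \<Longrightarrow>
    \<bar>sq_cov_diff2 wave_number (x - y) (h *\<^sub>R u) (h' *\<^sub>R v) / (h * h')
      + sq_cov_hess wave_number (x - y) u v\<bar> < e"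
    using sq_cov_second_difference[OF e, of wave_number "x - y" u v] by blast
  have "\<forall>\<^sub>F n in sequentially. step n < \<delta>"
    using LIMSEQ_inverse_real_of_nat \<delta>(1) by (rule order_tendstoD)
  then obtain N where N: "\<And>n. n \<ge> N \<Longrightarrow> step n < \<delta>"
    by (auto simp: eventually_sequentially)
  have "\<bar>A / 2 - (- H / 2)\<bar> \<le> e" if "\<bar>A + H\<bar> < e" for A H
    using that by linarith
  from this[OF \<delta>(2)[OF _ N _ N]]
  show "\<exists>N. \<forall>n\<ge>N. \<forall>m\<ge>N. \<bar>expectation (\<lambda>w. sq_quotient (step n) x u w * sq_quotient (step m) y v w)
      - (- sq_cov_hess wave_number (x - y) u v / 2)\<bar> \<le> e"
    unfolding sq_quotient_cov by (intro exI[of _ N] allI impI) simp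
qed

text \<open>Since their cross moments converge, the quotients approach the flux densities in mean
  square and not only pointwise, so the covariance passes to the limit.\<close>

lemma
  shows flux_density_integrable: "integrable M (\<lambda>w. flux_density x u w * flux_density y v w)"
    and flux_density_cov: "expectation (\<lambda>w. flux_density x u w * flux_density y v w) =
      - sq_cov_hess wave_number (x - y) u v / 2"
proof -
  note * = mean_square_limit_product[OF sq_quotient_measurable flux_density_measurable sq_quotient_tendsto
      sq_quotient_integrable sq_quotient_cov_limit sq_quotient_measurable flux_density_measurable
      sq_quotient_tendsto sq_quotient_integrable sq_quotient_cov_limit sq_quotient_cov_limit]
  show "integrable M (\<lambda>w. flux_density x u w * flux_density y v w)"
    by (rule *(1))
  show "expectation (\<lambda>w. flux_density x u w * flux_density y v w) = - sq_cov_hess wave_number (x - y) u v / 2"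
    by (rule *(2))
qed

text \<open>The field has variance 1 at every point, so the quotients have mean 0; the product limit
  with the constant 1 as second factor transfers this to the flux density.\<close>

lemma
  shows flux_density_integrable1: "integrable M (flux_density x u)"
    and flux_density_mean: "expectation (flux_density x u) = 0"
proof -
  have sqint: "integrable M (\<lambda>w. (B x w)\<^sup>2)" for x
    using gaussian_rv_moments(2)[OF prob_space_axioms berry_gaussian berry_mean] .
  have zero: "expectation (\<lambda>w. sq_quotient h x u w * 1) = 0" for h
    unfolding sq_quotient_def using sqint by (simp add: berry_variance)
  note * = mean_square_limit_product[where Y = "\<lambda>_ _. 1" and Y' = "\<lambda>_. 1" and c' = 1 and d = 0,
      OF sq_quotient_measurable flux_density_measurable sq_quotient_tendsto
      sq_quotient_integrable sq_quotient_cov_limit]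
  have "integrable M (\<lambda>w. flux_density x u w * 1)" "expectation (\<lambda>w. flux_density x u w * 1) = 0"
    by (rule *; simp add: zero[simplified] prob_space cross_moment_limit_def)+
  then show "integrable M (flux_density x u)" "expectation (flux_density x u) = 0"
    by simp_all
qed

definition seg_flux :: "oseg \<Rightarrow> 'w \<Rightarrow> real" where
  "seg_flux S w = (LINT t:{0..seg_length S}|lborel. flux_density (seg_param S t) (seg_normal S) w)"

lemma flux_density_continuous:
  assumes "w \<in> space M"
  shows "continuous_on UNIV (\<lambda>t. flux_density (seg_param S t) u w)"
proof -
  have smooth: "smooth_fun (\<lambda>x. B x w)"
    using berry assms by (simp add: berry_wave_def)
  have "continuous_on UNIV (\<lambda>x. B x w)"
    using smooth_fun_gradient(1)[OF smooth]
    by (auto intro!: continuous_at_imp_continuous_on has_derivative_continuous)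
  moreover have "continuous_on UNIV (seg_param S)"
    by (intro continuous_intros)
  ultimately have "continuous_on UNIV (\<lambda>t. B (seg_param S t) w)"
    "continuous_on UNIV (\<lambda>t. gradient (\<lambda>y. B y w) (seg_param S t))"
    using smooth_fun_gradient(2)[OF smooth] by (auto intro: continuous_on_compose2)
  then show ?thesis
    unfolding flux_density_def by (intro continuous_intros)
qed

lemma expectation_abs_mult_le:
  fixes X Y :: "'w \<Rightarrow> real"
  assumes [measurable]: "X \<in> borel_measurable M" "Y \<in> borel_measurable M"
    and X: "integrable M (\<lambda>w. X w * X w)" "expectation (\<lambda>w. X w * X w) \<le> c"
    and Y: "integrable M (\<lambda>w. Y w * Y w)" "expectation (\<lambda>w. Y w * Y w) \<le> c"
  shows "expectation (\<lambda>w. \<bar>X w * Y w\<bar>) \<le> c"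
proof -
  have "expectation (\<lambda>w. \<bar>X w * Y w\<bar>) \<le> expectation (\<lambda>w. (X w * X w + Y w * Y w) / 2)"
  proof (rule integral_mono)
    show "integrable M (\<lambda>w. \<bar>X w * Y w\<bar>)"
      using integrable_mult_of_squares[of X M Y] X Y by (simp add: power2_eq_square)
    show "integrable M (\<lambda>w. (X w * X w + Y w * Y w) / 2)"
      using X Y by simp
    show "\<bar>X w * Y w\<bar> \<le> (X w * X w + Y w * Y w) / 2" for w
      using sum_squares_bound[of "\<bar>X w\<bar>" "\<bar>Y w\<bar>"] by (simp add: abs_mult power2_eq_square)
  qed
  also have "\<dots> \<le> c"
    using X Y by simp
  finally show ?thesis .
qed

text \<open>At coinciding points the covariance of the flux density does not depend on the point.\<close>

lemma flux_density_bound: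
  assumes "u \<bullet> u = 1" "v \<bullet> v = 1"
  shows "expectation (\<lambda>w. \<bar>flux_density x u w * flux_density y v w\<bar>) \<le> - sq_cov_profile' wave_number 0"
proof (rule expectation_abs_mult_le)
  have "expectation (\<lambda>w. flux_density x u w * flux_density x u w) = - sq_cov_profile' wave_number 0"
    if "u \<bullet> u = 1" for x u
    unfolding flux_density_cov using that by (simp add: sq_cov_hess_def)
  then show "expectation (\<lambda>w. flux_density x u w * flux_density x u w) \<le> - sq_cov_profile' wave_number 0"
    "expectation (\<lambda>w. flux_density y v w * flux_density y v w) \<le> - sq_cov_profile' wave_number 0"
    using assms by simp_all
qed (simp_all add: flux_density_integrable)

lemma
  assumes S: "is_oseg S"
  shows seg_flux_integrable1: "integrable M (seg_flux S)"
    and seg_flux_mean: "expectation (seg_flux S) = 0"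
proof -
  have L: "0 \<le> seg_length S"
    using S by (simp add: is_oseg_def)
  have 1: "integrable M (\<lambda>w. flux_density x u w * 1)" for x u
    using flux_density_integrable1 by simp
  \<comment> \<open>\<open>expectation_abs_mult_le\<close> asks for one bound on both second
    moments, and that of the constant factor is 1.\<close>
  have 2: "expectation (\<lambda>w. \<bar>flux_density x u w * 1\<bar>) \<le> max 1 (- sq_cov_profile' wave_number 0)" if "u \<bullet> u = 1" for x u
    by (rule expectation_abs_mult_le) (use that in \<open>simp_all add: flux_density_integrable flux_density_cov sq_cov_hess_def prob_space\<close>)
  note * = expectation_integral_times[OF prob_space_axioms flux_density_measurable flux_density_continuous
      borel_measurable_const 1 2[OF seg_normal_normal] L]
  show "integrable M (seg_flux S)"
    using *(1)[of S S] by (simp add: seg_flux_def[abs_def])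
  show "expectation (seg_flux S) = 0"
    using *(2)[of S S] by (simp add: seg_flux_def[abs_def] flux_density_mean)
qed

lemma
  assumes S: "is_oseg S" and T: "is_oseg T"
  shows seg_flux_integrable: "integrable M (\<lambda>w. seg_flux T w * seg_flux S w)"
    and seg_flux_cov: "expectation (\<lambda>w. seg_flux T w * seg_flux S w) = seg_pair_integral wave_number S T"
proof -
  have L: "0 \<le> seg_length S" "0 \<le> seg_length T"
    using S T by (simp_all add: is_oseg_def)
  let ?f = "\<lambda>S t. flux_density (seg_param S t) (seg_normal S)"
  have meas: "seg_flux S \<in> borel_measurable M"
    using seg_flux_integrable1[OF S] by simp
  \<comment> \<open>First application: along \<open>S\<close>, against the flux density at a fixed
    point.\<close>
  note * = expectation_integral_times[OF prob_space_axioms flux_density_measurable flux_density_continuous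
      flux_density_measurable flux_density_integrable flux_density_bound[OF seg_normal_normal] L(1)]
  have 1: "integrable M (\<lambda>w. seg_flux S w * flux_density x v w)"
    "expectation (\<lambda>w. seg_flux S w * flux_density x v w) =
      (LINT t:{0..seg_length S}|lborel. expectation (\<lambda>w. ?f S t w * flux_density x v w))"
    "expectation (\<lambda>w. \<bar>seg_flux S w * flux_density x v w\<bar>) \<le> - sq_cov_profile' wave_number 0 * seg_length S"
    if "v \<bullet> v = 1" for x v
    unfolding seg_flux_def by (rule *[OF _ that]; assumption)+
  have int: "integrable M (\<lambda>w. ?f T s w * seg_flux S w)" for s
    using 1(1)[OF seg_normal_normal, of "seg_param T s" T] by (simp add: mult.commute)
  have bound: "expectation (\<lambda>w. \<bar>?f T s w * seg_flux S w\<bar>) \<le> - sq_cov_profile' wave_number 0 * seg_length S" for s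
    using 1(3)[OF seg_normal_normal, of "seg_param T s" T] by (simp add: mult.commute)
  have val: "expectation (\<lambda>w. ?f T s w * seg_flux S w) =
      (LINT t:{0..seg_length S}|lborel. - sq_cov_hess wave_number (seg_param S t - seg_param T s) (seg_normal S) (seg_normal T) / 2)" for s
    using 1(2)[OF seg_normal_normal, of "seg_param T s" T]
    by (subst mult.commute) (simp add: flux_density_cov)
  \<comment> \<open>Second application: along \<open>T\<close>, against the whole flux through
    \<open>S\<close>.\<close>
  note 2 = expectation_integral_times[OF prob_space_axioms flux_density_measurable flux_density_continuous
      meas int bound L(2), folded seg_flux_def]
  show "integrable M (\<lambda>w. seg_flux T w * seg_flux S w)"
    by (rule 2(1))
  show "expectation (\<lambda>w. seg_flux T w * seg_flux S w) = seg_pair_integral wave_number S T"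
    by (rule trans[OF 2(2)]) (simp_all only: val seg_pair_integral_def)
qed

lemma phi_eq:
  assumes C: "polygonal_chain C" and w: "w \<in> space M"
  shows "phi E B C w = 1 / (8 * pi * sqrt (2 * E)) * (\<Sum>k<length C. seg_flux (C ! k) w)"
proof -
  have smooth: "smooth_fun (\<lambda>x. B x w)"
    using berry w by (simp add: berry_wave_def)
  have "continuous_on UNIV (\<lambda>x. B x w)"
    using smooth_fun_gradient(1)[OF smooth]
    by (auto intro!: continuous_at_imp_continuous_on has_derivative_continuous)
  then have "continuous_on UNIV (\<lambda>x. B x w *\<^sub>R gradient (\<lambda>y. B y w) x)"
    using smooth_fun_gradient(2)[OF smooth] by (intro continuous_intros)
  from integral_chain_normal[OF C this] show ?thesis
    by (simp add: phi_def seg_flux_def flux_density_def)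
qed

lemma covariance_phi_eq:
  assumes C: "polygonal_chain C" and D: "polygonal_chain D"
  shows "covariance M (phi E B C) (phi E B D) = (1 / (8 * pi * sqrt (2 * E)))\<^sup>2 *
    (\<Sum>i<length C. \<Sum>k<length D. seg_pair_integral wave_number (C ! i) (D ! k))"
proof -
  let ?c = "1 / (8 * pi * sqrt (2 * E))"
  have oseg: "is_oseg (C ! i)" if "polygonal_chain C" "i < length C" for C i
    using that by (auto simp: polygonal_chain_def)
  have mean: "expectation (phi E B C) = 0" if "polygonal_chain C" for C
  proof -
    have "expectation (phi E B C) = expectation (\<lambda>w. ?c * (\<Sum>k<length C. seg_flux (C ! k) w))"
      by (rule Bochner_Integration.integral_cong) (simp_all add: phi_eq[OF that])
    also have "\<dots> = ?c * (\<Sum>k<length C. expectation (seg_flux (C ! k)))"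
      using oseg[OF that] by (simp add: seg_flux_integrable1)
    also have "\<dots> = 0"
      using oseg[OF that] by (simp add: seg_flux_mean)
    finally show ?thesis .
  qed
  have "covariance M (phi E B C) (phi E B D) =
      expectation (\<lambda>w. ?c\<^sup>2 * (\<Sum>i<length C. \<Sum>k<length D. seg_flux (D ! k) w * seg_flux (C ! i) w))"
    unfolding covariance_def mean[OF C] mean[OF D]
  proof (rule Bochner_Integration.integral_cong[OF refl])
    fix w assume w: "w \<in> space M"
    have "(\<Sum>i<length C. \<Sum>k<length D. seg_flux (D ! k) w * seg_flux (C ! i) w) =
        (\<Sum>i<length C. seg_flux (C ! i) w) * (\<Sum>k<length D. seg_flux (D ! k) w)"
      by (simp add: sum_product mult.commute)
    then show "(phi E B C w - 0) * (phi E B D w - 0) =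
        ?c\<^sup>2 * (\<Sum>i<length C. \<Sum>k<length D. seg_flux (D ! k) w * seg_flux (C ! i) w)"
      unfolding phi_eq[OF C w] phi_eq[OF D w] by (simp add: power2_eq_square)
  qed
  also have "\<dots> = ?c\<^sup>2 * (\<Sum>i<length C. \<Sum>k<length D. seg_pair_integral wave_number (C ! i) (D ! k))"
  proof -
    have int: "integrable M (\<lambda>w. seg_flux (D ! k) w * seg_flux (C ! i) w)" if "i < length C" "k < length D" for i k
      using oseg[OF C] oseg[OF D] that by (intro seg_flux_integrable)
    have "expectation (\<lambda>w. \<Sum>i<length C. \<Sum>k<length D. seg_flux (D ! k) w * seg_flux (C ! i) w) =
        (\<Sum>i<length C. expectation (\<lambda>w. \<Sum>k<length D. seg_flux (D ! k) w * seg_flux (C ! i) w))"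
      using int by (intro Bochner_Integration.integral_sum Bochner_Integration.integrable_sum) auto
    also have "\<dots> = (\<Sum>i<length C. \<Sum>k<length D. expectation (\<lambda>w. seg_flux (D ! k) w * seg_flux (C ! i) w))"
      using int by (intro sum.cong refl Bochner_Integration.integral_sum) auto
    also have "\<dots> = (\<Sum>i<length C. \<Sum>k<length D. seg_pair_integral wave_number (C ! i) (D ! k))"
      by (intro sum.cong refl seg_flux_cov) (auto intro: oseg C D)
    finally show ?thesis
      by (simp only: integral_mult_right_zero)
  qed
  finally show ?thesis .
qed

end

section \<open>High-energy asymptotics\<close>

text \<open>Signed distance of a point of \<open>T\<close> from the line of \<open>S\<close>;
  \<open>seg_foot\<close> is the parameter on that line of its orthogonal projection. Both are
  affine in \<open>s\<close>, as the oscillatory integrals expect.\<close>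

definition seg_height :: "oseg \<Rightarrow> oseg \<Rightarrow> real \<Rightarrow> real" where
  "seg_height S T s = (seg_param T s - seg_start S) \<bullet> seg_normal S"

definition seg_foot :: "oseg \<Rightarrow> oseg \<Rightarrow> real \<Rightarrow> real" where
  "seg_foot S T s = (seg_param T s - seg_start S) \<bullet> seg_tangent S"

lemma seg_height_affine:
  "seg_height S T s = (seg_start T - seg_start S) \<bullet> seg_normal S + (seg_tangent T \<bullet> seg_normal S) * s"
  by (simp add: seg_height_def seg_param_eq inner_diff_left inner_add_left algebra_simps)

lemma seg_foot_affine:
  "seg_foot S T s = (seg_start T - seg_start S) \<bullet> seg_tangent S + (seg_tangent T \<bullet> seg_tangent S) * s"
  by (simp add: seg_foot_def seg_param_eq inner_diff_left inner_add_left algebra_simps)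

text \<open>On the line of \<open>S\<close> the two signs add up to 2 strictly inside
  \<open>S\<close>, to 1 at an endpoint and to 0 outside, so apart from endpoints this is
  \<open>4 / pi\<close> times the indicator of \<open>S\<close>.\<close>

definition overlap_limit :: "oseg \<Rightarrow> oseg \<Rightarrow> real \<Rightarrow> real" where
  "overlap_limit S T s = (if seg_height S T s = 0
     then 2 / pi * (sgn (seg_length S - seg_foot S T s) + sgn (seg_foot S T s)) else 0)"

lemma inner_square_frame: "(y \<bullet> seg_tangent S)\<^sup>2 + (y \<bullet> seg_normal S)\<^sup>2 = y \<bullet> y"
proof -
  let ?c = "cos (seg_angle S)" and ?s = "sin (seg_angle S)"
  have "(a * c + b * s)\<^sup>2 + (- a * s + b * c)\<^sup>2 = (a * a + b * b) * (c\<^sup>2 + s\<^sup>2)" for a b c s :: real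
    by (simp add: power2_eq_square algebra_simps)
  from this[of "y $ 1" ?c "y $ 2" ?s] show ?thesis
    by (simp add: inner_real2 seg_tangent_def seg_normal_def)
qed

lemma norm_seg_param_diff:
  "norm (seg_param S t - seg_param T s) = sqrt ((seg_height S T s)\<^sup>2 + (t - seg_foot S T s)\<^sup>2)"
proof -
  define y where "y = seg_param S t - seg_param T s"
  have "y \<bullet> seg_normal S = - seg_height S T s" "y \<bullet> seg_tangent S = t - seg_foot S T s"
    by (simp_all add: y_def seg_height_def seg_foot_def seg_param_eq[of S] inner_diff_left inner_add_left)
  then have "y \<bullet> y = (seg_height S T s)\<^sup>2 + (t - seg_foot S T s)\<^sup>2"
    unfolding inner_square_frame[of y S, symmetric] by (simp only: power2_minus add.commute)
  then show ?thesis
    unfolding y_def[symmetric] norm_eq_sqrt_inner by simp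
qed

lemma seg_param_mem_seg_set_iff:
  "seg_param T s \<in> seg_set S \<longleftrightarrow>
    seg_height S T s = 0 \<and>
    seg_foot S T s \<in> {0..seg_length S}"
proof -
  have "seg_param S t = seg_param T s \<longleftrightarrow>
    seg_height S T s = 0 \<and>
    t = seg_foot S T s" for t
  proof -
    have "seg_param S t = seg_param T s \<longleftrightarrow> norm (seg_param S t - seg_param T s) = 0"
      by simp
    also have "\<dots> \<longleftrightarrow> seg_height S T s = 0 \<and>
        t - seg_foot S T s = 0"
      unfolding norm_seg_param_diff real_sqrt_eq_0_iff sum_power2_eq_zero_iff ..
    finally show ?thesis by auto
  qed
  then show ?thesis
    unfolding seg_set_def by (auto simp: image_iff eq_commute[of "seg_param T s"])
qed

text \<open>The integrand is \<open>4 / pi\<close> times the indicator of the overlap except where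
  \<open>T\<close> passes through an endpoint of \<open>S\<close>, and the injective parametrization
  leaves at most two such parameters.\<close>

lemma integral_overlap_limit:
  assumes S: "is_oseg S" and T: "is_oseg T"
  shows "integral {0..seg_length T} (overlap_limit S T) = 4 / pi * measure hausdorff1 (seg_set S \<inter> seg_set T)"
proof -
  define A where "A = {s \<in> {0..seg_length T}. seg_param T s \<in> seg_set S}"
  have A: "A = {0..seg_length T} \<inter> seg_param T -` seg_set S"
    by (auto simp: A_def)
  have A_borel: "A \<in> sets borel"
    using measurable_sets[OF seg_param_measurable seg_set_borel, of T S] unfolding A by simp
  have A_lm: "A \<in> lmeasurable"
  proof (rule bounded_set_imp_lmeasurable)
    show "bounded A" unfolding A by (rule bounded_subset[of "{0..seg_length T}"]) auto
    show "A \<in> sets lebesgue" using A_borel by simp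
  qed
  let ?N = "{s. seg_param T s \<in> {seg_param S 0, seg_param S (seg_length S)}}"
  have "finite ?N"
    using finite_vimageI[OF _ inj_seg_param, of "{seg_param S 0, seg_param S (seg_length S)}" T]
    by (simp add: vimage_def)
  have "overlap_limit S T s = 4 / pi * indicator A s" if "s \<in> {0..seg_length T} - ?N" for s
  proof -
    have L: "seg_length S > 0" using S by (simp add: is_oseg_def)
    have ne: "seg_param S t \<noteq> seg_param T s" if "t \<in> {0, seg_length S}" for t
      using \<open>s \<in> {0..seg_length T} - ?N\<close> that by auto
    have "seg_foot S T s \<noteq> 0 \<and> seg_foot S T s \<noteq> seg_length S" if "seg_height S T s = 0"
    proof -
      have "norm (seg_param S (seg_foot S T s) - seg_param T s) = 0"
        unfolding norm_seg_param_diff that by simp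
      then show ?thesis
        using ne by auto
    qed
    moreover have "indicator A s = (if seg_height S T s = 0 \<and> seg_foot S T s \<in> {0..seg_length S} then 1 else 0 :: real)"
      using that by (auto simp: A_def seg_param_mem_seg_set_iff)
    ultimately show ?thesis
      using L by (auto simp: overlap_limit_def sgn_if)
  qed
  then have "integral {0..seg_length T} (overlap_limit S T) = integral {0..seg_length T} (\<lambda>s. 4 / pi * indicator A s)"
    using negligible_finite[OF \<open>finite ?N\<close>] by (intro integral_spike[of ?N]) auto
  also have "\<dots> = 4 / pi * integral {0..seg_length T} (indicator A)"
    by simp
  also have "integral {0..seg_length T} (indicator A) = integral UNIV (\<lambda>s. if s \<in> {0..seg_length T} then indicator A s else 0 :: real)"
    by (rule integral_restrict_UNIV[symmetric])
  also have "\<dots> = integral UNIV (indicator A)"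
    by (intro integral_cong) (auto simp: A_def)
  also have "\<dots> = measure lebesgue A"
    using lmeasure_integral_UNIV[OF A_lm] by simp
  also have "\<dots> = measure lborel A"
    using A_borel by (simp add: measure_completion)
  also have "\<dots> = measure hausdorff1 (seg_set T \<inter> seg_set S)"
    by (simp add: measure_hausdorff1_seg_Int A_def)
  finally show ?thesis
    by (simp add: Int_commute)
qed

text \<open>Bridge between the Lebesgue integrals of the covariance and the gauge integrals of the
  asymptotic analysis.\<close>

lemma double_set_integral_eq_integral:
  fixes f :: "real \<Rightarrow> real \<Rightarrow> real"
  assumes "continuous_on UNIV (\<lambda>p. f (fst p) (snd p))"
  shows "(LINT s:{a..b}|lborel. LINT t:{c..d}|lborel. f s t) = integral {a..b} (\<lambda>s. integral {c..d} (f s))"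
    and "(\<lambda>s. integral {c..d} (f s)) integrable_on {a..b}"
    and "f s integrable_on {c..d}"
proof -
  have cf: "continuous_on A (f s)" for s A
  proof -
    have "continuous_on A (\<lambda>t. (s, t))" by (intro continuous_intros)
    from continuous_on_compose2[OF assms this] show ?thesis by simp
  qed
  then show fs: "f s integrable_on {c..d}" for s
    by (intro integrable_continuous_interval)
  have inner: "(LINT t:{c..d}|lborel. f s t) = integral {c..d} (f s)" for s
    by (intro set_borel_integral_eq_integral borel_integrable_atLeastAtMost' cf)
  have "continuous_on UNIV (\<lambda>s. integral (cbox c d) (f s))"
    using assms by (intro integral_continuous_on_param) (auto simp: split_beta' intro: continuous_on_subset)
  then have cI: "continuous_on {a..b} (\<lambda>s. integral {c..d} (f s))"
    by (auto intro: continuous_on_subset)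
  then show "(\<lambda>s. integral {c..d} (f s)) integrable_on {a..b}"
    by (rule integrable_continuous_interval)
  show "(LINT s:{a..b}|lborel. LINT t:{c..d}|lborel. f s t) = integral {a..b} (\<lambda>s. integral {c..d} (f s))"
    unfolding inner by (intro set_borel_integral_eq_integral borel_integrable_atLeastAtMost' cI)
qed

text \<open>By \<open>sq_cov_hess_normal\<close> the difference is half the double integral of the
  tangential second derivative, and the latter is at most 2.\<close>

lemma seg_pair_integral_bound:
  assumes S: "is_oseg S" and T: "is_oseg T" and k: "k > 0"
  shows "\<bar>seg_pair_integral k S T - (seg_normal S \<bullet> seg_normal T) * k *
    integral {0..seg_length T} (\<lambda>s. integral {0..seg_length S} (\<lambda>t.
      osc_kernel k (seg_height S T s)
        (t - seg_foot S T s)))\<bar> \<le> 1"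
proof -
  have L: "0 \<le> seg_length S" "0 \<le> seg_length T"
    using S T by (simp_all add: is_oseg_def)
  let ?z = "\<lambda>s t. seg_param S t - seg_param T s"
  let ?p = "seg_start S - seg_start T"
  let ?K = "\<lambda>s t. osc_kernel k (seg_height S T s)
        (t - seg_foot S T s)"
  let ?H = "\<lambda>s t. sq_cov_hess k (?p + t *\<^sub>R seg_tangent S - s *\<^sub>R seg_tangent T) (seg_tangent S) (seg_tangent T)"
  let ?c = "seg_normal S \<bullet> seg_normal T"
  have z: "?z s t = ?p + t *\<^sub>R seg_tangent S - s *\<^sub>R seg_tangent T" for s t
    by (simp add: seg_param_eq algebra_simps)
  have K: "?K s t = k * bessel_sq_diff (k * norm (?z s t))" for s t
    by (simp add: osc_kernel_def norm_seg_param_diff)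
  \<comment> \<open>Of the two factors \<open>k\<close> in the Laplacian one is part of
    \<open>osc_kernel\<close>; the other stays in front and sets the order of growth.\<close>
  have eq: "- sq_cov_hess k (?z s t) (seg_normal S) (seg_normal T) / 2 = ?c * k * ?K s t + ?H s t / 2" for s t
    unfolding sq_cov_hess_normal K by (simp add: z power2_eq_square algebra_simps)
  have contK: "continuous_on UNIV (\<lambda>p. ?K (fst p) (snd p))"
    unfolding osc_kernel_def seg_height_def seg_foot_def by (intro continuous_intros)
  have contH: "continuous_on UNIV (\<lambda>p. ?H (fst p) (snd p))"
    by (intro continuous_intros)
  have cont: "continuous_on UNIV (\<lambda>p. ?c * k * ?K (fst p) (snd p) + ?H (fst p) (snd p) / 2)"
    using contK contH by (intro continuous_intros) auto
  note dK = double_set_integral_eq_integral[OF contK] and dH = double_set_integral_eq_integral[OF contH]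
  have "seg_pair_integral k S T = integral {0..seg_length T} (\<lambda>s. integral {0..seg_length S} (\<lambda>t. ?c * k * ?K s t + ?H s t / 2))"
    unfolding seg_pair_integral_def eq by (rule double_set_integral_eq_integral(1)[OF cont])
  also have "\<dots> = integral {0..seg_length T} (\<lambda>s. ?c * k * integral {0..seg_length S} (?K s) + integral {0..seg_length S} (?H s) / 2)"
    using dK(3) dH(3)
    by (intro integral_cong, subst Henstock_Kurzweil_Integration.integral_add)
      (auto intro!: integrable_on_mult_right integrable_on_divide)
  also have "\<dots> = ?c * k * integral {0..seg_length T} (\<lambda>s. integral {0..seg_length S} (?K s))
      + integral {0..seg_length T} (\<lambda>s. integral {0..seg_length S} (?H s)) / 2"
    using dK(2) dH(2)
    by (subst Henstock_Kurzweil_Integration.integral_add) (auto intro!: integrable_on_mult_right integrable_on_divide)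
  finally have "seg_pair_integral k S T - ?c * k * integral {0..seg_length T} (\<lambda>s. integral {0..seg_length S} (?K s)) =
      integral {0..seg_length T} (\<lambda>s. integral {0..seg_length S} (?H s)) / 2"
    by simp
  moreover have "\<bar>integral {0..seg_length T} (\<lambda>s. integral {0..seg_length S} (?H s))\<bar> \<le> 2"
    using k L by (intro double_integral_sq_cov_hess_tangent) auto
  ultimately show ?thesis
    by simp
qed

text \<open>Division by \<open>k\<close> sends the bounded corner terms to 0 and leaves the limit of
  the oscillatory integral.\<close>

lemma seg_pair_integral_tendsto:
  assumes S: "is_oseg S" and T: "is_oseg T"
  shows "((\<lambda>k. seg_pair_integral k S T / k) \<longlongrightarrow> 4 / pi * seg_signed_length S T) at_top"
proof -
  have L: "0 \<le> seg_length S" "0 \<le> seg_length T"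
    using S T by (simp_all add: is_oseg_def)
  let ?I = "\<lambda>k. integral {0..seg_length T} (\<lambda>s. integral {0..seg_length S} (\<lambda>t.
      osc_kernel k (seg_height S T s)
        (t - seg_foot S T s)))"
  let ?c = "seg_normal S \<bullet> seg_normal T"
  have "(?I \<longlongrightarrow> integral {0..seg_length T} (overlap_limit S T)) at_top"
    using double_integral_osc_kernel_tendsto(2)[OF L, of "(seg_start T - seg_start S) \<bullet> seg_normal S"
        "seg_tangent T \<bullet> seg_normal S" "(seg_start T - seg_start S) \<bullet> seg_tangent S" "seg_tangent T \<bullet> seg_tangent S",
        folded seg_height_affine seg_foot_affine]
    unfolding overlap_limit_def[abs_def] .
  then have "((\<lambda>k. ?c * ?I k) \<longlongrightarrow> ?c * (4 / pi * measure hausdorff1 (seg_set S \<inter> seg_set T))) at_top"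
    unfolding integral_overlap_limit[OF S T] by (rule tendsto_mult_left)
  moreover have "((\<lambda>k. seg_pair_integral k S T / k - ?c * ?I k) \<longlongrightarrow> 0) at_top"
  proof (rule Lim_null_comparison)
    show "((\<lambda>k::real. 1 / k) \<longlongrightarrow> 0) at_top"
      by real_asymp
    show "\<forall>\<^sub>F k in at_top. norm (seg_pair_integral k S T / k - ?c * ?I k) \<le> 1 / k"
      using eventually_gt_at_top[of 0]
    proof eventually_elim
      case (elim k)
      have "seg_pair_integral k S T / k - ?c * ?I k = (seg_pair_integral k S T - ?c * k * ?I k) / k"
        using elim by (simp add: field_simps)
      then show ?case
        using divide_right_mono[OF seg_pair_integral_bound[OF S T elim], of k] elim by simp
    qed
  qed
  ultimately have "((\<lambda>k. (seg_pair_integral k S T / k - ?c * ?I k) + ?c * ?I k) \<longlongrightarrow>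
      0 + ?c * (4 / pi * measure hausdorff1 (seg_set S \<inter> seg_set T))) at_top"
    by (intro tendsto_add)
  then show ?thesis
    by (simp add: seg_signed_length_def mult_ac)
qed

lemma sqrt_mult_covariance_phi_tendsto:
  fixes M :: "real \<Rightarrow> 'w measure" and B :: "real \<Rightarrow> real^2 \<Rightarrow> 'w \<Rightarrow> real"
  assumes berry: "\<And>E. E > 0 \<Longrightarrow> berry_wave (M E) E (B E)"
    and C: "polygonal_chain C" and D: "polygonal_chain D"
  shows "((\<lambda>E. sqrt E * covariance (M E) (phi E (B E) C) (phi E (B E) D))
    \<longlongrightarrow> signed_length C D / (16 * pi\<^sup>2)) at_top"
proof -
  have oseg: "is_oseg (C ! i)" if "polygonal_chain C" "i < length C" for C i
    using that by (auto simp: polygonal_chain_def)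
  let ?R = "\<lambda>k. \<Sum>i<length C. \<Sum>j<length D. seg_pair_integral k (C ! i) (D ! j) / k"
  have "(?R \<longlongrightarrow> (\<Sum>i<length C. \<Sum>j<length D. 4 / pi * seg_signed_length (C ! i) (D ! j))) at_top"
    by (intro tendsto_sum seg_pair_integral_tendsto) (auto intro: oseg C D)
  then have R: "(?R \<longlongrightarrow> 4 / pi * signed_length C D) at_top"
    by (simp add: signed_length_def sum_distrib_left)
  have "filterlim (\<lambda>E. 2 * pi * sqrt E) at_top at_top"
    by (intro filterlim_tendsto_pos_mult_at_top[OF tendsto_const _ sqrt_at_top]) simp
  \<comment> \<open>With \<open>k = 2 * pi * sqrt E\<close>, the squared prefactor of
    \<open>phi\<close> times \<open>sqrt E\<close> is
    \<open>sqrt E / (128 * pi^2 * E) = 1 / (64 * pi * k)\<close>.\<close>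
  from filterlim_compose[OF R this]
  have "((\<lambda>E. 1 / (64 * pi) * ?R (2 * pi * sqrt E)) \<longlongrightarrow> 1 / (64 * pi) * (4 / pi * signed_length C D)) at_top"
    by (rule tendsto_mult_left)
  also have "1 / (64 * pi) * (4 / pi * signed_length C D) = signed_length C D / (16 * pi\<^sup>2)"
    by (simp add: power2_eq_square)
  finally show ?thesis
  proof (rule Lim_transform_eventually)
    show "\<forall>\<^sub>F E in at_top. 1 / (64 * pi) * ?R (2 * pi * sqrt E) =
        sqrt E * covariance (M E) (phi E (B E) C) (phi E (B E) D)"
      using eventually_gt_at_top[of 0]
    proof eventually_elim
      case (elim E)
      define k where "k = 2 * pi * sqrt E"
      define r where "r = (\<Sum>i<length C. \<Sum>j<length D. seg_pair_integral k (C ! i) (D ! j))"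
      have k: "k > 0"
        using elim by (simp add: k_def)
      have "covariance (M E) (phi E (B E) C) (phi E (B E) D) = (1 / (8 * pi * sqrt (2 * E)))\<^sup>2 * r"
        unfolding r_def k_def by (rule covariance_phi_eq[OF berry[OF elim] C D])
      moreover have "?R k = r / k"
        by (simp add: r_def sum_divide_distrib)
      moreover have "1 / (64 * pi) * (r / k) = sqrt E * ((1 / (8 * pi * sqrt (2 * E)))\<^sup>2 * r)"
      proof -
        have "1 / (64 * pi) * (r / (2 * pi * x)) = x * ((1 / (8 * pi * (y * x)))\<^sup>2 * r)"
          if "x > 0" "y\<^sup>2 = 2" for x y :: real
        proof -
          have "x * ((1 / (8 * pi * (y * x)))\<^sup>2 * r) = x * r / (64 * pi\<^sup>2 * (y\<^sup>2 * x\<^sup>2))"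
            by (simp add: power_divide power_mult_distrib)
          also have "\<dots> = 1 / (64 * pi) * (r / (2 * pi * x))"
            using that by (simp add: power2_eq_square)
          finally show ?thesis ..
        qed
        from this[of "sqrt E" "sqrt 2"] show ?thesis
          using elim by (simp add: k_def real_sqrt_mult)
      qed
      ultimately show ?case
        unfolding k_def[symmetric] by simp
    qed
  qed
qed

theorem theorem2p3:
  fixes M :: "real \<Rightarrow> 'w measure" and B :: "real \<Rightarrow> real^2 \<Rightarrow> 'w \<Rightarrow> real"
  assumes "\<And>E. E > 0 \<Longrightarrow> berry_wave (M E) E (B E)"
  shows "(\<forall>C1 C2. polygonal_chain C1 \<longrightarrow> polygonal_chain C2 \<longrightarrow>
            (\<lambda>E. covariance (M E) (phi E (B E) C1) (phi E (B E) C2)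
                 - signed_length C1 C2 / (16 * pi\<^sup>2 * sqrt E))
              \<in> o[at_top](\<lambda>E. 1 / sqrt E))
       \<and> (\<forall>C. polygonal_chain C \<longrightarrow>
            (\<lambda>E. prob_space.variance (M E) (phi E (B E) C)
                 - chain_length C / (16 * pi\<^sup>2 * sqrt E))
              \<in> o[at_top](\<lambda>E. 1 / sqrt E))"
proof -
  have cov: "(\<lambda>E. covariance (M E) (phi E (B E) C) (phi E (B E) D)
      - signed_length C D / (16 * pi\<^sup>2 * sqrt E)) \<in> o[at_top](\<lambda>E. 1 / sqrt E)"
    if CD: "polygonal_chain C" "polygonal_chain D" for C D
  proof (rule smalloI_tendsto)
    show "\<forall>\<^sub>F E in at_top. 1 / sqrt E \<noteq> (0 :: real)"
      using eventually_gt_at_top[of 0] by eventually_elim simp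
    have "((\<lambda>E. sqrt E * covariance (M E) (phi E (B E) C) (phi E (B E) D) - signed_length C D / (16 * pi\<^sup>2))
        \<longlongrightarrow> signed_length C D / (16 * pi\<^sup>2) - signed_length C D / (16 * pi\<^sup>2)) at_top"
      by (intro tendsto_diff tendsto_const sqrt_mult_covariance_phi_tendsto assms CD)
    then have lim: "((\<lambda>E. sqrt E * covariance (M E) (phi E (B E) C) (phi E (B E) D) - signed_length C D / (16 * pi\<^sup>2))
        \<longlongrightarrow> 0) at_top"
      by simp
    show "((\<lambda>E. (covariance (M E) (phi E (B E) C) (phi E (B E) D)
        - signed_length C D / (16 * pi\<^sup>2 * sqrt E)) / (1 / sqrt E)) \<longlongrightarrow> 0) at_top"
    proof (rule Lim_transform_eventually[OF lim])
      show "\<forall>\<^sub>F E in at_top. sqrt E * covariance (M E) (phi E (B E) C) (phi E (B E) D) - signed_length C D / (16 * pi\<^sup>2) =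
          (covariance (M E) (phi E (B E) C) (phi E (B E) D) - signed_length C D / (16 * pi\<^sup>2 * sqrt E)) / (1 / sqrt E)"
        using eventually_gt_at_top[of 0]
      proof eventually_elim
        case (elim E)
        have "x * c - l / p = (c - l / (p * x)) / (1 / x)" if "x > 0" for x c l p :: real
          using that by (simp add: left_diff_distrib)
        from this[of "sqrt E"] elim show ?case by simp
      qed
    qed
  qed
  \<comment> \<open>The second claim is the diagonal case of the first, since the length is the
    signed length of a chain with itself.\<close>
  have var: "prob_space.variance (M E) X = covariance (M E) X X" for E and X :: "'w \<Rightarrow> real"
    by (simp add: covariance_def power2_eq_square)
  show ?thesis
    unfolding var using cov by (auto simp: chain_length_eq_signed_length)
qed

end
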